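(* Let $(M,\omega)$ be a closed connected symplectic manifold equipped with a Riemannian metric $g$. For every $\phi\in Symp_0(M,\omega)$ we have $$\|\phi\|_{HL}^{\infty}=\|\phi\|_{HL}^{(1,\infty)}.$$
   Context: $M$ is closed of dimension $2n$. A symplectic isotopy is a smooth path $\Phi=\{\phi_t\}_{t\in[0,1]}$ of diffeomorphisms with $\phi_0=\mathrm{id}$ such that for each $t$ the vector field $\dot\phi_t:=\frac{d\phi_t}{dt}\circ\phi_t^{-1}$ satisfies $d(\iota(\dot\phi_t)\omega)=0$. $Symp_0(M,\omega)$ is the set of time-one maps of symplectic isotopies. Let $\mathcal H^1(M,g)$ be the space of $g$-harmonic $1$-forms; fix a basis $(h_i)_{1\le i\le b_1}$ and put $|\sum_i\lambda_ih_i|:=\sum_i|\lambda_i|$. By Hodge theory, for a symplectic isotopy $\Phi$ one has uniquely $\iota(\dot\phi_t)\omega=dU_t+\mathcal H_t$ with $\mathcal H_t\in\mathcal H^1(M,g)$ and $\int_MU_t\,\omega^n=0$. With $\mathrm{osc}(f)=\max_Mf-\min_Mf$, define $$l^{(1,\infty)}(\Phi)=\int_0^1\big(\mathrm{osc}(U_t)+|\mathcal H_t|\big)dt,\qquad l^\infty(\Phi)=\max_{t\in[0,1]}\big(\mathrm{osc}(U_t)+|\mathcal H_t|\big).$$ For $\phi\in Symp_0(M,\omega)$ let $e_0(\phi)=\inf l^{(1,\infty)}(\Phi)$ and $e_0^\infty(\phi)=\inf l^\infty(\Phi)$, the infima being over all symplectic isotopies $\Phi$ with time-one map $\phi$. Finally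 $$\|\phi\|_{HL}^{(1,\infty)}=\tfrac12\big(e_0(\phi)+e_0(\phi^{-1})\big),\qquad \|\phi\|_{HL}^{\infty}=\tfrac12\big(e_0^\infty(\phi)+e_0^\infty(\phi^{-1})\big).$$ *)

theory Defs
  imports "HOL-Analysis.Analysis" "HOL-Combinatorics.Permutations"
begin

section \<open>Smooth maps between Euclidean spaces\<close>

primrec C_on :: "nat \<Rightarrow> 'x::real_normed_vector set \<Rightarrow> ('x \<Rightarrow> 'y::real_normed_vector) \<Rightarrow> bool" where
  "C_on 0 S f \<longleftrightarrow> continuous_on S f"
| "C_on (Suc k) S f \<longleftrightarrow>
     f differentiable_on S \<and> (\<forall>v. C_on k S (\<lambda>x. frechet_derivative f (at x) v))"

text \<open>
  \<open>C_on\<close> is meaningful for open sets only. On an arbitrary set (such as \<open>{0..1} \<times> V\<close>),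
  smoothness means local extendability to a \<open>C\<^sup>\<infinity>\<close> map on an open set.
\<close>

definition smooth_on :: "'x::real_normed_vector set \<Rightarrow> ('x \<Rightarrow> 'y::real_normed_vector) \<Rightarrow> bool" where
  "smooth_on S f \<longleftrightarrow>
     (\<forall>x\<in>S. \<exists>W F. open W \<and> x \<in> W \<and> (\<forall>k. C_on k W F) \<and> (\<forall>y\<in>W \<inter> S. F y = f y))"


section \<open>Manifolds\<close>

text \<open>
  A manifold is a topological space \<open>'a\<close> (the type itself) together with a smooth atlas modelled
  on \<open>\<real>^'m\<close>. A chart is a pair of its domain and its coordinate map, the latter being
  relevant only on the domain.
\<close>

type_synonym ('a, 'm) chart = "'a set \<times> ('a \<Rightarrow> real ^ 'm)"

definition cdom :: "('a, 'm::finite) chart \<Rightarrow> 'a set" where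
  "cdom \<kappa> = fst \<kappa>"

definition cmap :: "('a, 'm::finite) chart \<Rightarrow> 'a \<Rightarrow> real ^ 'm" where
  "cmap \<kappa> = snd \<kappa>"

definition cinv :: "('a, 'm::finite) chart \<Rightarrow> real ^ 'm \<Rightarrow> 'a" where
  "cinv \<kappa> = inv_into (cdom \<kappa>) (cmap \<kappa>)"

definition is_chart :: "('a::topological_space, 'm::finite) chart \<Rightarrow> bool" where
  "is_chart \<kappa> \<longleftrightarrow> open (cdom \<kappa>) \<and> open (cmap \<kappa> ` cdom \<kappa>) \<and>
     homeomorphism (cdom \<kappa>) (cmap \<kappa> ` cdom \<kappa>) (cmap \<kappa>) (cinv \<kappa>)"

definition smooth_atlas :: "('a::topological_space, 'm::finite) chart set \<Rightarrow> bool" where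
  "smooth_atlas A \<longleftrightarrow> (\<forall>\<kappa>\<in>A. is_chart \<kappa>) \<and> (\<Union>\<kappa>\<in>A. cdom \<kappa>) = UNIV \<and>
     (\<forall>\<kappa>\<in>A. \<forall>\<kappa>'\<in>A.
        smooth_on (cmap \<kappa> ` (cdom \<kappa> \<inter> cdom \<kappa>')) (\<lambda>y. cmap \<kappa>' (cinv \<kappa> y)))"

definition closed_connected_manifold ::
    "('a::{t2_space, second_countable_topology}, 'm::finite) chart set \<Rightarrow> bool" where
  "closed_connected_manifold A \<longleftrightarrow>
     smooth_atlas A \<and> compact (UNIV :: 'a set) \<and> connected (UNIV :: 'a set)"

definition smooth_fun :: "('a, 'm::finite) chart set \<Rightarrow> ('a \<Rightarrow> real) \<Rightarrow> bool" where
  "smooth_fun A u \<longleftrightarrow> (\<forall>\<kappa>\<in>A. smooth_on (cmap \<kappa> ` cdom \<kappa>) (\<lambda>y. u (cinv \<kappa> y)))"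

definition smooth_map :: "('a::topological_space, 'm::finite) chart set \<Rightarrow> ('a \<Rightarrow> 'a) \<Rightarrow> bool" where
  "smooth_map A f \<longleftrightarrow> continuous_on UNIV f \<and>
     (\<forall>\<kappa>\<in>A. \<forall>\<kappa>'\<in>A.
        smooth_on (cmap \<kappa> ` (cdom \<kappa> \<inter> f -` cdom \<kappa>')) (\<lambda>y. cmap \<kappa>' (f (cinv \<kappa> y))))"

definition diffeomorphism :: "('a::topological_space, 'm::finite) chart set \<Rightarrow> ('a \<Rightarrow> 'a) \<Rightarrow> bool" where
  "diffeomorphism A f \<longleftrightarrow> bij f \<and> smooth_map A f \<and> smooth_map A (inv f)"

text \<open>Joint smoothness of \<open>(t, x) \<mapsto> \<Phi> t x\<close> on \<open>[0,1] \<times> M\<close>.\<close>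

definition smooth_family ::
    "('a::topological_space, 'm::finite) chart set \<Rightarrow> (real \<Rightarrow> 'a \<Rightarrow> 'a) \<Rightarrow> bool" where
  "smooth_family A \<Phi> \<longleftrightarrow> continuous_on ({0..1} \<times> UNIV) (\<lambda>(t, x). \<Phi> t x) \<and>
     (\<forall>\<kappa>\<in>A. \<forall>\<kappa>'\<in>A.
        smooth_on {(t, y). t \<in> {0..1} \<and> y \<in> cmap \<kappa> ` cdom \<kappa> \<and> \<Phi> t (cinv \<kappa> y) \<in> cdom \<kappa>'}
          (\<lambda>(t, y). cmap \<kappa>' (\<Phi> t (cinv \<kappa> y))))"


section \<open>Tensor fields\<close>

text \<open>
  A tensor field is the family of its components in the charts of the atlas; \<open>T \<kappa> p\<close> is
  the component vector or matrix at the point \<open>p\<close> with respect to the coordinates of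
  \<open>\<kappa>\<close>, relevant only for \<open>p \<in> cdom \<kappa>\<close>.
\<close>

type_synonym ('a, 'm) vec_field = "('a, 'm) chart \<Rightarrow> 'a \<Rightarrow> real ^ 'm"
type_synonym ('a, 'm) mat_field = "('a, 'm) chart \<Rightarrow> 'a \<Rightarrow> real ^ 'm ^ 'm"

definition jacobian :: "('a, 'm::finite) chart \<Rightarrow> ('a, 'm) chart \<Rightarrow> 'a \<Rightarrow> real ^ 'm ^ 'm" where
  "jacobian \<kappa> \<kappa>' p =
     matrix (frechet_derivative (\<lambda>y. cmap \<kappa>' (cinv \<kappa> y)) (at (cmap \<kappa> p)))"

definition one_form :: "('a, 'm::finite) chart set \<Rightarrow> ('a, 'm) vec_field \<Rightarrow> bool" where
  "one_form A \<alpha> \<longleftrightarrow>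
     (\<forall>\<kappa>\<in>A. smooth_on (cmap \<kappa> ` cdom \<kappa>) (\<lambda>y. \<alpha> \<kappa> (cinv \<kappa> y))) \<and>
     (\<forall>\<kappa>\<in>A. \<forall>\<kappa>'\<in>A. \<forall>p\<in>cdom \<kappa> \<inter> cdom \<kappa>'.
        \<alpha> \<kappa> p = transpose (jacobian \<kappa> \<kappa>' p) *v \<alpha> \<kappa>' p)"

definition covariant_2_tensor :: "('a, 'm::finite) chart set \<Rightarrow> ('a, 'm) mat_field \<Rightarrow> bool" where
  "covariant_2_tensor A T \<longleftrightarrow>
     (\<forall>\<kappa>\<in>A. smooth_on (cmap \<kappa> ` cdom \<kappa>) (\<lambda>y. T \<kappa> (cinv \<kappa> y))) \<and>
     (\<forall>\<kappa>\<in>A. \<forall>\<kappa>'\<in>A. \<forall>p\<in>cdom \<kappa> \<inter> cdom \<kappa>'.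
        T \<kappa> p = transpose (jacobian \<kappa> \<kappa>' p) ** T \<kappa>' p ** jacobian \<kappa> \<kappa>' p)"

definition riemannian_metric :: "('a, 'm::finite) chart set \<Rightarrow> ('a, 'm) mat_field \<Rightarrow> bool" where
  "riemannian_metric A G \<longleftrightarrow> covariant_2_tensor A G \<and>
     (\<forall>\<kappa>\<in>A. \<forall>p\<in>cdom \<kappa>. transpose (G \<kappa> p) = G \<kappa> p \<and>
        (\<forall>v. v \<noteq> 0 \<longrightarrow> 0 < v \<bullet> (G \<kappa> p *v v)))"

text \<open>\<open>pd \<kappa> i u p\<close> is the \<open>i\<close>-th partial derivative of \<open>u\<close> at \<open>p\<close>
  in the coordinates of \<open>\<kappa>\<close>.\<close>

definition pd :: "('a, 'm::finite) chart \<Rightarrow> 'm \<Rightarrow> ('a \<Rightarrow> real) \<Rightarrow> 'a \<Rightarrow> real" where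
  "pd \<kappa> i u p = frechet_derivative (\<lambda>y. u (cinv \<kappa> y)) (at (cmap \<kappa> p)) (axis i 1)"

definition d_fun :: "('a \<Rightarrow> real) \<Rightarrow> ('a, 'm::finite) vec_field" where
  "d_fun u \<kappa> p = (\<chi> i. pd \<kappa> i u p)"

definition d_form :: "('a, 'm::finite) vec_field \<Rightarrow> ('a, 'm) mat_field" where
  "d_form \<alpha> \<kappa> p =
     (\<chi> i j. pd \<kappa> i (\<lambda>q. \<alpha> \<kappa> q $ j) p - pd \<kappa> j (\<lambda>q. \<alpha> \<kappa> q $ i) p)"

definition closed_two_form :: "('a, 'm::finite) chart set \<Rightarrow> ('a, 'm) mat_field \<Rightarrow> bool" where
  "closed_two_form A \<omega> \<longleftrightarrow> covariant_2_tensor A \<omega> \<and>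
     (\<forall>\<kappa>\<in>A. \<forall>p\<in>cdom \<kappa>. transpose (\<omega> \<kappa> p) = - \<omega> \<kappa> p) \<and>
     (\<forall>\<kappa>\<in>A. \<forall>p\<in>cdom \<kappa>. \<forall>i j k.
        pd \<kappa> i (\<lambda>q. \<omega> \<kappa> q $ j $ k) p + pd \<kappa> j (\<lambda>q. \<omega> \<kappa> q $ k $ i) p
          + pd \<kappa> k (\<lambda>q. \<omega> \<kappa> q $ i $ j) p = 0)"

definition symplectic_form :: "('a, 'm::finite) chart set \<Rightarrow> ('a, 'm) mat_field \<Rightarrow> bool" where
  "symplectic_form A \<omega> \<longleftrightarrow> closed_two_form A \<omega> \<and>
     (\<forall>\<kappa>\<in>A. \<forall>p\<in>cdom \<kappa>. \<forall>u. (\<forall>v. u \<bullet> (\<omega> \<kappa> p *v v) = 0) \<longrightarrow> u = 0)"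

text \<open>\<open>\<iota>(X)\<omega> = \<omega>(X, \<cdot>)\<close>, where \<open>\<omega>(u, v) = u \<bullet> (\<omega> *v v)\<close>.\<close>

definition contract :: "('a, 'm::finite) vec_field \<Rightarrow> ('a, 'm) mat_field \<Rightarrow> ('a, 'm) vec_field" where
  "contract X \<omega> \<kappa> p = transpose (\<omega> \<kappa> p) *v X \<kappa> p"


section \<open>Harmonic 1-forms\<close>

text \<open>
  The codifferential on 1-forms and 2-forms in local coordinates, with
  \<open>\<rho> = sqrt (det g)\<close> and indices raised and lowered by \<open>g\<close>:
  \<open>d\<^sup>*\<alpha> = - \<rho>\<^sup>-\<^sup>1 \<Sum>\<^sub>i \<partial>\<^sub>i (\<rho> \<alpha>\<^sup>i)\<close> and
  \<open>(d\<^sup>*\<beta>)\<^sup>l = - \<rho>\<^sup>-\<^sup>1 \<Sum>\<^sub>i \<partial>\<^sub>i (\<rho> \<beta>\<^sup>i\<^sup>l)\<close>.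
\<close>

definition codiff1 :: "('a, 'm::finite) mat_field \<Rightarrow> ('a, 'm) vec_field
    \<Rightarrow> ('a, 'm) chart \<Rightarrow> 'a \<Rightarrow> real" where
  "codiff1 G \<alpha> \<kappa> p = - (1 / sqrt (det (G \<kappa> p))) *
     (\<Sum>i\<in>UNIV. pd \<kappa> i (\<lambda>q. sqrt (det (G \<kappa> q)) * (matrix_inv (G \<kappa> q) *v \<alpha> \<kappa> q) $ i) p)"

definition codiff2 :: "('a, 'm::finite) mat_field \<Rightarrow> ('a, 'm) mat_field \<Rightarrow> ('a, 'm) vec_field" where
  "codiff2 G \<beta> \<kappa> p = - (1 / sqrt (det (G \<kappa> p))) *\<^sub>R
     (G \<kappa> p *v (\<chi> l. \<Sum>i\<in>UNIV. pd \<kappa> i (\<lambda>q. sqrt (det (G \<kappa> q)) *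
        (matrix_inv (G \<kappa> q) ** \<beta> \<kappa> q ** transpose (matrix_inv (G \<kappa> q))) $ i $ l) p))"

text \<open>The Hodge--de Rham Laplacian \<open>d d\<^sup>* + d\<^sup>* d\<close>.\<close>

definition laplacian :: "('a, 'm::finite) mat_field \<Rightarrow> ('a, 'm) vec_field \<Rightarrow> ('a, 'm) vec_field" where
  "laplacian G \<alpha> \<kappa> p =
     (\<chi> j. pd \<kappa> j (codiff1 G \<alpha> \<kappa>) p) + codiff2 G (d_form \<alpha>) \<kappa> p"

definition harmonic :: "('a, 'm::finite) chart set \<Rightarrow> ('a, 'm) mat_field \<Rightarrow> ('a, 'm) vec_field \<Rightarrow> bool" where
  "harmonic A G \<alpha> \<longleftrightarrow> one_form A \<alpha> \<and> (\<forall>\<kappa>\<in>A. \<forall>p\<in>cdom \<kappa>. laplacian G \<alpha> \<kappa> p = 0)"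

definition is_lincomb :: "('a, 'm::finite) chart set \<Rightarrow> nat \<Rightarrow> (nat \<Rightarrow> ('a, 'm) vec_field)
    \<Rightarrow> (nat \<Rightarrow> real) \<Rightarrow> ('a, 'm) vec_field \<Rightarrow> bool" where
  "is_lincomb A b h c \<alpha> \<longleftrightarrow>
     (\<forall>\<kappa>\<in>A. \<forall>p\<in>cdom \<kappa>. \<alpha> \<kappa> p = (\<Sum>i<b. c i *\<^sub>R h i \<kappa> p))"

definition harmonic_basis :: "('a, 'm::finite) chart set \<Rightarrow> ('a, 'm) mat_field
    \<Rightarrow> nat \<Rightarrow> (nat \<Rightarrow> ('a, 'm) vec_field) \<Rightarrow> bool" where
  "harmonic_basis A G b h \<longleftrightarrow>
     (\<forall>i<b. harmonic A G (h i)) \<and>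
     (\<forall>\<alpha>. harmonic A G \<alpha> \<longrightarrow> (\<exists>c. is_lincomb A b h c \<alpha>)) \<and>
     (\<forall>c. is_lincomb A b h c (\<lambda>\<kappa> p. 0) \<longrightarrow> (\<forall>i<b. c i = 0))"

definition harmonic_norm :: "('a, 'm::finite) chart set \<Rightarrow> nat \<Rightarrow> (nat \<Rightarrow> ('a, 'm) vec_field)
    \<Rightarrow> ('a, 'm) vec_field \<Rightarrow> real" where
  "harmonic_norm A b h \<alpha> = (THE s. \<exists>c. is_lincomb A b h c \<alpha> \<and> s = (\<Sum>i<b. \<bar>c i\<bar>))"


section \<open>Integration against \<open>\<omega>\<^sup>n\<close>\<close>

text \<open>
  The value of the \<open>n\<close>-fold wedge product \<open>\<omega> \<and> \<dots> \<and> \<omega>\<close> on the coordinate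
  frame ordered as \<open>Inl i\<^sub>1, Inr i\<^sub>1, \<dots>, Inl i\<^sub>n, Inr i\<^sub>n\<close>. The dimension is
  \<open>CARD('n + 'n) = 2 * CARD('n)\<close>, and the order of the pairs is immaterial.
\<close>

definition omega_power :: "('a, 'n::finite + 'n) mat_field \<Rightarrow> ('a, 'n + 'n) chart \<Rightarrow> 'a \<Rightarrow> real" where
  "omega_power \<omega> \<kappa> p =
     (\<Sum>\<sigma> | \<sigma> permutes (UNIV :: ('n + 'n) set).
        of_int (sign \<sigma>) * (\<Prod>i\<in>UNIV. \<omega> \<kappa> p $ \<sigma> (Inl i) $ \<sigma> (Inr i))) / 2 ^ CARD('n)"

definition partition_of_unity :: "('a::topological_space, 'm::finite) chart set
    \<Rightarrow> nat \<Rightarrow> (nat \<Rightarrow> ('a, 'm) chart) \<Rightarrow> (nat \<Rightarrow> 'a \<Rightarrow> real) \<Rightarrow> bool" where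
  "partition_of_unity A K \<kappa> \<psi> \<longleftrightarrow>
     (\<forall>k<K. \<kappa> k \<in> A \<and> smooth_fun A (\<psi> k) \<and> (\<forall>x. 0 \<le> \<psi> k x) \<and>
        closure {x. \<psi> k x \<noteq> 0} \<subseteq> cdom (\<kappa> k)) \<and>
     (\<forall>x. (\<Sum>k<K. \<psi> k x) = 1)"

text \<open>
  \<open>M\<close> is oriented by \<open>\<omega>\<^sup>n\<close>, so that in a chart of either orientation \<open>\<omega>\<^sup>n\<close> is
  integrated as the positive density \<open>\<bar>omega_power \<omega> \<kappa>\<bar>\<close>. The value does not depend
  on the partition of unity.
\<close>

definition has_omega_integral :: "('a::topological_space, 'n::finite + 'n) chart set
    \<Rightarrow> ('a, 'n + 'n) mat_field \<Rightarrow> ('a \<Rightarrow> real) \<Rightarrow> real \<Rightarrow> bool" where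
  "has_omega_integral A \<omega> u I \<longleftrightarrow>
     (\<exists>K \<kappa> \<psi>. partition_of_unity A K \<kappa> \<psi> \<and>
        I = (\<Sum>k<K. integral (cmap (\<kappa> k) ` cdom (\<kappa> k))
              (\<lambda>y. let p = cinv (\<kappa> k) y in \<psi> k p * u p * \<bar>omega_power \<omega> (\<kappa> k) p\<bar>)))"


section \<open>Symplectic isotopies and Hofer-like norms\<close>

text \<open>The vector field \<open>(d\<phi>\<^sub>t/dt) \<circ> \<phi>\<^sub>t\<^sup>-\<^sup>1\<close>, with one-sided derivatives at \<open>t = 0, 1\<close>.\<close>

definition velocity :: "(real \<Rightarrow> 'a \<Rightarrow> 'a) \<Rightarrow> real \<Rightarrow> ('a, 'm::finite) vec_field" where
  "velocity \<Phi> t \<kappa> p =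
     vector_derivative (\<lambda>s. cmap \<kappa> (\<Phi> s (inv (\<Phi> t) p))) (at t within {0..1})"

definition symplectic_isotopy :: "('a::topological_space, 'm::finite) chart set
    \<Rightarrow> ('a, 'm) mat_field \<Rightarrow> (real \<Rightarrow> 'a \<Rightarrow> 'a) \<Rightarrow> bool" where
  "symplectic_isotopy A \<omega> \<Phi> \<longleftrightarrow>
     smooth_family A \<Phi> \<and> (\<forall>t\<in>{0..1}. diffeomorphism A (\<Phi> t)) \<and> \<Phi> 0 = id \<and>
     (\<forall>t\<in>{0..1}. \<forall>\<kappa>\<in>A. \<forall>p\<in>cdom \<kappa>. d_form (contract (velocity \<Phi> t) \<omega>) \<kappa> p = 0)"

definition Symp0 :: "('a::topological_space, 'm::finite) chart set
    \<Rightarrow> ('a, 'm) mat_field \<Rightarrow> ('a \<Rightarrow> 'a) set" where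
  "Symp0 A \<omega> = {\<phi>. \<exists>\<Phi>. symplectic_isotopy A \<omega> \<Phi> \<and> \<Phi> 1 = \<phi>}"

definition hodge_decomposition :: "('a::topological_space, 'n::finite + 'n) chart set
    \<Rightarrow> ('a, 'n + 'n) mat_field \<Rightarrow> ('a, 'n + 'n) mat_field
    \<Rightarrow> ('a, 'n + 'n) vec_field \<Rightarrow> ('a \<Rightarrow> real) \<Rightarrow> ('a, 'n + 'n) vec_field \<Rightarrow> bool" where
  "hodge_decomposition A \<omega> G \<alpha> u \<eta> \<longleftrightarrow>
     smooth_fun A u \<and> has_omega_integral A \<omega> u 0 \<and> harmonic A G \<eta> \<and>
     (\<forall>\<kappa>\<in>A. \<forall>p\<in>cdom \<kappa>. \<alpha> \<kappa> p = d_fun u \<kappa> p + \<eta> \<kappa> p)"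

definition isotopy_hodge :: "('a::topological_space, 'n::finite + 'n) chart set
    \<Rightarrow> ('a, 'n + 'n) mat_field \<Rightarrow> ('a, 'n + 'n) mat_field \<Rightarrow> (real \<Rightarrow> 'a \<Rightarrow> 'a)
    \<Rightarrow> (real \<Rightarrow> 'a \<Rightarrow> real) \<Rightarrow> (real \<Rightarrow> ('a, 'n + 'n) vec_field) \<Rightarrow> bool" where
  "isotopy_hodge A \<omega> G \<Phi> U H \<longleftrightarrow>
     (\<forall>t\<in>{0..1}. hodge_decomposition A \<omega> G (contract (velocity \<Phi> t) \<omega>) (U t) (H t))"

text \<open>\<open>Sup\<close> and \<open>Inf\<close> are attained for continuous functions on a compact space.\<close>

definition osc :: "('a \<Rightarrow> real) \<Rightarrow> real" where
  "osc u = Sup (range u) - Inf (range u)"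

definition speed :: "('a, 'm::finite) chart set \<Rightarrow> nat \<Rightarrow> (nat \<Rightarrow> ('a, 'm) vec_field)
    \<Rightarrow> (real \<Rightarrow> 'a \<Rightarrow> real) \<Rightarrow> (real \<Rightarrow> ('a, 'm) vec_field) \<Rightarrow> real \<Rightarrow> real" where
  "speed A b h U H t = osc (U t) + harmonic_norm A b h (H t)"

definition length_one :: "('a, 'm::finite) chart set \<Rightarrow> nat \<Rightarrow> (nat \<Rightarrow> ('a, 'm) vec_field)
    \<Rightarrow> (real \<Rightarrow> 'a \<Rightarrow> real) \<Rightarrow> (real \<Rightarrow> ('a, 'm) vec_field) \<Rightarrow> real" where
  "length_one A b h U H = integral {0..1} (speed A b h U H)"

definition length_infty :: "('a, 'm::finite) chart set \<Rightarrow> nat \<Rightarrow> (nat \<Rightarrow> ('a, 'm) vec_field)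
    \<Rightarrow> (real \<Rightarrow> 'a \<Rightarrow> real) \<Rightarrow> (real \<Rightarrow> ('a, 'm) vec_field) \<Rightarrow> real" where
  "length_infty A b h U H = Sup (speed A b h U H ` {0..1})"

text \<open>
  By Hodge theory every symplectic isotopy \<open>\<Phi>\<close> has exactly one family \<open>(U\<^sub>t, H\<^sub>t)\<close>
  of decompositions (up to the irrelevant values of components outside chart domains and of
  families outside \<open>[0,1]\<close>), so the following sets contain exactly one length per isotopy.
\<close>

definition energy_one where
  "energy_one A \<omega> G b h \<phi> =
     Inf {length_one A b h U H | \<Phi> U H.
            symplectic_isotopy A \<omega> \<Phi> \<and> \<Phi> 1 = \<phi> \<and> isotopy_hodge A \<omega> G \<Phi> U H}"

definition energy_infty where
  "energy_infty A \<omega> G b h \<phi> =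
     Inf {length_infty A b h U H | \<Phi> U H.
            symplectic_isotopy A \<omega> \<Phi> \<and> \<Phi> 1 = \<phi> \<and> isotopy_hodge A \<omega> G \<Phi> U H}"

definition HL_norm_one where
  "HL_norm_one A \<omega> G b h \<phi> =
     (energy_one A \<omega> G b h \<phi> + energy_one A \<omega> G b h (inv \<phi>)) / 2"

definition HL_norm_infty where
  "HL_norm_infty A \<omega> G b h \<phi> =
     (energy_infty A \<omega> G b h \<phi> + energy_infty A \<omega> G b h (inv \<phi>)) / 2"

end

theory Submission
  imports Defs
begin

text \<open>
  The average speed of an isotopy is at most its maximal speed. Conversely, reparametrising an
  isotopy by \<open>\<xi>\<close> multiplies its speed by \<open>\<xi>'\<close>, so a suitable \<open>\<xi>\<close>
  makes the speed almost constant, and its maximum almost the average; hence the two energies agree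
  even before symmetrisation. The analytic point is that the speed is a continuous function of time,
  i.e. that the Hodge decomposition depends continuously on the form. The harmonic forms are a
  finite-dimensional space which meets the exact forms only in \<open>0\<close>: the codifferential of a
  harmonic exact form \<open>du\<close> is a constant, the second derivative test at a maximum and a
  minimum of \<open>u\<close> shows that it vanishes, and then the strong maximum principle makes
  \<open>u\<close> constant. A compactness argument turns this into an estimate.
\<close>

section \<open>Calculus of smooth maps on open sets\<close>

text \<open>That an exact harmonic form vanishes is classically an integration by parts. Pointwise
  arguments replace it here, and their price is that \<open>codiff1\<close>, defined chart by chart,
  must be shown to be one global function before connectedness can make it constant; the Jacobi and
  Piola identities serve this purpose. The stability estimate is qualitative: its constant comes
  from a contradiction by subsequences, which works because coefficients in a finite basis
  subconverge and because the limit of the exact parts inherits its smoothness from a combination of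
  basis forms. Oscillation sees a function only up to a constant, so potentials are controlled
  through differences \<open>u p - u q\<close>. The speed of an isotopy is merely continuous and may
  vanish, so its own arc length is no smooth time change with smooth inverse; a polynomial majorant,
  strictly positive on the whole line, is used instead, and the loss of an arbitrary epsilon
  disappears in the infimum. The reparametrised path brings its own Hodge decomposition, obtained by
  scaling the old one.\<close>

lemma C_on_SucD:
  assumes "C_on (Suc k) S f" "open S" "x \<in> S"
  shows "(f has_derivative frechet_derivative f (at x)) (at x)"
  using assms by (metis C_on.simps(2) at_within_open differentiable_on_def frechet_derivative_works)

lemma C_on_cong:
  assumes "open S" "\<And>x. x \<in> S \<Longrightarrow> f x = g x" "C_on k S f"
  shows "C_on k S g"
  using assms(2,3)
proof (induction k arbitrary: f g)
  case 0
  then show ?case by (auto cong: continuous_on_cong)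
next
  case (Suc k)
  have d: "(g has_derivative frechet_derivative f (at x)) (at x)" if "x \<in> S" for x
    by (rule has_derivative_transform_within_open[OF C_on_SucD[OF Suc.prems(2) assms(1) that] assms(1) that])
      (use Suc.prems in auto)
  then have "g differentiable_on S"
    by (meson differentiable_at_withinI differentiable_def differentiable_on_def)
  moreover have "C_on k S (\<lambda>x. frechet_derivative g (at x) v)" for v
    by (rule Suc.IH[of "\<lambda>x. frechet_derivative f (at x) v"])
      (use frechet_derivative_at[OF d] Suc.prems(2) in auto)
  ultimately show ?case by simp
qed

lemma C_on_Suc_intro:
  assumes "open S" and d: "\<And>x. x \<in> S \<Longrightarrow> (f has_derivative f' x) (at x)"
    and "\<And>v. C_on k S (\<lambda>x. f' x v)"
  shows "C_on (Suc k) S f"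
proof -
  have "f differentiable_on S"
    using d by (meson differentiable_at_withinI differentiable_def differentiable_on_def)
  moreover have "C_on k S (\<lambda>x. frechet_derivative f (at x) v)" for v
    by (rule C_on_cong[OF assms(1) _ assms(3)[of v]]) (use frechet_derivative_at[OF d] in auto)
  ultimately show ?thesis by simp
qed

lemma C_on_imp_continuous_on: "C_on k S f \<Longrightarrow> continuous_on S f"
  by (cases k) (auto simp: differentiable_imp_continuous_on)

lemma C_on_decSuc: "C_on (Suc k) S f \<Longrightarrow> C_on k S f"
proof (induction k arbitrary: f)
  case 0
  then show ?case by (auto simp: differentiable_imp_continuous_on)
next
  case (Suc k)
  then show ?case by (metis C_on.simps(2))
qed

lemma C_on_subset: "C_on k S f \<Longrightarrow> T \<subseteq> S \<Longrightarrow> C_on k T f"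
  by (induction k arbitrary: f) (auto intro: continuous_on_subset differentiable_on_subset)

lemma C_on_local:
  assumes "\<And>x. x \<in> S \<Longrightarrow> \<exists>W. open W \<and> x \<in> W \<and> C_on k W f"
  shows "C_on k S f"
  using assms
proof (induction k arbitrary: f)
  case 0
  then show ?case
    unfolding C_on.simps(1) by (metis continuous_at_imp_continuous_on continuous_on_eq_continuous_at)
next
  case (Suc k)
  have "f differentiable at x" if x: "x \<in> S" for x
  proof -
    obtain W where "open W" "x \<in> W" "C_on (Suc k) W f" using Suc.prems[OF x] by blast
    then show ?thesis using C_on_SucD[of k W f x] unfolding differentiable_def by blast
  qed
  then have "f differentiable_on S"
    by (meson differentiable_at_withinI differentiable_on_def)
  moreover have "C_on k S (\<lambda>x. frechet_derivative f (at x) v)" for v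
    by (rule Suc.IH) (use Suc.prems in force)
  ultimately show ?case by simp
qed

lemma C_on_const: "open S \<Longrightarrow> C_on k S (\<lambda>x. c)"
proof (induction k arbitrary: c)
  case (Suc k)
  show ?case
    by (rule C_on_Suc_intro[where f'="\<lambda>x v. 0"]) (use Suc in auto)
qed auto

lemma C_on_linear:
  assumes "open S" "bounded_linear L" "C_on k S f"
  shows "C_on k S (\<lambda>x. L (f x))"
  using assms(3)
proof (induction k arbitrary: f)
  case 0
  then show ?case by (simp add: assms(2) bounded_linear.continuous_on)
next
  case (Suc k)
  show ?case
  proof (rule C_on_Suc_intro[OF assms(1)])
    show "((\<lambda>x. L (f x)) has_derivative (\<lambda>v. L (frechet_derivative f (at x) v))) (at x)" if "x \<in> S" for x
      using C_on_SucD[OF Suc.prems assms(1) that] bounded_linear.has_derivative[OF assms(2)] by blast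
  qed (use Suc assms in auto)
qed

lemma C_on_ident: "open S \<Longrightarrow> C_on k S (\<lambda>x. x)"
proof (cases k)
  case (Suc j)
  assume "open S"
  then show ?thesis unfolding Suc
    by (intro C_on_Suc_intro[where f'="\<lambda>x v. v"]) (auto intro: C_on_const)
qed auto

lemma C_on_add:
  assumes "open S" "C_on k S f" "C_on k S g"
  shows "C_on k S (\<lambda>x. f x + g x)"
  using assms(2,3)
proof (induction k arbitrary: f g)
  case 0
  then show ?case by (simp add: continuous_on_add)
next
  case (Suc k)
  show ?case
  proof (rule C_on_Suc_intro[OF assms(1)])
    show "((\<lambda>x. f x + g x) has_derivative (\<lambda>v. frechet_derivative f (at x) v + frechet_derivative g (at x) v)) (at x)"
      if "x \<in> S" for x
      using C_on_SucD[OF Suc.prems(1) assms(1) that] C_on_SucD[OF Suc.prems(2) assms(1) that]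
      by (rule has_derivative_add)
  qed (use Suc assms in auto)
qed

lemma C_on_bilinear:
  assumes "bounded_bilinear B" "open S" "C_on k S f" "C_on k S g"
  shows "C_on k S (\<lambda>x. B (f x) (g x))"
  using assms(3,4)
proof (induction k arbitrary: f g)
  case 0
  then show ?case by (simp add: assms(1) bounded_bilinear.continuous_on)
next
  case (Suc k)
  show ?case
  proof (rule C_on_Suc_intro[OF assms(2)])
    show "((\<lambda>x. B (f x) (g x)) has_derivative
        (\<lambda>v. B (f x) (frechet_derivative g (at x) v) + B (frechet_derivative f (at x) v) (g x))) (at x)"
      if "x \<in> S" for x
      using bounded_bilinear.FDERIV[OF assms(1) C_on_SucD[OF Suc.prems(1) assms(2) that] C_on_SucD[OF Suc.prems(2) assms(2) that]] .
    show "C_on k S (\<lambda>x. B (f x) (frechet_derivative g (at x) v) + B (frechet_derivative f (at x) v) (g x))" for v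
      using Suc.prems[THEN C_on_decSuc] Suc.prems by (intro C_on_add[OF assms(2)] Suc.IH) auto
  qed
qed

lemmas C_on_mult = C_on_bilinear[OF bounded_bilinear_mult]
  and C_on_scaleR = C_on_bilinear[OF bounded_bilinear_scaleR]

lemma C_on_sum:
  assumes "open S" "\<And>i. i \<in> I \<Longrightarrow> C_on k S (f i)"
  shows "C_on k S (\<lambda>x. \<Sum>i\<in>I. f i x)"
  using assms(2)
  by (induction I rule: infinite_finite_induct) (auto intro!: C_on_add C_on_const assms(1))

lemma C_on_prod:
  fixes f :: "'i \<Rightarrow> 'x::real_normed_vector \<Rightarrow> real"
  assumes "open S" "\<And>i. i \<in> I \<Longrightarrow> C_on k S (f i)"
  shows "C_on k S (\<lambda>x. \<Prod>i\<in>I. f i x)"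
  using assms(2)
  by (induction I rule: infinite_finite_induct) (auto intro!: C_on_mult C_on_const assms(1))

text \<open>\<open>C_on\<close> differentiates in fixed directions, whereas the chain rule evaluates
  the derivative of \<open>g\<close> at the moving vector \<open>?f' x v\<close>. Expanding that
  vector in \<open>Basis\<close> leaves fixed directions with scalar coefficients; this is why the
  middle space is Euclidean.\<close>

lemma C_on_compose:
  fixes f :: "'x::real_normed_vector \<Rightarrow> 'y::euclidean_space"
  assumes "open S" "open T" "C_on k S f" "C_on k T g" "\<And>x. x \<in> S \<Longrightarrow> f x \<in> T"
  shows "C_on k S (\<lambda>x. g (f x))"
  using assms(3,4)
proof (induction k arbitrary: g)
  case 0
  then show ?case using continuous_on_compose2[of T g S f] assms(5) by auto
next
  case (Suc k)
  let ?f' = "\<lambda>x. frechet_derivative f (at x)" and ?g' = "\<lambda>y. frechet_derivative g (at y)"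
  show ?case
  proof (rule C_on_Suc_intro[OF assms(1)])
    show "((\<lambda>x. g (f x)) has_derivative (\<lambda>v. \<Sum>b\<in>Basis. (?f' x v \<bullet> b) *\<^sub>R ?g' (f x) b)) (at x)"
      if "x \<in> S" for x
    proof -
      have g: "(g has_derivative ?g' (f x)) (at (f x))"
        using C_on_SucD[OF Suc.prems(2) assms(2)] assms(5)[OF that] by blast
      interpret lin: linear "?g' (f x)" using has_derivative_linear[OF g] .
      have E: "?g' (f x) w = (\<Sum>b\<in>Basis. (w \<bullet> b) *\<^sub>R ?g' (f x) b)" for w
        using arg_cong[OF euclidean_representation[of w], of "?g' (f x)"]
        by (simp add: lin.sum lin.scaleR)
      have D: "((\<lambda>x. g (f x)) has_derivative (\<lambda>v. ?g' (f x) (?f' x v))) (at x)"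
        using has_derivative_compose[OF C_on_SucD[OF Suc.prems(1) assms(1) that] g] .
      show ?thesis by (rule has_derivative_eq_rhs[OF D]) (rule ext, rule E)
    qed
    show "C_on k S (\<lambda>x. \<Sum>b\<in>Basis. (?f' x v \<bullet> b) *\<^sub>R ?g' (f x) b)" for v
    proof (intro C_on_sum C_on_scaleR C_on_linear[OF _ bounded_linear_inner_left] assms(1))
      show "C_on k S (\<lambda>x. ?f' x v)" using Suc.prems(1) by simp
      show "C_on k S (\<lambda>x. ?g' (f x) b)" for b
        using Suc.prems Suc.prems(1)[THEN C_on_decSuc] by (intro Suc.IH) auto
    qed
  qed
qed

text \<open>The derivative of \<open>1/f\<close> is a polynomial in \<open>1/f\<close> and the
  derivative of \<open>f\<close>, so each order of smoothness of \<open>1/f\<close> yields the next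
  one.\<close>

lemma C_on_inverse:
  fixes f :: "'x::real_normed_vector \<Rightarrow> real"
  assumes "open S" "\<And>x. x \<in> S \<Longrightarrow> f x \<noteq> 0" "C_on k S f"
  shows "C_on k S (\<lambda>x. inverse (f x))"
  using assms(3)
proof (induction k)
  case 0
  then show ?case using assms(2) by (simp add: continuous_on_inverse)
next
  case (Suc k)
  have IH: "C_on k S (\<lambda>x. inverse (f x))" using Suc C_on_decSuc by blast
  show ?case
  proof (rule C_on_Suc_intro[OF assms(1)])
    show "((\<lambda>x. inverse (f x)) has_derivative
        (\<lambda>v. (- 1) * (inverse (f x) * frechet_derivative f (at x) v * inverse (f x)))) (at x)" if "x \<in> S" for x
      using Deriv.has_derivative_inverse[OF assms(2)[OF that] C_on_SucD[OF Suc.prems assms(1) that]] by simp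
    show "C_on k S (\<lambda>x. (- 1) * (inverse (f x) * frechet_derivative f (at x) v * inverse (f x)))" for v
      using Suc.prems by (intro C_on_mult C_on_const IH assms(1)) auto
  qed
qed

lemma C_on_sqrt:
  fixes f :: "'x::real_normed_vector \<Rightarrow> real"
  assumes "open S" "\<And>x. x \<in> S \<Longrightarrow> f x > 0" "C_on k S f"
  shows "C_on k S (\<lambda>x. sqrt (f x))"
  using assms(3)
proof (induction k)
  case 0
  then show ?case by (simp add: continuous_on_real_sqrt)
next
  case (Suc k)
  have IH: "C_on k S (\<lambda>x. sqrt (f x))" using Suc C_on_decSuc by blast
  show ?case
  proof (rule C_on_Suc_intro[OF assms(1)])
    show "((\<lambda>x. sqrt (f x)) has_derivative
        (\<lambda>v. frechet_derivative f (at x) v * (inverse (sqrt (f x)) * (1/2)))) (at x)" if "x \<in> S" for x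
      using DERIV_compose_FDERIV[of sqrt "inverse (sqrt (f x)) / 2" f x, OF DERIV_real_sqrt[OF assms(2)[OF that]]
          C_on_SucD[OF Suc.prems assms(1) that]] by simp
    show "C_on k S (\<lambda>x. frechet_derivative f (at x) v * (inverse (sqrt (f x)) * (1/2)))" for v
      using Suc.prems assms(2) by (intro C_on_mult C_on_const C_on_inverse IH assms(1)) force+
  qed
qed

lemma C_on_Pair:
  assumes "open S" "C_on k S f" "C_on k S g"
  shows "C_on k S (\<lambda>x. (f x, g x))"
proof -
  have "C_on k S (\<lambda>x. (f x, 0) + (0, g x))"
    by (intro C_on_add[OF assms(1)] C_on_linear[OF assms(1) _ assms(2)] C_on_linear[OF assms(1) _ assms(3)]
        bounded_linear_Pair bounded_linear_ident bounded_linear_zero)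
  then show ?thesis by simp
qed

lemma C_on_vec_iff:
  fixes f :: "'x::real_normed_vector \<Rightarrow> 'b::euclidean_space ^ 'm"
  assumes "open S"
  shows "C_on k S f \<longleftrightarrow> (\<forall>i. C_on k S (\<lambda>x. f x $ i))"
proof
  assume "C_on k S f"
  then show "\<forall>i. C_on k S (\<lambda>x. f x $ i)"
    using C_on_linear[OF assms bounded_linear_vec_nth] by blast
next
  assume *: "\<forall>i. C_on k S (\<lambda>x. f x $ i)"
  have L: "bounded_linear (axis i :: 'b \<Rightarrow> 'b ^ 'm)" for i
    unfolding linear_conv_bounded_linear[symmetric] by (rule linearI) (auto simp: vec_eq_iff axis_def)
  have C: "C_on k S (\<lambda>x. \<Sum>i\<in>UNIV. axis i (f x $ i))"
    by (rule C_on_sum[OF assms], rule C_on_linear[OF assms L]) (use * in blast)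
  have E: "(\<lambda>x. \<Sum>i\<in>UNIV. axis i (f x $ i)) = f"
    by (simp add: fun_eq_iff vec_eq_iff axis_def cong: if_cong)
  show "C_on k S f" using C unfolding E .
qed

text \<open>A local extension agrees with \<open>f\<close> on a neighbourhood inside the open set,
  so there extendability is ordinary smoothness and the calculus can work with
  \<open>C_on\<close>.\<close>

lemma smooth_on_open_iff:
  assumes "open S"
  shows "smooth_on S f \<longleftrightarrow> (\<forall>k. C_on k S f)"
proof
  assume s: "smooth_on S f"
  show "\<forall>k. C_on k S f"
  proof (intro allI C_on_local)
    fix k x assume "x \<in> S"
    then obtain W F where W: "open W" "x \<in> W" "C_on k W F" "\<forall>y\<in>W \<inter> S. F y = f y"
      using s unfolding smooth_on_def by metis
    then have "C_on k (W \<inter> S) F" using C_on_subset by blast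
    then have "C_on k (W \<inter> S) f" using W(1,4) assms by (auto intro: C_on_cong[of _ F f])
    then show "\<exists>W. open W \<and> x \<in> W \<and> C_on k W f" using W assms \<open>x \<in> S\<close> by blast
  qed
next
  assume "\<forall>k. C_on k S f"
  then show "smooth_on S f" unfolding smooth_on_def using assms by blast
qed

text \<open>The mean value theorem applied twice, along \<open>v\<close> to the increment in
  direction \<open>w\<close>, then along \<open>w\<close>. The left side of the equation is
  symmetric in \<open>v\<close> and \<open>w\<close>, which makes the two mixed derivatives
  comparable.\<close>

lemma second_difference:
  fixes f :: "'x::real_normed_vector \<Rightarrow> real"
  assumes "open S" "C_on 2 S f" "h > 0"
    and S: "\<And>s t. s \<in> {0..h} \<Longrightarrow> t \<in> {0..h} \<Longrightarrow> x + s *\<^sub>R v + t *\<^sub>R w \<in> S"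
  obtains s t where "s \<in> {0..h}" "t \<in> {0..h}"
    "f (x + h *\<^sub>R v + h *\<^sub>R w) - f (x + h *\<^sub>R v) - f (x + h *\<^sub>R w) + f x
      = h * (h * frechet_derivative (\<lambda>y. frechet_derivative f (at y) v) (at (x + s *\<^sub>R v + t *\<^sub>R w)) w)"
proof -
  have C: "C_on (Suc (Suc 0)) S f" using assms(2) by (simp only: numeral_2_eq_2)
  let ?fv = "\<lambda>y. frechet_derivative f (at y) v"
  have Cv: "C_on (Suc 0) S ?fv" using C by simp
  have line: "((\<lambda>s. g (a + s *\<^sub>R u)) has_real_derivative frechet_derivative g (at (a + s *\<^sub>R u)) u) (at s)"
    if "a + s *\<^sub>R u \<in> S" "C_on (Suc 0) S g" for a u s and g :: "'x \<Rightarrow> real"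
  proof -
    have "(g has_derivative frechet_derivative g (at (a + s *\<^sub>R u))) (at (a + s *\<^sub>R u))"
      using C_on_SucD[OF that(2) assms(1) that(1)] .
    moreover have "((\<lambda>s. a + s *\<^sub>R u) has_derivative (\<lambda>r. r *\<^sub>R u)) (at s)"
      by (auto intro!: derivative_eq_intros)
    ultimately have *: "((\<lambda>s. g (a + s *\<^sub>R u)) has_derivative (\<lambda>r. frechet_derivative g (at (a + s *\<^sub>R u)) (r *\<^sub>R u))) (at s)"
      by (rule has_derivative_compose[rotated])
    have "(\<lambda>r. frechet_derivative g (at (a + s *\<^sub>R u)) (r *\<^sub>R u)) = (*) (frechet_derivative g (at (a + s *\<^sub>R u)) u)"
      using linear_cmul[OF has_derivative_linear[OF \<open>(g has_derivative _) _\<close>]] by (simp add: fun_eq_iff)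
    then show ?thesis
      using * by (simp add: has_field_derivative_def)
  qed
  define \<phi> where "\<phi> s = f ((x + h *\<^sub>R w) + s *\<^sub>R v) - f (x + s *\<^sub>R v)" for s
  have "\<exists>z>0. z < h \<and> \<phi> h - \<phi> 0 = (h - 0) * (?fv ((x + h *\<^sub>R w) + z *\<^sub>R v) - ?fv (x + z *\<^sub>R v))"
  proof (rule MVT2[OF assms(3)])
    fix s assume s: "0 \<le> s" "s \<le> h"
    have "x + h *\<^sub>R w + s *\<^sub>R v \<in> S" "x + s *\<^sub>R v \<in> S"
      using S[of s h] S[of s 0] s assms(3) by (auto simp: algebra_simps)
    then show "(\<phi> has_real_derivative ?fv ((x + h *\<^sub>R w) + s *\<^sub>R v) - ?fv (x + s *\<^sub>R v)) (at s)"
      unfolding \<phi>_def using C_on_decSuc[OF C] by (intro DERIV_diff line) auto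
  qed
  then obtain s where s: "0 < s" "s < h" "\<phi> h - \<phi> 0 = h * (?fv ((x + h *\<^sub>R w) + s *\<^sub>R v) - ?fv (x + s *\<^sub>R v))"
    by auto
  have "\<exists>z>0. z < h \<and> ?fv ((x + s *\<^sub>R v) + h *\<^sub>R w) - ?fv ((x + s *\<^sub>R v) + 0 *\<^sub>R w)
      = (h - 0) * frechet_derivative ?fv (at ((x + s *\<^sub>R v) + z *\<^sub>R w)) w"
    by (rule MVT2[OF assms(3)]) (use S s Cv in \<open>auto intro!: line\<close>)
  then obtain t where t: "0 < t" "t < h" "?fv ((x + s *\<^sub>R v) + h *\<^sub>R w) - ?fv (x + s *\<^sub>R v)
      = h * frechet_derivative ?fv (at ((x + s *\<^sub>R v) + t *\<^sub>R w)) w" by auto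
  show ?thesis
  proof (rule that)
    show "s \<in> {0..h}" "t \<in> {0..h}" using s t by auto
    have e: "x + h *\<^sub>R w + s *\<^sub>R v = (x + s *\<^sub>R v) + h *\<^sub>R w" by (simp add: algebra_simps)
    have "\<phi> h - \<phi> 0 = h * (h * frechet_derivative ?fv (at ((x + s *\<^sub>R v) + t *\<^sub>R w)) w)"
      by (simp only: s(3) e t(3))
    then show "f (x + h *\<^sub>R v + h *\<^sub>R w) - f (x + h *\<^sub>R v) - f (x + h *\<^sub>R w) + f x
      = h * (h * frechet_derivative ?fv (at (x + s *\<^sub>R v + t *\<^sub>R w)) w)"
      unfolding \<phi>_def by (simp add: algebra_simps)
  qed
qed

lemma second_derivative_symmetric:
  fixes f :: "'x::real_normed_vector \<Rightarrow> real"
  assumes "open S" "C_on 2 S f" "x \<in> S"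
  shows "frechet_derivative (\<lambda>y. frechet_derivative f (at y) v) (at x) w
       = frechet_derivative (\<lambda>y. frechet_derivative f (at y) w) (at x) v"
proof -
  let ?D = "\<lambda>v w y. frechet_derivative (\<lambda>y. frechet_derivative f (at y) v) (at y) w"
  have cont: "isCont (?D v w) x" for v w
  proof -
    have "continuous_on S (?D v w)" using assms(2) by (simp add: numeral_2_eq_2)
    then show ?thesis using assms continuous_on_eq_continuous_at by blast
  qed
  have eps: "\<exists>d>0. \<forall>y. dist y x < d \<longrightarrow> dist (?D v w y) (?D v w x) < \<epsilon>" if "\<epsilon> > 0" for \<epsilon> v w
  proof -
    have "\<forall>\<^sub>F y in at x. dist (?D v w y) (?D v w x) < \<epsilon>"
      using tendstoD[OF cont[of v w, unfolded isCont_def] that] .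
    then obtain d where "d > 0" "\<forall>y\<in>UNIV. y \<noteq> x \<and> dist y x < d \<longrightarrow> dist (?D v w y) (?D v w x) < \<epsilon>"
      unfolding eventually_at by blast
    then show ?thesis using that by (intro exI[of _ d]) (metis UNIV_I dist_self)
  qed
  have "\<bar>?D v w x - ?D w v x\<bar> < 2 * \<epsilon>" if e0: "\<epsilon> > 0" for \<epsilon>
  proof -
    obtain d1 where d1: "d1 > 0" "\<forall>y. dist y x < d1 \<longrightarrow> dist (?D v w y) (?D v w x) < \<epsilon>"
      using eps[OF e0, of v w] by (elim exE conjE)
    obtain d2 where d2: "d2 > 0" "\<forall>y. dist y x < d2 \<longrightarrow> dist (?D w v y) (?D w v x) < \<epsilon>"
      using eps[OF e0, of w v] by (elim exE conjE)
    obtain d3 where d3: "d3 > 0" "ball x d3 \<subseteq> S" using assms(1,3) open_contains_ball by blast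
    define d where "d = min d1 (min d2 d3)"
    \<comment> \<open>This \<open>h\<close> keeps the whole parallelogram spanned at
      \<open>x\<close> by \<open>h v\<close> and \<open>h w\<close> within distance
      \<open>d\<close>; the summand 1 covers \<open>v = w = 0\<close>.\<close>
    define h where "h = d / (norm v + norm w + 1)"
    have "d > 0" "h > 0"
      using d1(1) d2(1) d3(1) by (auto simp: d_def h_def add_nonneg_pos)
    have near: "dist (x + s *\<^sub>R a + t *\<^sub>R b) x < d"
      if "s \<in> {0..h}" "t \<in> {0..h}" "norm a + norm b \<le> norm v + norm w" for s t a b
    proof -
      have "dist (x + s *\<^sub>R a + t *\<^sub>R b) x = norm (s *\<^sub>R a + t *\<^sub>R b)"
        by (simp add: dist_norm)
      also have "\<dots> \<le> s * norm a + t * norm b"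
        using norm_triangle_ineq[of "s *\<^sub>R a" "t *\<^sub>R b"] that by simp
      also have "\<dots> \<le> h * norm a + h * norm b"
        using that by (intro add_mono mult_right_mono) auto
      also have "\<dots> < h * (norm v + norm w + 1)"
        using that \<open>h > 0\<close> by (simp add: distrib_left[symmetric])
      also have "\<dots> = d" using add_nonneg_pos[of "norm v + norm w" 1] by (simp add: h_def)
      finally show ?thesis .
    qed
    then have inS: "x + s *\<^sub>R a + t *\<^sub>R b \<in> S"
      if "s \<in> {0..h}" "t \<in> {0..h}" "norm a + norm b \<le> norm v + norm w" for s t a b
      using that d3(2) by (force simp: d_def dist_commute)
    obtain s t where st: "s \<in> {0..h}" "t \<in> {0..h}"
      "f (x + h *\<^sub>R v + h *\<^sub>R w) - f (x + h *\<^sub>R v) - f (x + h *\<^sub>R w) + f x = h * (h * ?D v w (x + s *\<^sub>R v + t *\<^sub>R w))"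
      using second_difference[OF assms(1,2) \<open>h > 0\<close> inS[of _ _ v w]] by auto
    obtain s' t' where st': "s' \<in> {0..h}" "t' \<in> {0..h}"
      "f (x + h *\<^sub>R w + h *\<^sub>R v) - f (x + h *\<^sub>R w) - f (x + h *\<^sub>R v) + f x = h * (h * ?D w v (x + s' *\<^sub>R w + t' *\<^sub>R v))"
      using second_difference[OF assms(1,2) \<open>h > 0\<close> inS[of _ _ w v]] by auto
    have e: "x + h *\<^sub>R w + h *\<^sub>R v = x + h *\<^sub>R v + h *\<^sub>R w" by (simp add: algebra_simps)
    have "h * (h * ?D v w (x + s *\<^sub>R v + t *\<^sub>R w)) = h * (h * ?D w v (x + s' *\<^sub>R w + t' *\<^sub>R v))"
      unfolding st(3)[symmetric] st'(3)[symmetric] e by simp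
    then have "?D v w (x + s *\<^sub>R v + t *\<^sub>R w) = ?D w v (x + s' *\<^sub>R w + t' *\<^sub>R v)"
      using \<open>h > 0\<close> by simp
    moreover have "dist (?D v w (x + s *\<^sub>R v + t *\<^sub>R w)) (?D v w x) < \<epsilon>"
      using near[OF st(1,2), of v w] by (intro d1(2)[rule_format]) (simp add: d_def)
    moreover have "dist (?D w v (x + s' *\<^sub>R w + t' *\<^sub>R v)) (?D w v x) < \<epsilon>"
      using near[OF st'(1,2), of w v] by (intro d2(2)[rule_format]) (simp add: d_def)
    ultimately show ?thesis by (simp add: dist_real_def)
  qed
  from this[of "\<bar>?D v w x - ?D w v x\<bar> / 2"] show ?thesis by (cases "?D v w x = ?D w v x") auto
qed

section \<open>Smooth functions in a chart\<close>

text \<open>Images of charts are open, so smoothness in coordinates is plain \<open>C_on\<close> of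
  every order. The codomain is an arbitrary normed space so that functions and the component vectors
  and matrices of tensor fields share one notion.\<close>

definition chart_smooth :: "('a, 'm::finite) chart \<Rightarrow> ('a \<Rightarrow> 'b::real_normed_vector) \<Rightarrow> bool" where
  "chart_smooth \<kappa> u \<longleftrightarrow> (\<forall>k. C_on k (cmap \<kappa> ` cdom \<kappa>) (\<lambda>y. u (cinv \<kappa> y)))"

lemma is_chartD:
  assumes "is_chart \<kappa>"
  shows open_cdom: "open (cdom \<kappa>)"
    and open_chart_image: "open (cmap \<kappa> ` cdom \<kappa>)"
    and cinv_cmap: "p \<in> cdom \<kappa> \<Longrightarrow> cinv \<kappa> (cmap \<kappa> p) = p"
    and cmap_cinv: "y \<in> cmap \<kappa> ` cdom \<kappa> \<Longrightarrow> cmap \<kappa> (cinv \<kappa> y) = y"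
    and cinv_in_cdom: "y \<in> cmap \<kappa> ` cdom \<kappa> \<Longrightarrow> cinv \<kappa> y \<in> cdom \<kappa>"
    and continuous_on_cmap: "continuous_on (cdom \<kappa>) (cmap \<kappa>)"
    and continuous_on_cinv: "continuous_on (cmap \<kappa> ` cdom \<kappa>) (cinv \<kappa>)"
  using assms unfolding is_chart_def homeomorphism_def by auto

text \<open>\<open>frechet_derivative\<close> is a choice from the set of derivatives; both
  functions have the same such set at \<open>x\<close>, so the choices coincide even if that set is
  empty.\<close>

lemma frechet_derivative_cong_open:
  assumes "open S" "x \<in> S" "\<And>y. y \<in> S \<Longrightarrow> f y = g y"
  shows "frechet_derivative f (at x) = frechet_derivative g (at x)"
proof -
  have "(f has_derivative D) (at x) \<longleftrightarrow> (g has_derivative D) (at x)" for D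
    using assms by (metis has_derivative_transform_within_open)
  then show ?thesis unfolding frechet_derivative_def by simp
qed

lemma pd_eqI:
  assumes "((\<lambda>y. u (cinv \<kappa> y)) has_derivative D) (at (cmap \<kappa> p))"
  shows "pd \<kappa> i u p = D (axis i 1)"
  unfolding pd_def frechet_derivative_at[OF assms, symmetric] ..

lemma sum_axis: "(\<Sum>j\<in>UNIV. axis i 1 $ j * f j) = (f i :: real)"
  by (simp add: axis_def if_distrib if_distribR cong: if_cong)

lemma pd_const: "pd \<kappa> i (\<lambda>q. c) p = 0"
  by (subst pd_eqI[where D="\<lambda>v. 0"]) auto

lemma bounded_linear_vec_expansion:
  fixes D :: "real ^ 'm \<Rightarrow> real"
  assumes "linear D"
  shows "D v = (\<Sum>i\<in>UNIV. v $ i * D (axis i 1))"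
  using arg_cong[OF basis_expansion[of v], of D] assms
  by (simp add: linear_sum linear_cmul scalar_mult_eq_scaleR)

context
  fixes \<kappa> :: "('a::topological_space, 'm::finite) chart"
  assumes ch: "is_chart \<kappa>"
begin

lemma chart_smooth_cong:
  assumes "\<And>p. p \<in> cdom \<kappa> \<Longrightarrow> u p = v p" "chart_smooth \<kappa> u"
  shows "chart_smooth \<kappa> v"
  unfolding chart_smooth_def
proof
  fix k
  show "C_on k (cmap \<kappa> ` cdom \<kappa>) (\<lambda>y. v (cinv \<kappa> y))"
    by (rule C_on_cong[OF open_chart_image[OF ch], of "\<lambda>y. u (cinv \<kappa> y)"])
      (use assms cinv_in_cdom[OF ch] in \<open>auto simp: chart_smooth_def\<close>)
qed

lemma pd_cong:
  assumes "\<And>q. q \<in> cdom \<kappa> \<Longrightarrow> u q = v q" "p \<in> cdom \<kappa>"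
  shows "pd \<kappa> i u p = pd \<kappa> i v p"
  unfolding pd_def
  by (subst frechet_derivative_cong_open[OF open_chart_image[OF ch], of "cmap \<kappa> p" "\<lambda>y. u (cinv \<kappa> y)" "\<lambda>y. v (cinv \<kappa> y)"])
    (use assms cinv_in_cdom[OF ch] in auto)

lemma chart_smooth_const: "chart_smooth \<kappa> (\<lambda>q. c)"
  by (simp add: chart_smooth_def C_on_const open_chart_image[OF ch])

lemma chart_smooth_add: "chart_smooth \<kappa> u \<Longrightarrow> chart_smooth \<kappa> v \<Longrightarrow> chart_smooth \<kappa> (\<lambda>q. u q + v q)"
  by (simp add: chart_smooth_def C_on_add open_chart_image[OF ch])

lemma chart_smooth_mult:
  fixes u v :: "'a \<Rightarrow> real"
  shows "chart_smooth \<kappa> u \<Longrightarrow> chart_smooth \<kappa> v \<Longrightarrow> chart_smooth \<kappa> (\<lambda>q. u q * v q)"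
  by (simp add: chart_smooth_def C_on_mult open_chart_image[OF ch])

lemma chart_smooth_diff:
  fixes u v :: "'a \<Rightarrow> real"
  assumes "chart_smooth \<kappa> u" "chart_smooth \<kappa> v"
  shows "chart_smooth \<kappa> (\<lambda>q. u q - v q)"
  using chart_smooth_add[OF assms(1) chart_smooth_mult[OF chart_smooth_const[of "-1"] assms(2)]] by simp

lemma chart_smooth_sum:
  "(\<And>i. i \<in> I \<Longrightarrow> chart_smooth \<kappa> (u i)) \<Longrightarrow> chart_smooth \<kappa> (\<lambda>q. \<Sum>i\<in>I. u i q)"
  by (simp add: chart_smooth_def C_on_sum open_chart_image[OF ch])

lemma chart_smooth_prod:
  fixes u :: "'i \<Rightarrow> 'a \<Rightarrow> real"
  shows "(\<And>i. i \<in> I \<Longrightarrow> chart_smooth \<kappa> (u i)) \<Longrightarrow> chart_smooth \<kappa> (\<lambda>q. \<Prod>i\<in>I. u i q)"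
  by (simp add: chart_smooth_def C_on_prod open_chart_image[OF ch])

lemma chart_smooth_inverse:
  fixes u :: "'a \<Rightarrow> real"
  shows "chart_smooth \<kappa> u \<Longrightarrow> (\<And>q. q \<in> cdom \<kappa> \<Longrightarrow> u q \<noteq> 0) \<Longrightarrow> chart_smooth \<kappa> (\<lambda>q. inverse (u q))"
  by (simp add: chart_smooth_def C_on_inverse[OF open_chart_image[OF ch]] cinv_in_cdom[OF ch])

lemma chart_smooth_sqrt:
  "chart_smooth \<kappa> u \<Longrightarrow> (\<And>q. q \<in> cdom \<kappa> \<Longrightarrow> u q > 0) \<Longrightarrow> chart_smooth \<kappa> (\<lambda>q. sqrt (u q))"
  by (simp add: chart_smooth_def C_on_sqrt[OF open_chart_image[OF ch]] cinv_in_cdom[OF ch])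

lemma chart_smooth_vec_iff:
  fixes u :: "'a \<Rightarrow> 'b::euclidean_space ^ 'n"
  shows "chart_smooth \<kappa> u \<longleftrightarrow> (\<forall>i. chart_smooth \<kappa> (\<lambda>q. u q $ i))"
  by (auto simp: chart_smooth_def C_on_vec_iff[OF open_chart_image[OF ch], of _ "\<lambda>y. u (cinv \<kappa> y)"])

lemma chart_smooth_mat_iff:
  fixes T :: "'a \<Rightarrow> real ^ 'm ^ 'm"
  shows "chart_smooth \<kappa> T \<longleftrightarrow> (\<forall>i j. chart_smooth \<kappa> (\<lambda>q. T q $ i $ j))"
  unfolding chart_smooth_vec_iff[of T] chart_smooth_vec_iff[of "\<lambda>q. T q $ i" for i] ..

lemma chart_smooth_has_derivative:
  fixes u :: "'a \<Rightarrow> real"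
  assumes "chart_smooth \<kappa> u" "p \<in> cdom \<kappa>"
  shows "((\<lambda>y. u (cinv \<kappa> y)) has_derivative (\<lambda>v. \<Sum>i\<in>UNIV. v $ i * pd \<kappa> i u p)) (at (cmap \<kappa> p))"
proof -
  let ?D = "frechet_derivative (\<lambda>y. u (cinv \<kappa> y)) (at (cmap \<kappa> p))"
  have "C_on (Suc 0) (cmap \<kappa> ` cdom \<kappa>) (\<lambda>y. u (cinv \<kappa> y))"
    using assms(1) unfolding chart_smooth_def by blast
  then have D: "((\<lambda>y. u (cinv \<kappa> y)) has_derivative ?D) (at (cmap \<kappa> p))"
    using C_on_SucD open_chart_image[OF ch] assms(2) by blast
  have "?D = (\<lambda>v. \<Sum>i\<in>UNIV. v $ i * pd \<kappa> i u p)"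
    unfolding pd_def by (rule ext, rule bounded_linear_vec_expansion[OF has_derivative_linear[OF D]])
  then show ?thesis using D by metis
qed

lemma pd_add:
  assumes "chart_smooth \<kappa> u" "chart_smooth \<kappa> v" "p \<in> cdom \<kappa>"
  shows "pd \<kappa> i (\<lambda>q. u q + v q) p = pd \<kappa> i u p + pd \<kappa> i v p"
  by (subst pd_eqI[OF has_derivative_add[OF assms(1,2)[THEN chart_smooth_has_derivative, OF assms(3)]]])
    (simp add: sum_axis)

lemma pd_mult:
  assumes "chart_smooth \<kappa> u" "chart_smooth \<kappa> v" "p \<in> cdom \<kappa>"
  shows "pd \<kappa> i (\<lambda>q. u q * v q) p = u p * pd \<kappa> i v p + pd \<kappa> i u p * v p"
  by (subst pd_eqI[OF has_derivative_mult[OF assms(1,2)[THEN chart_smooth_has_derivative, OF assms(3)]]])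
    (simp add: sum_axis cinv_cmap[OF ch assms(3)])

lemma pd_cmult:
  assumes "chart_smooth \<kappa> u" "p \<in> cdom \<kappa>"
  shows "pd \<kappa> i (\<lambda>q. c * u q) p = c * pd \<kappa> i u p"
  using pd_mult[OF chart_smooth_const assms] by (simp add: pd_const)

lemma pd_diff:
  assumes "chart_smooth \<kappa> u" "chart_smooth \<kappa> v" "p \<in> cdom \<kappa>"
  shows "pd \<kappa> i (\<lambda>q. u q - v q) p = pd \<kappa> i u p - pd \<kappa> i v p"
  by (subst pd_eqI[OF has_derivative_diff[OF assms(1,2)[THEN chart_smooth_has_derivative, OF assms(3)]]])
    (simp add: sum_axis)

lemma pd_sum:
  assumes "\<And>j. j \<in> I \<Longrightarrow> chart_smooth \<kappa> (u j)" "p \<in> cdom \<kappa>"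
  shows "pd \<kappa> i (\<lambda>q. \<Sum>j\<in>I. u j q) p = (\<Sum>j\<in>I. pd \<kappa> i (u j) p)"
  using assms(1)
  by (induction I rule: infinite_finite_induct) (auto simp: pd_const pd_add chart_smooth_sum assms(2))

lemma chart_smooth_pd:
  assumes "chart_smooth \<kappa> u"
  shows "chart_smooth \<kappa> (pd \<kappa> i u)"
  unfolding chart_smooth_def
proof
  fix k
  have "C_on (Suc k) (cmap \<kappa> ` cdom \<kappa>) (\<lambda>y. u (cinv \<kappa> y))"
    using assms unfolding chart_smooth_def by blast
  then have "C_on k (cmap \<kappa> ` cdom \<kappa>) (\<lambda>y. frechet_derivative (\<lambda>y. u (cinv \<kappa> y)) (at y) (axis i 1))"
    by simp
  then show "C_on k (cmap \<kappa> ` cdom \<kappa>) (\<lambda>y. pd \<kappa> i u (cinv \<kappa> y))"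
    by (rule C_on_cong[rotated 2]) (auto simp: open_chart_image[OF ch] pd_def cinv_cmap[OF ch])
qed

lemma pd_commute:
  assumes "chart_smooth \<kappa> u" "p \<in> cdom \<kappa>"
  shows "pd \<kappa> i (pd \<kappa> j u) p = pd \<kappa> j (pd \<kappa> i u) p"
proof -
  let ?f = "\<lambda>y. u (cinv \<kappa> y)" and ?S = "cmap \<kappa> ` cdom \<kappa>"
  have *: "pd \<kappa> i (pd \<kappa> j u) p
      = frechet_derivative (\<lambda>y. frechet_derivative ?f (at y) (axis j 1)) (at (cmap \<kappa> p)) (axis i 1)" for i j
    unfolding pd_def[of \<kappa> i "pd \<kappa> j u"]
    by (subst frechet_derivative_cong_open[OF open_chart_image[OF ch], of "cmap \<kappa> p" "\<lambda>y. pd \<kappa> j u (cinv \<kappa> y)"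
          "\<lambda>y. frechet_derivative ?f (at y) (axis j 1)"])
      (use assms in \<open>auto simp: pd_def cinv_cmap[OF ch]\<close>)
  have "C_on 2 ?S ?f" using assms(1) unfolding chart_smooth_def by blast
  from second_derivative_symmetric[OF open_chart_image[OF ch] this] show ?thesis
    unfolding * using assms(2) by blast
qed

lemma chart_smooth_det:
  assumes "chart_smooth \<kappa> T"
  shows "chart_smooth \<kappa> (\<lambda>q. det (T q :: real ^ 'm ^ 'm))"
  unfolding det_def using assms unfolding chart_smooth_mat_iff
  by (intro chart_smooth_sum chart_smooth_mult chart_smooth_const chart_smooth_prod) auto

end

section \<open>Inverses and determinants of matrices depending on a point\<close>

lemma matrix_inv_of_det_nonzero:
  fixes B :: "real ^ 'm ^ 'm"
  assumes "det B \<noteq> 0"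
  shows "B ** matrix_inv B = mat 1" "matrix_inv B ** B = mat 1"
proof -
  have "\<exists>C. B ** C = mat 1 \<and> C ** B = mat 1"
    using assms unfolding invertible_det_nz[symmetric] invertible_def .
  from someI_ex[OF this] show "B ** matrix_inv B = mat 1" "matrix_inv B ** B = mat 1"
    unfolding matrix_inv_def by auto
qed

text \<open>Cramer's rule: the inverse matrix is rational in the entries of \<open>B\<close>, whence
  its smooth dependence on a point of the manifold.\<close>

lemma matrix_inv_entry:
  fixes B :: "real ^ 'm ^ 'm"
  assumes "det B \<noteq> 0"
  shows "matrix_inv B $ i $ j = det (\<chi> a b. if b = i then axis j 1 $ a else B $ a $ b) * inverse (det B)"
proof -
  have "B *v (matrix_inv B *v axis j 1) = axis j 1"
    using assms by (simp add: matrix_vector_mul_assoc matrix_inv_of_det_nonzero)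
  then have "matrix_inv B *v axis j 1 = (\<chi> k. det (\<chi> a b. if b = k then axis j 1 $ a else B $ a $ b) / det B)"
    using cramer[OF assms] by blast
  then show ?thesis
    by (simp add: matrix_vector_mult_basis column_def vec_eq_iff divide_inverse)
qed

lemma chart_smooth_matrix_inv:
  fixes \<kappa> :: "('a::topological_space, 'm::finite) chart" and T :: "'a \<Rightarrow> real ^ 'm ^ 'm"
  assumes "is_chart \<kappa>" "chart_smooth \<kappa> T" "\<And>q. q \<in> cdom \<kappa> \<Longrightarrow> det (T q) \<noteq> 0"
  shows "chart_smooth \<kappa> (\<lambda>q. matrix_inv (T q) $ i $ j)"
proof (rule chart_smooth_cong[OF assms(1)])
  show "chart_smooth \<kappa> (\<lambda>q. det (\<chi> a b. if b = i then axis j 1 $ a else T q $ a $ b) * inverse (det (T q)))"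
  proof (intro chart_smooth_mult chart_smooth_inverse chart_smooth_det assms)
    have "chart_smooth \<kappa> (\<lambda>q. T q $ a $ b)" for a b
      using assms(2) unfolding chart_smooth_mat_iff[OF assms(1)] by blast
    then show "chart_smooth \<kappa> (\<lambda>q. \<chi> ia ja. if ja = i then axis j 1 $ ia else T q $ ia $ ja)"
      unfolding chart_smooth_mat_iff[OF assms(1)]
      by (intro allI, case_tac "ja = i") (simp_all add: chart_smooth_const[OF assms(1)])
  qed auto
qed (simp add: assms(3) matrix_inv_entry)

text \<open>The segment from the identity to \<open>B\<close> consists of matrices with positive
  quadratic form, hence of invertible ones, so the determinant cannot change sign along it.\<close>

lemma det_pos_of_positive_definite:
  fixes B :: "real ^ 'm ^ 'm"
  assumes "\<And>v. v \<noteq> 0 \<Longrightarrow> 0 < v \<bullet> (B *v v)"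
  shows "0 < det B"
proof (rule ccontr)
  let ?C = "\<lambda>s. (1 - s) *\<^sub>R mat 1 + s *\<^sub>R B"
  assume "\<not> 0 < det B"
  moreover have "continuous_on {0..1} (\<lambda>s. det (?C s))"
    unfolding det_def by (intro continuous_intros)
  moreover have "?C 0 = mat 1" "?C 1 = B" by auto
  ultimately obtain s where s: "0 \<le> s" "s \<le> 1" "det (?C s) = 0"
    using IVT2'[of "\<lambda>s. det (?C s)" 1 0 0] by force
  then obtain v where v: "v \<noteq> 0" "?C s *v v = 0"
    by (metis invertible_det_nz invertible_left_inverse matrix_left_invertible_ker)
  have "0 = v \<bullet> (?C s *v v)" using v by simp
  also have "\<dots> = (1 - s) * (v \<bullet> v) + s * (v \<bullet> (B *v v))"
    by (simp add: matrix_vector_mult_add_rdistrib scaleR_matrix_vector_assoc[symmetric] inner_add_right)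
  also have "\<dots> > 0"
  proof (cases "s = 0")
    case False
    then have "0 < s * (v \<bullet> (B *v v))" using s assms v by simp
    then show ?thesis using s by (simp add: add_nonneg_pos)
  qed (use v in simp)
  finally show False by simp
qed

section \<open>Linearity of the Laplacian\<close>

lemma matrix_vector_mult_component: "(B *v x) $ i = (\<Sum>j\<in>UNIV. B $ i $ j * x $ j)"
  by (simp add: matrix_vector_mult_def)

lemma matrix_matrix_mult_component: "(B ** C) $ i $ j = (\<Sum>k\<in>UNIV. B $ i $ k * C $ k $ j)"
  by (simp add: matrix_matrix_mult_def)

context
  fixes \<kappa> :: "('a::topological_space, 'm::finite) chart" and G :: "('a, 'm) mat_field"
  assumes ch: "is_chart \<kappa>" and Gs: "chart_smooth \<kappa> (G \<kappa>)"
    and Gpos: "\<And>q. q \<in> cdom \<kappa> \<Longrightarrow> 0 < det (G \<kappa> q)"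
begin

lemma chart_smooth_metric_det: "chart_smooth \<kappa> (\<lambda>q. sqrt (det (G \<kappa> q)))"
  by (intro chart_smooth_sqrt ch chart_smooth_det Gs Gpos)

lemma chart_smooth_metric_inv: "chart_smooth \<kappa> (\<lambda>q. matrix_inv (G \<kappa> q) $ i $ j)"
  by (rule chart_smooth_matrix_inv[OF ch Gs]) (use Gpos in force)

text \<open>These are the components that \<open>codiff1\<close> differentiates. Their smoothness is
  recorded because the rules for \<open>pd\<close>, which rests on
  \<open>frechet_derivative\<close>, hold only where derivatives exist.\<close>

lemma chart_smooth_flux:
  assumes "chart_smooth \<kappa> (\<alpha> \<kappa>)"
  shows "chart_smooth \<kappa> (\<lambda>q. sqrt (det (G \<kappa> q)) * (matrix_inv (G \<kappa> q) *v \<alpha> \<kappa> q) $ i)"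
  unfolding matrix_vector_mult_component
  using assms unfolding chart_smooth_vec_iff[OF ch]
  by (intro chart_smooth_mult chart_smooth_sum ch chart_smooth_metric_det chart_smooth_metric_inv) auto

lemma chart_smooth_flux2:
  assumes "chart_smooth \<kappa> (\<beta> \<kappa>)"
  shows "chart_smooth \<kappa> (\<lambda>q. sqrt (det (G \<kappa> q)) *
        (matrix_inv (G \<kappa> q) ** \<beta> \<kappa> q ** transpose (matrix_inv (G \<kappa> q))) $ i $ l)"
  unfolding matrix_matrix_mult_component transpose_def vec_lambda_beta
  using assms unfolding chart_smooth_mat_iff[OF ch]
  by (intro chart_smooth_mult chart_smooth_sum ch chart_smooth_metric_det chart_smooth_metric_inv) auto

lemma chart_smooth_codiff1:
  assumes "chart_smooth \<kappa> (\<alpha> \<kappa>)"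
  shows "chart_smooth \<kappa> (codiff1 G \<alpha> \<kappa>)"
proof -
  have "chart_smooth \<kappa> (\<lambda>q. (-1) * inverse (sqrt (det (G \<kappa> q))) *
     (\<Sum>i\<in>UNIV. pd \<kappa> i (\<lambda>q. sqrt (det (G \<kappa> q)) * (matrix_inv (G \<kappa> q) *v \<alpha> \<kappa> q) $ i) q))"
    using Gpos
    by (intro chart_smooth_mult chart_smooth_const chart_smooth_inverse chart_smooth_sum chart_smooth_pd ch
        chart_smooth_metric_det chart_smooth_flux assms) force
  then show ?thesis by (rule chart_smooth_cong[OF ch, rotated]) (simp add: codiff1_def divide_inverse)
qed

lemma chart_smooth_d_form:
  assumes "chart_smooth \<kappa> (\<alpha> \<kappa>)"
  shows "chart_smooth \<kappa> (d_form \<alpha> \<kappa>)"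
  using assms unfolding chart_smooth_mat_iff[OF ch] chart_smooth_vec_iff[OF ch] d_form_def vec_lambda_beta
  by (intro allI chart_smooth_diff chart_smooth_pd ch) auto

lemma codiff1_lincomb:
  assumes "chart_smooth \<kappa> (\<alpha> \<kappa>)" "chart_smooth \<kappa> (\<beta> \<kappa>)" "p \<in> cdom \<kappa>"
  shows "codiff1 G (\<lambda>\<kappa> q. a *\<^sub>R \<alpha> \<kappa> q + b *\<^sub>R \<beta> \<kappa> q) \<kappa> p = a * codiff1 G \<alpha> \<kappa> p + b * codiff1 G \<beta> \<kappa> p"
proof -
  let ?F = "\<lambda>\<alpha> i q. sqrt (det (G \<kappa> q)) * (matrix_inv (G \<kappa> q) *v \<alpha> \<kappa> q) $ i"
  have "pd \<kappa> i (?F (\<lambda>\<kappa> q. a *\<^sub>R \<alpha> \<kappa> q + b *\<^sub>R \<beta> \<kappa> q) i) p = a * pd \<kappa> i (?F \<alpha> i) p + b * pd \<kappa> i (?F \<beta> i) p" for i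
  proof -
    have "?F (\<lambda>\<kappa> q. a *\<^sub>R \<alpha> \<kappa> q + b *\<^sub>R \<beta> \<kappa> q) i = (\<lambda>q. a * ?F \<alpha> i q + b * ?F \<beta> i q)"
      by (rule ext) (simp add: matrix_vector_right_distrib matrix_vector_mult_scaleR algebra_simps)
    then show ?thesis
      using chart_smooth_flux[of \<alpha>, OF assms(1)] chart_smooth_flux[of \<beta>, OF assms(2)]
      by (simp add: pd_add[OF ch] pd_cmult[OF ch] chart_smooth_mult[OF ch] chart_smooth_const[OF ch] assms(3))
  qed
  then show ?thesis
    unfolding codiff1_def by (simp add: sum.distrib sum_distrib_left[symmetric] algebra_simps)
qed

lemma d_form_lincomb:
  assumes "chart_smooth \<kappa> (\<alpha> \<kappa>)" "chart_smooth \<kappa> (\<beta> \<kappa>)" "p \<in> cdom \<kappa>"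
  shows "d_form (\<lambda>\<kappa> q. a *\<^sub>R \<alpha> \<kappa> q + b *\<^sub>R \<beta> \<kappa> q) \<kappa> p = a *\<^sub>R d_form \<alpha> \<kappa> p + b *\<^sub>R d_form \<beta> \<kappa> p"
  using assms unfolding chart_smooth_vec_iff[OF ch]
  by (simp add: d_form_def vec_eq_iff pd_add[OF ch] pd_cmult[OF ch] chart_smooth_mult[OF ch]
      chart_smooth_const[OF ch] algebra_simps)

lemma codiff2_lincomb:
  assumes "chart_smooth \<kappa> (\<alpha> \<kappa>)" "chart_smooth \<kappa> (\<beta> \<kappa>)" "p \<in> cdom \<kappa>"
    and \<gamma>: "\<And>q. q \<in> cdom \<kappa> \<Longrightarrow> \<gamma> \<kappa> q = a *\<^sub>R \<alpha> \<kappa> q + b *\<^sub>R \<beta> \<kappa> q"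
  shows "codiff2 G \<gamma> \<kappa> p = a *\<^sub>R codiff2 G \<alpha> \<kappa> p + b *\<^sub>R codiff2 G \<beta> \<kappa> p"
proof -
  let ?F = "\<lambda>\<beta> i l q. sqrt (det (G \<kappa> q)) * (matrix_inv (G \<kappa> q) ** \<beta> \<kappa> q ** transpose (matrix_inv (G \<kappa> q))) $ i $ l"
  have "pd \<kappa> i (?F \<gamma> i l) p = a * pd \<kappa> i (?F \<alpha> i l) p + b * pd \<kappa> i (?F \<beta> i l) p" for i l
  proof -
    have "?F \<gamma> i l q = a * ?F \<alpha> i l q + b * ?F \<beta> i l q" if "q \<in> cdom \<kappa>" for q
      unfolding \<gamma>[OF that] matrix_matrix_mult_component
      by (simp add: sum.distrib sum_distrib_left sum_distrib_right algebra_simps)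
    then have "pd \<kappa> i (?F \<gamma> i l) p = pd \<kappa> i (\<lambda>q. a * ?F \<alpha> i l q + b * ?F \<beta> i l q) p"
      by (rule pd_cong[OF ch _ assms(3)])
    then show ?thesis
      using chart_smooth_flux2[of \<alpha>, OF assms(1)] chart_smooth_flux2[of \<beta>, OF assms(2)]
      by (simp add: pd_add[OF ch] pd_cmult[OF ch] chart_smooth_mult[OF ch] chart_smooth_const[OF ch] assms(3))
  qed
  then have "(\<chi> l. \<Sum>i\<in>UNIV. pd \<kappa> i (?F \<gamma> i l) p)
      = a *\<^sub>R (\<chi> l. \<Sum>i\<in>UNIV. pd \<kappa> i (?F \<alpha> i l) p) + b *\<^sub>R (\<chi> l. \<Sum>i\<in>UNIV. pd \<kappa> i (?F \<beta> i l) p)"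
    by (simp add: vec_eq_iff sum.distrib sum_distrib_left)
  then show ?thesis
    unfolding codiff2_def
    by (simp add: matrix_vector_right_distrib matrix_vector_mult_scaleR scaleR_add_right)
qed

lemma laplacian_lincomb:
  assumes "chart_smooth \<kappa> (\<alpha> \<kappa>)" "chart_smooth \<kappa> (\<beta> \<kappa>)" "p \<in> cdom \<kappa>"
  shows "laplacian G (\<lambda>\<kappa> q. a *\<^sub>R \<alpha> \<kappa> q + b *\<^sub>R \<beta> \<kappa> q) \<kappa> p = a *\<^sub>R laplacian G \<alpha> \<kappa> p + b *\<^sub>R laplacian G \<beta> \<kappa> p"
proof -
  let ?\<gamma> = "\<lambda>\<kappa> q. a *\<^sub>R \<alpha> \<kappa> q + b *\<^sub>R \<beta> \<kappa> q"
  have "pd \<kappa> j (codiff1 G ?\<gamma> \<kappa>) p = pd \<kappa> j (\<lambda>q. a * codiff1 G \<alpha> \<kappa> q + b * codiff1 G \<beta> \<kappa> q) p" for j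
    by (rule pd_cong[OF ch _ assms(3)]) (rule codiff1_lincomb[of \<alpha> \<beta>, OF assms(1,2)])
  also have "\<dots> j = a * pd \<kappa> j (codiff1 G \<alpha> \<kappa>) p + b * pd \<kappa> j (codiff1 G \<beta> \<kappa>) p" for j
    using chart_smooth_codiff1[of \<alpha>, OF assms(1)] chart_smooth_codiff1[of \<beta>, OF assms(2)]
    by (simp add: pd_add[OF ch] pd_cmult[OF ch] chart_smooth_mult[OF ch] chart_smooth_const[OF ch] assms(3))
  finally have "(\<chi> j. pd \<kappa> j (codiff1 G ?\<gamma> \<kappa>) p)
      = a *\<^sub>R (\<chi> j. pd \<kappa> j (codiff1 G \<alpha> \<kappa>) p) + b *\<^sub>R (\<chi> j. pd \<kappa> j (codiff1 G \<beta> \<kappa>) p)"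
    by (simp add: vec_eq_iff)
  moreover have "codiff2 G (d_form ?\<gamma>) \<kappa> p = a *\<^sub>R codiff2 G (d_form \<alpha>) \<kappa> p + b *\<^sub>R codiff2 G (d_form \<beta>) \<kappa> p"
    by (rule codiff2_lincomb[of "d_form \<alpha>" "d_form \<beta>", OF chart_smooth_d_form[of \<alpha>, OF assms(1)] chart_smooth_d_form[of \<beta>, OF assms(2)] assms(3)])
      (rule d_form_lincomb[of \<alpha> \<beta>, OF assms(1,2)])
  ultimately show ?thesis unfolding laplacian_def by (simp add: scaleR_add_right)
qed

text \<open>Components outside the chart domain are arbitrary in this encoding; derivatives at a
  point of the open domain do not see them.\<close>

lemma laplacian_cong:
  assumes "\<And>q. q \<in> cdom \<kappa> \<Longrightarrow> \<alpha> \<kappa> q = \<beta> \<kappa> q" "p \<in> cdom \<kappa>"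
  shows "laplacian G \<alpha> \<kappa> p = laplacian G \<beta> \<kappa> p"
proof -
  have 1: "codiff1 G \<alpha> \<kappa> q = codiff1 G \<beta> \<kappa> q" if "q \<in> cdom \<kappa>" for q
    unfolding codiff1_def using assms(1) that
    by (intro arg_cong2[where f="(*)"] refl sum.cong pd_cong[OF ch]) auto
  have 2: "d_form \<alpha> \<kappa> q = d_form \<beta> \<kappa> q" if "q \<in> cdom \<kappa>" for q
    unfolding d_form_def using assms(1) that
    by (auto simp: vec_eq_iff intro!: arg_cong2[where f="(-)"] pd_cong[OF ch])
  have 3: "(\<chi> l. \<Sum>i\<in>UNIV. pd \<kappa> i (\<lambda>q. sqrt (det (G \<kappa> q)) *
        (matrix_inv (G \<kappa> q) ** d_form \<alpha> \<kappa> q ** transpose (matrix_inv (G \<kappa> q))) $ i $ l) p)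
      = (\<chi> l. \<Sum>i\<in>UNIV. pd \<kappa> i (\<lambda>q. sqrt (det (G \<kappa> q)) *
        (matrix_inv (G \<kappa> q) ** d_form \<beta> \<kappa> q ** transpose (matrix_inv (G \<kappa> q))) $ i $ l) p)"
    unfolding vec_eq_iff vec_lambda_beta
    by (intro allI sum.cong refl pd_cong[OF ch] assms(2)) (simp add: 2)
  have "pd \<kappa> j (codiff1 G \<alpha> \<kappa>) p = pd \<kappa> j (codiff1 G \<beta> \<kappa>) p" for j
    by (rule pd_cong[OF ch 1 assms(2)])
  then show ?thesis unfolding laplacian_def codiff2_def 3 by simp
qed

end

section \<open>From a single chart to the atlas: harmonic forms are a linear space\<close>

lemma closed_manifold_chart: "closed_connected_manifold A \<Longrightarrow> \<kappa> \<in> A \<Longrightarrow> is_chart \<kappa>"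
  by (simp add: closed_connected_manifold_def smooth_atlas_def)

lemma chart_smooth_iff_smooth_on:
  assumes "is_chart \<kappa>"
  shows "chart_smooth \<kappa> u \<longleftrightarrow> smooth_on (cmap \<kappa> ` cdom \<kappa>) (\<lambda>y. u (cinv \<kappa> y))"
  unfolding chart_smooth_def smooth_on_open_iff[OF open_chart_image[OF assms]] ..

lemma one_form_chart_smooth: "one_form A \<alpha> \<Longrightarrow> \<kappa> \<in> A \<Longrightarrow> is_chart \<kappa> \<Longrightarrow> chart_smooth \<kappa> (\<alpha> \<kappa>)"
  by (simp add: one_form_def chart_smooth_iff_smooth_on)

lemma smooth_fun_chart_smooth: "smooth_fun A u \<Longrightarrow> \<kappa> \<in> A \<Longrightarrow> is_chart \<kappa> \<Longrightarrow> chart_smooth \<kappa> u"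
  by (simp add: smooth_fun_def chart_smooth_iff_smooth_on)

lemma riemannian_metric_chart_smooth:
  "riemannian_metric A G \<Longrightarrow> \<kappa> \<in> A \<Longrightarrow> is_chart \<kappa> \<Longrightarrow> chart_smooth \<kappa> (G \<kappa>)"
  by (simp add: riemannian_metric_def covariant_2_tensor_def chart_smooth_iff_smooth_on)

lemma riemannian_metric_det_pos:
  "riemannian_metric A G \<Longrightarrow> \<kappa> \<in> A \<Longrightarrow> q \<in> cdom \<kappa> \<Longrightarrow> 0 < det (G \<kappa> q)"
  by (rule det_pos_of_positive_definite) (simp add: riemannian_metric_def)

context
  fixes A :: "('a::{t2_space, second_countable_topology}, 'm::finite) chart set" and G :: "('a, 'm) mat_field"
  assumes man: "closed_connected_manifold A" and riem: "riemannian_metric A G"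
begin

lemma riemannian_metric_chart_smooth_closed: "\<kappa> \<in> A \<Longrightarrow> chart_smooth \<kappa> (G \<kappa>)"
  by (rule riemannian_metric_chart_smooth[OF riem _ closed_manifold_chart[OF man]])

lemmas metric_chart = closed_manifold_chart[OF man] riemannian_metric_chart_smooth_closed
  riemannian_metric_det_pos[OF riem]

lemma one_form_lincomb:
  assumes "one_form A \<alpha>" "one_form A \<beta>"
  shows "one_form A (\<lambda>\<kappa> q. a *\<^sub>R \<alpha> \<kappa> q + b *\<^sub>R \<beta> \<kappa> q)"
  unfolding one_form_def
proof (intro conjI ballI)
  fix \<kappa> assume \<kappa>: "\<kappa> \<in> A"
  note ch = closed_manifold_chart[OF man \<kappa>]
  have "chart_smooth \<kappa> (\<alpha> \<kappa>)" "chart_smooth \<kappa> (\<beta> \<kappa>)"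
    using assms[THEN one_form_chart_smooth, OF \<kappa> ch] by auto
  then have "chart_smooth \<kappa> (\<lambda>q. a *\<^sub>R \<alpha> \<kappa> q + b *\<^sub>R \<beta> \<kappa> q)"
    unfolding chart_smooth_vec_iff[OF ch]
    by (auto intro!: chart_smooth_add chart_smooth_mult chart_smooth_const ch)
  then show "smooth_on (cmap \<kappa> ` cdom \<kappa>) (\<lambda>y. a *\<^sub>R \<alpha> \<kappa> (cinv \<kappa> y) + b *\<^sub>R \<beta> \<kappa> (cinv \<kappa> y))"
    unfolding chart_smooth_iff_smooth_on[OF ch] .
  fix \<kappa>' p assume \<kappa>': "\<kappa>' \<in> A" "p \<in> cdom \<kappa> \<inter> cdom \<kappa>'"
  then have "\<alpha> \<kappa> p = transpose (jacobian \<kappa> \<kappa>' p) *v \<alpha> \<kappa>' p" "\<beta> \<kappa> p = transpose (jacobian \<kappa> \<kappa>' p) *v \<beta> \<kappa>' p"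
    using assms \<kappa> unfolding one_form_def by blast+
  then show "a *\<^sub>R \<alpha> \<kappa> p + b *\<^sub>R \<beta> \<kappa> p = transpose (jacobian \<kappa> \<kappa>' p) *v (a *\<^sub>R \<alpha> \<kappa>' p + b *\<^sub>R \<beta> \<kappa>' p)"
    by (simp add: matrix_vector_right_distrib matrix_vector_mult_scaleR)
qed

lemma harmonic_lincomb:
  assumes "harmonic A G \<alpha>" "harmonic A G \<beta>"
  shows "harmonic A G (\<lambda>\<kappa> q. a *\<^sub>R \<alpha> \<kappa> q + b *\<^sub>R \<beta> \<kappa> q)"
  unfolding harmonic_def
proof (intro conjI ballI)
  show "one_form A (\<lambda>\<kappa> q. a *\<^sub>R \<alpha> \<kappa> q + b *\<^sub>R \<beta> \<kappa> q)"
    using assms by (intro one_form_lincomb) (auto simp: harmonic_def)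
  fix \<kappa> p assume \<kappa>: "\<kappa> \<in> A" "p \<in> cdom \<kappa>"
  have "chart_smooth \<kappa> (\<alpha> \<kappa>)" "chart_smooth \<kappa> (\<beta> \<kappa>)"
    using assms one_form_chart_smooth[OF _ \<kappa>(1) closed_manifold_chart[OF man \<kappa>(1)]] by (auto simp: harmonic_def)
  from laplacian_lincomb[of \<kappa> G \<alpha> \<beta>, OF metric_chart(1,2)[OF \<kappa>(1)] metric_chart(3)[OF \<kappa>(1)] this \<kappa>(2)]
  show "laplacian G (\<lambda>\<kappa> q. a *\<^sub>R \<alpha> \<kappa> q + b *\<^sub>R \<beta> \<kappa> q) \<kappa> p = 0"
    using assms \<kappa> by (simp add: harmonic_def)
qed

lemma harmonic_zero: "harmonic A G (\<lambda>\<kappa> q. 0)"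
  unfolding harmonic_def
proof (intro conjI ballI)
  show "one_form A (\<lambda>\<kappa> q. 0)"
    unfolding one_form_def
    using chart_smooth_const[OF closed_manifold_chart[OF man], of _ "0 :: real ^ 'm"]
    by (simp add: chart_smooth_iff_smooth_on closed_manifold_chart[OF man])
  fix \<kappa> p assume \<kappa>: "\<kappa> \<in> A" "p \<in> cdom \<kappa>"
  have z: "chart_smooth \<kappa> ((\<lambda>\<kappa> q. 0) \<kappa> :: 'a \<Rightarrow> real ^ 'm)"
    by (rule chart_smooth_const[OF closed_manifold_chart[OF man \<kappa>(1)]])
  show "laplacian G (\<lambda>\<kappa> q. 0) \<kappa> p = 0"
    using laplacian_lincomb[of \<kappa> G "\<lambda>\<kappa> q. 0" "\<lambda>\<kappa> q. 0", OF metric_chart(1,2)[OF \<kappa>(1)] metric_chart(3)[OF \<kappa>(1)] z z \<kappa>(2), of 0 0] by simp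
qed

lemma harmonic_sum:
  assumes "\<forall>i<b::nat. harmonic A G (h i)"
  shows "harmonic A G (\<lambda>\<kappa> q. \<Sum>i<b. c i *\<^sub>R h i \<kappa> q)"
  using assms
proof (induction b)
  case (Suc b)
  then show ?case
    using harmonic_lincomb[of "\<lambda>\<kappa> q. \<Sum>i<b. c i *\<^sub>R h i \<kappa> q" "h b" 1 "c b"] by simp
qed (simp add: harmonic_zero)

end

section \<open>Invariance of the codifferential under changes of charts\<close>

context
  fixes \<kappa> :: "('a::topological_space, 'm::finite) chart" and D
  assumes ch: "is_chart \<kappa>" and D: "open D" "D \<subseteq> cdom \<kappa>"
begin

lemma cdom_restrict [simp]: "cdom (D, cmap \<kappa>) = D" and cmap_restrict [simp]: "cmap (D, cmap \<kappa>) = cmap \<kappa>"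
  by (simp_all add: cdom_def cmap_def)

text \<open>\<open>cinv\<close> is \<open>inv_into\<close> of the domain, so shrinking the domain
  changes it as a function, though not on the image of \<open>D\<close>. Overlapping charts are
  restricted in this way to a common domain, where coordinate changes can be treated without mention
  of overlaps.\<close>

lemma cinv_restrict: "y \<in> cmap \<kappa> ` D \<Longrightarrow> cinv (D, cmap \<kappa>) y = cinv \<kappa> y"
proof -
  assume "y \<in> cmap \<kappa> ` D"
  then obtain p where p: "p \<in> D" "y = cmap \<kappa> p" by auto
  have "inj_on (cmap \<kappa>) D" using cinv_cmap[OF ch] D by (metis inj_on_inverseI subsetD)
  then have "cinv (D, cmap \<kappa>) y = p"
    unfolding cinv_def cdom_restrict cmap_restrict p(2) using p(1) by (rule inv_into_f_f)
  then show ?thesis using cinv_cmap[OF ch] p D by auto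
qed

lemma open_restrict_image: "open (cmap \<kappa> ` D)"
proof -
  have "cmap \<kappa> ` D = cmap \<kappa> ` cdom \<kappa> \<inter> cinv \<kappa> -` D"
    using cinv_cmap[OF ch] cmap_cinv[OF ch] cinv_in_cdom[OF ch] D(2)
    by (auto simp: image_iff subset_iff)
  then show ?thesis
    using continuous_open_preimage[OF continuous_on_cinv[OF ch] open_chart_image[OF ch] D(1)] by simp
qed

lemma is_chart_restrict: "is_chart (D, cmap \<kappa>)"
  unfolding is_chart_def cdom_restrict cmap_restrict
proof (intro conjI D(1) open_restrict_image)
  have "homeomorphism D (cmap \<kappa> ` D) (cmap \<kappa>) (cinv \<kappa>)"
    unfolding homeomorphism_def
    using continuous_on_subset[OF continuous_on_cmap[OF ch] D(2)]
      continuous_on_subset[OF continuous_on_cinv[OF ch] image_mono[OF D(2)]]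
      cinv_cmap[OF ch] D(2)
    by (auto simp: image_image subset_iff)
  then show "homeomorphism D (cmap \<kappa> ` D) (cmap \<kappa>) (cinv (D, cmap \<kappa>))"
    by (rule homeomorphism_cong) (simp_all add: cinv_restrict)
qed

lemma chart_smooth_restrict:
  assumes "chart_smooth \<kappa> u"
  shows "chart_smooth (D, cmap \<kappa>) u"
  unfolding chart_smooth_def cdom_restrict cmap_restrict
proof
  fix k
  have "C_on k (cmap \<kappa> ` D) (\<lambda>y. u (cinv \<kappa> y))"
    using assms D(2) C_on_subset unfolding chart_smooth_def by (metis image_mono)
  then show "C_on k (cmap \<kappa> ` D) (\<lambda>y. u (cinv (D, cmap \<kappa>) y))"
    by (rule C_on_cong[OF open_restrict_image, rotated]) (simp add: cinv_restrict)
qed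

lemma pd_restrict:
  assumes "p \<in> D"
  shows "pd (D, cmap \<kappa>) i u p = pd \<kappa> i u p"
  unfolding pd_def cmap_restrict
  by (subst frechet_derivative_cong_open[OF open_restrict_image, of "cmap \<kappa> p" _ "\<lambda>y. u (cinv \<kappa> y)"])
    (use assms in \<open>auto simp: cinv_restrict\<close>)

end

lemma pd_coordinate:
  assumes "is_chart \<kappa>" "p \<in> cdom \<kappa>"
  shows "pd \<kappa> j (\<lambda>q. cmap \<kappa> q $ i) p = (if i = j then 1 else 0)"
proof -
  have "pd \<kappa> j (\<lambda>q. cmap \<kappa> q $ i) p = frechet_derivative (\<lambda>y. y $ i) (at (cmap \<kappa> p)) (axis j 1)"
    unfolding pd_def
    by (subst frechet_derivative_cong_open[OF open_chart_image[OF assms(1)], of "cmap \<kappa> p" _ "\<lambda>y. y $ i"])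
      (use assms in \<open>auto simp: cinv_cmap\<close>)
  also have "\<dots> = axis j 1 $ i"
    by (subst frechet_derivative_at[symmetric, of _ "\<lambda>v. v $ i"])
      (auto intro!: bounded_linear_imp_has_derivative bounded_linear_vec_nth)
  finally show ?thesis by (simp add: axis_def)
qed

lemma chart_smooth_coordinate:
  assumes "is_chart \<kappa>"
  shows "chart_smooth \<kappa> (\<lambda>q. cmap \<kappa> q $ i)"
  unfolding chart_smooth_def
proof
  fix k
  have "C_on k (cmap \<kappa> ` cdom \<kappa>) (\<lambda>y. y $ i)"
    by (rule C_on_linear[OF open_chart_image[OF assms] bounded_linear_vec_nth C_on_ident[OF open_chart_image[OF assms]]])
  then show "C_on k (cmap \<kappa> ` cdom \<kappa>) (\<lambda>y. cmap \<kappa> (cinv \<kappa> y) $ i)"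
    by (rule C_on_cong[OF open_chart_image[OF assms], rotated]) (simp add: cmap_cinv[OF assms])
qed

section \<open>Derivative of a determinant\<close>

lemma pd_prod:
  fixes u :: "'i \<Rightarrow> 'a::topological_space \<Rightarrow> real"
  assumes "is_chart \<kappa>" "p \<in> cdom \<kappa>" "finite I" "\<And>k. k \<in> I \<Longrightarrow> chart_smooth \<kappa> (u k)"
  shows "pd \<kappa> i (\<lambda>q. \<Prod>k\<in>I. u k q) p = (\<Sum>k\<in>I. pd \<kappa> i (u k) p * (\<Prod>l\<in>I - {k}. u l p))"
  using assms(3,4)
proof (induction I rule: finite_induct)
  case (insert k I)
  have "(\<Prod>l\<in>insert k I - {j}. u l p) = u k p * (\<Prod>l\<in>I - {j}. u l p)" if "j \<in> I" for j
  proof -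
    have "insert k I - {j} = insert k (I - {j})" using insert.hyps that by auto
    then show ?thesis using insert.hyps by simp
  qed
  moreover have "insert k I - {k} = I" using insert.hyps by auto
  ultimately show ?case
    using insert by (simp add: pd_mult[OF assms(1)] chart_smooth_prod[OF assms(1)] assms(2)
        sum_distrib_left mult.assoc mult.left_commute)
qed (simp add: pd_const)

text \<open>In the Leibniz formula a permutation other than the identity moves at least two indices.
  After one factor has been differentiated there remains an off-diagonal entry of the identity
  matrix, which is 0, so only the trace survives.\<close>

lemma pd_det_at_identity:
  fixes T :: "'a::topological_space \<Rightarrow> real ^ 'm ^ 'm"
  assumes "is_chart \<kappa>" "p \<in> cdom \<kappa>" "\<And>k l. chart_smooth \<kappa> (\<lambda>q. T q $ k $ l)" "T p = mat 1"
  shows "pd \<kappa> i (\<lambda>q. det (T q)) p = (\<Sum>k\<in>UNIV. pd \<kappa> i (\<lambda>q. T q $ k $ k) p)"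
proof -
  let ?S = "{\<sigma>. \<sigma> permutes (UNIV :: 'm set)}"
  let ?t = "\<lambda>\<sigma>. of_int (sign \<sigma>) * (\<Sum>k\<in>UNIV. pd \<kappa> i (\<lambda>q. T q $ k $ \<sigma> k) p * (\<Prod>l\<in>UNIV - {k}. T p $ l $ \<sigma> l))"
  have "pd \<kappa> i (\<lambda>q. det (T q)) p = (\<Sum>\<sigma>\<in>?S. ?t \<sigma>)"
    unfolding det_def
    by (subst pd_sum[OF assms(1)])
      (auto simp: pd_cmult[OF assms(1)] pd_prod[OF assms(1)] assms(2,3) chart_smooth_prod[OF assms(1)]
        intro!: chart_smooth_mult chart_smooth_const assms(1))
  also have "\<dots> = (\<Sum>\<sigma>\<in>{id}. ?t \<sigma>)"
  proof (rule sum.mono_neutral_right)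
    show "\<forall>\<sigma>\<in>?S - {id}. ?t \<sigma> = 0"
    proof
      fix \<sigma> assume \<sigma>: "\<sigma> \<in> ?S - {id}"
      then obtain k0 where k0: "\<sigma> k0 \<noteq> k0" by (auto simp: fun_eq_iff)
      have "inj \<sigma>" using \<sigma> permutes_inj by auto
      then have k1: "\<sigma> (\<sigma> k0) \<noteq> \<sigma> k0" using k0 by (auto dest: injD)
      have z: "(\<Prod>l\<in>UNIV - {k}. T p $ l $ \<sigma> l) = 0" for k
      proof (rule prod_zero)
        show "\<exists>l\<in>UNIV - {k}. T p $ l $ \<sigma> l = 0"
          using k0 k1 by (cases "k = k0") (auto simp: assms(4) mat_def intro: bexI[of _ "\<sigma> k0"] bexI[of _ k0])
      qed simp
      show "?t \<sigma> = 0" unfolding z by simp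
    qed
  qed (auto simp: permutes_id)
  also have "\<dots> = (\<Sum>k\<in>UNIV. pd \<kappa> i (\<lambda>q. T q $ k $ k) p)"
    by (simp add: assms(4) mat_def)
  finally show ?thesis .
qed

text \<open>Jacobi's formula. Multiplying by the constant inverse of \<open>T p\<close> moves the
  base value to the identity, where the derivative of the determinant is the trace.\<close>

lemma pd_det:
  fixes T :: "'a::topological_space \<Rightarrow> real ^ 'm ^ 'm"
  assumes "is_chart \<kappa>" "p \<in> cdom \<kappa>" "\<And>k l. chart_smooth \<kappa> (\<lambda>q. T q $ k $ l)" "det (T p) \<noteq> 0"
  shows "pd \<kappa> i (\<lambda>q. det (T q)) p
    = det (T p) * (\<Sum>k\<in>UNIV. \<Sum>l\<in>UNIV. matrix_inv (T p) $ k $ l * pd \<kappa> i (\<lambda>q. T q $ l $ k) p)"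
proof -
  let ?K = "matrix_inv (T p)"
  have e: "(\<lambda>q. (?K ** T q) $ k $ l) = (\<lambda>q. \<Sum>j\<in>UNIV. ?K $ k $ j * T q $ j $ l)" for k l
    by (simp add: matrix_matrix_mult_component)
  have s: "chart_smooth \<kappa> (\<lambda>q. (?K ** T q) $ k $ l)" for k l
    unfolding e by (intro chart_smooth_sum chart_smooth_mult chart_smooth_const assms)
  have "det (T p) * det ?K = 1"
    using matrix_inv_of_det_nonzero(1)[OF assms(4)] by (simp add: det_mul[symmetric])
  then have "(\<lambda>q. det (T q)) = (\<lambda>q. det (T p) * det (?K ** T q))"
    by (simp add: det_mul mult.assoc[symmetric])
  then have "pd \<kappa> i (\<lambda>q. det (T q)) p = pd \<kappa> i (\<lambda>q. det (T p) * det (?K ** T q)) p" by simp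
  also have "\<dots> = det (T p) * pd \<kappa> i (\<lambda>q. det (?K ** T q)) p"
    by (rule pd_cmult[OF assms(1) _ assms(2)])
      (unfold det_def, intro chart_smooth_sum chart_smooth_mult chart_smooth_const chart_smooth_prod s assms(1))
  also have "pd \<kappa> i (\<lambda>q. det (?K ** T q)) p = (\<Sum>k\<in>UNIV. pd \<kappa> i (\<lambda>q. (?K ** T q) $ k $ k) p)"
    by (rule pd_det_at_identity[OF assms(1,2) s matrix_inv_of_det_nonzero(2)[OF assms(4)]])
  also have "\<dots> = (\<Sum>k\<in>UNIV. \<Sum>l\<in>UNIV. ?K $ k $ l * pd \<kappa> i (\<lambda>q. T q $ l $ k) p)"
    unfolding e using assms(3)
    by (simp add: pd_sum[OF assms(1) _ assms(2)] pd_cmult[OF assms(1) _ assms(2)]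
        chart_smooth_mult[OF assms(1)] chart_smooth_const[OF assms(1)])
  finally show ?thesis .
qed

text \<open>The pointwise algebra of a coordinate change: \<open>J\<close> is the Jacobian matrix,
  \<open>K\<close> its inverse, \<open>S\<close> the second derivatives, \<open>D\<close> stands for
  \<open>|det J|\<close>. The equations for \<open>dD\<close>, \<open>dK\<close> and
  \<open>dP\<close> are Jacobi's formula, the derivative of an inverse and the chain rule. The left
  side is the divergence of \<open>D K P\<close> after the product rule.\<close>

lemma divergence_transformation_algebra:
  fixes J K dP' :: "'m::finite \<Rightarrow> 'm \<Rightarrow> real" and S :: "'m \<Rightarrow> 'm \<Rightarrow> 'm \<Rightarrow> real"
  assumes JK: "\<And>b a. (\<Sum>i\<in>UNIV. J b i * K i a) = (if a = b then 1 else 0)"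
    and S: "\<And>a c i. S a c i = S a i c"
    and dD: "\<And>i. dD i = D * (\<Sum>c\<in>UNIV. \<Sum>a\<in>UNIV. K c a * S a c i)"
    and dK: "\<And>i c e. dK i c e = - (\<Sum>d\<in>UNIV. \<Sum>a\<in>UNIV. K c a * S a d i * K d e)"
    and dP: "\<And>i a. dP i a = (\<Sum>b\<in>UNIV. dP' b a * J b i)"
  shows "(\<Sum>i\<in>UNIV. \<Sum>a\<in>UNIV. dD i * K i a * P a + D * dK i i a * P a + D * K i a * dP i a)
    = D * (\<Sum>a\<in>UNIV. dP' a a)"
proof -
  have main: "(\<Sum>i\<in>UNIV. D * K i a * dP i a) = D * dP' a a" for a
  proof -
    have "(\<Sum>i\<in>UNIV. D * K i a * dP i a) = (\<Sum>i\<in>UNIV. \<Sum>b\<in>UNIV. D * dP' b a * (J b i * K i a))"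
      unfolding dP sum_distrib_left by (simp add: mult.commute mult.left_commute)
    also have "\<dots> = (\<Sum>b\<in>UNIV. D * dP' b a * (\<Sum>i\<in>UNIV. J b i * K i a))"
      by (subst sum.swap) (simp add: sum_distrib_left)
    also have "\<dots> = D * dP' a a" by (simp add: JK if_distrib cong: if_cong)
    finally show ?thesis .
  qed
  \<comment> \<open>The Piola identity: the columns of \<open>D K\<close> have divergence 0. The
    terms from \<open>dD\<close> and \<open>dK\<close> are the same contraction of two factors
    \<open>K\<close> with \<open>S\<close>, up to exchanging the two symmetric indices of
    \<open>S\<close>.\<close>
  have piola: "(\<Sum>i\<in>UNIV. dD i * K i a + D * dK i i a) = 0" for a
  proof -
    have "(\<Sum>i\<in>UNIV. \<Sum>d\<in>UNIV. \<Sum>b\<in>UNIV. K i b * S b d i * K d a)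
        = (\<Sum>d\<in>UNIV. \<Sum>i\<in>UNIV. \<Sum>b\<in>UNIV. K i b * S b d i * K d a)"
      by (rule sum.swap)
    also have "\<dots> = (\<Sum>i\<in>UNIV. (\<Sum>c\<in>UNIV. \<Sum>b\<in>UNIV. K c b * S b c i) * K i a)"
      unfolding sum_distrib_right by (subst S) simp
    finally have E: "(\<Sum>i\<in>UNIV. \<Sum>d\<in>UNIV. \<Sum>b\<in>UNIV. K i b * S b d i * K d a)
        = (\<Sum>i\<in>UNIV. (\<Sum>c\<in>UNIV. \<Sum>b\<in>UNIV. K c b * S b c i) * K i a)" .
    have "dD i * K i a + D * dK i i a = D * ((\<Sum>c\<in>UNIV. \<Sum>b\<in>UNIV. K c b * S b c i) * K i a
        - (\<Sum>d\<in>UNIV. \<Sum>b\<in>UNIV. K i b * S b d i * K d a))" for i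
      unfolding dD dK by (simp add: right_diff_distrib)
    then show ?thesis
      by (simp only: sum_distrib_left[symmetric] sum_subtractf E) simp
  qed
  have "(\<Sum>i\<in>UNIV. \<Sum>a\<in>UNIV. dD i * K i a * P a + D * dK i i a * P a + D * K i a * dP i a)
    = (\<Sum>a\<in>UNIV. (\<Sum>i\<in>UNIV. dD i * K i a + D * dK i i a) * P a + (\<Sum>i\<in>UNIV. D * K i a * dP i a))"
    by (subst sum.swap) (simp add: sum.distrib sum_distrib_right distrib_right)
  then show ?thesis unfolding main piola by (simp add: sum_distrib_left)
qed


section \<open>Change of coordinates between two charts with the same domain\<close>

context
  fixes \<kappa> \<kappa>' :: "('a::topological_space, 'm::finite) chart"
  assumes ch: "is_chart \<kappa>" and ch': "is_chart \<kappa>'" and dom: "cdom \<kappa>' = cdom \<kappa>"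
    and trans: "chart_smooth \<kappa> (cmap \<kappa>')" "chart_smooth \<kappa>' (cmap \<kappa>)"
begin

text \<open>Rows belong to the coordinates of \<open>\<kappa>'\<close>, columns to those of
  \<open>\<kappa>\<close>. Built from \<open>pd\<close>, so that its entries can be differentiated
  again by the rules for \<open>pd\<close>; \<open>jacobian_eq_transition_derivative\<close>
  identifies it with \<open>jacobian\<close>.\<close>

definition transition_derivative :: "'a \<Rightarrow> real ^ 'm ^ 'm" where
  "transition_derivative p = (\<chi> a i. pd \<kappa> i (\<lambda>q. cmap \<kappa>' q $ a) p)"

lemma coordinate_smooth: "chart_smooth \<kappa> (\<lambda>q. cmap \<kappa>' q $ a)"
  by (rule iffD1[OF chart_smooth_vec_iff[OF ch] trans(1), rule_format])

lemma has_derivative_transition: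
  assumes "p \<in> cdom \<kappa>"
  shows "((\<lambda>y. cmap \<kappa>' (cinv \<kappa> y)) has_derivative (\<lambda>v. transition_derivative p *v v)) (at (cmap \<kappa> p))"
proof (rule iffD2[OF has_derivative_componentwise_within], rule ballI)
  fix b :: "real ^ 'm" assume "b \<in> Basis"
  then obtain a where b: "b = axis a 1" by (auto simp: Basis_vec_def)
  have "chart_smooth \<kappa> (\<lambda>q. cmap \<kappa>' q $ a)" by (rule coordinate_smooth)
  from chart_smooth_has_derivative[OF ch this assms]
  show "((\<lambda>y. cmap \<kappa>' (cinv \<kappa> y) \<bullet> b) has_derivative (\<lambda>v. (transition_derivative p *v v) \<bullet> b)) (at (cmap \<kappa> p))"
    unfolding b inner_axis transition_derivative_def matrix_vector_mult_component vec_lambda_beta inner_real_def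
    by (simp only: mult_1_right mult.commute[of "_ $ _"])
qed

lemma pd_chain:
  assumes "chart_smooth \<kappa>' f" "p \<in> cdom \<kappa>"
  shows "pd \<kappa> i f p = (\<Sum>a\<in>UNIV. pd \<kappa>' a f p * transition_derivative p $ a $ i)"
proof -
  have f: "((\<lambda>z. f (cinv \<kappa>' z)) has_derivative (\<lambda>v. \<Sum>a\<in>UNIV. v $ a * pd \<kappa>' a f p)) (at (cmap \<kappa>' (cinv \<kappa> (cmap \<kappa> p))))"
    using chart_smooth_has_derivative[OF ch' assms(1)] assms(2) by (simp add: dom cinv_cmap[OF ch])
  have "((\<lambda>y. f (cinv \<kappa>' (cmap \<kappa>' (cinv \<kappa> y)))) has_derivative
      (\<lambda>v. \<Sum>a\<in>UNIV. (transition_derivative p *v v) $ a * pd \<kappa>' a f p)) (at (cmap \<kappa> p))"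
    by (rule has_derivative_compose[OF has_derivative_transition[OF assms(2)] f])
  then have "((\<lambda>y. f (cinv \<kappa> y)) has_derivative
      (\<lambda>v. \<Sum>a\<in>UNIV. (transition_derivative p *v v) $ a * pd \<kappa>' a f p)) (at (cmap \<kappa> p))"
    by (rule has_derivative_transform_within_open[OF _ open_chart_image[OF ch]])
      (use assms(2) cinv_in_cdom[OF ch] in \<open>auto simp: dom cinv_cmap[OF ch']\<close>)
  from pd_eqI[OF this] show ?thesis
    by (simp add: matrix_vector_mult_basis column_def mult.commute)
qed

lemma chart_smooth_chain:
  fixes f :: "'a \<Rightarrow> real"
  assumes "chart_smooth \<kappa>' f"
  shows "chart_smooth \<kappa> f"
  unfolding chart_smooth_def
proof
  fix k
  have "C_on k (cmap \<kappa> ` cdom \<kappa>) (\<lambda>y. f (cinv \<kappa>' (cmap \<kappa>' (cinv \<kappa> y))))"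
    by (rule C_on_compose[where g="\<lambda>z. f (cinv \<kappa>' z)" and T="cmap \<kappa>' ` cdom \<kappa>'"])
      (use assms trans(1) cinv_in_cdom[OF ch] in
        \<open>auto simp: chart_smooth_def open_chart_image[OF ch] open_chart_image[OF ch', unfolded dom] dom\<close>)
  then show "C_on k (cmap \<kappa> ` cdom \<kappa>) (\<lambda>y. f (cinv \<kappa> y))"
    by (rule C_on_cong[OF open_chart_image[OF ch], rotated]) (simp add: cinv_in_cdom[OF ch] dom cinv_cmap[OF ch'])
qed

text \<open>The chain rule for the coordinates of \<open>\<kappa>\<close> itself says that the
  derivative of the opposite transition is a left inverse.\<close>

lemma det_transition_derivative:
  assumes "p \<in> cdom \<kappa>"
  shows "det (transition_derivative p) \<noteq> 0"
proof -
  have "(\<chi> i a. pd \<kappa>' a (\<lambda>q. cmap \<kappa> q $ i) p) ** transition_derivative p = mat 1"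
    unfolding vec_eq_iff matrix_matrix_mult_component vec_lambda_beta
  proof (intro allI)
    fix i j
    have "chart_smooth \<kappa>' (\<lambda>q. cmap \<kappa> q $ i)"
      by (rule iffD1[OF chart_smooth_vec_iff[OF ch'] trans(2), rule_format])
    from pd_chain[OF this assms, of j]
    show "(\<Sum>a\<in>UNIV. pd \<kappa>' a (\<lambda>q. cmap \<kappa> q $ i) p * transition_derivative p $ a $ j) = mat 1 $ i $ j"
      by (simp add: pd_coordinate[OF ch assms] mat_def)
  qed
  then show ?thesis by (metis det_I det_mul mult_zero_right zero_neq_one)
qed

lemma chart_smooth_transition_derivative: "chart_smooth \<kappa> (\<lambda>q. transition_derivative q $ a $ i)"
  unfolding transition_derivative_def vec_lambda_beta
  by (rule chart_smooth_pd[OF ch coordinate_smooth])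

text \<open>Charts may reverse orientation, so densities carry an absolute value. With
  \<open>d\<close> the determinant, \<open>|d|\<close> is smooth as \<open>sqrt (d * d)\<close>, and
  its derivative is found by differentiating \<open>|d| * |d| = d * d\<close> and cancelling
  \<open>|d|\<close>, without a distinction by the sign of \<open>d\<close>.\<close>

lemma pd_abs_det:
  assumes "p \<in> cdom \<kappa>"
  shows "chart_smooth \<kappa> (\<lambda>q. \<bar>det (transition_derivative q)\<bar>)"
    and "pd \<kappa> i (\<lambda>q. \<bar>det (transition_derivative q)\<bar>) p = \<bar>det (transition_derivative p)\<bar> *
      (\<Sum>c\<in>UNIV. \<Sum>a\<in>UNIV. matrix_inv (transition_derivative p) $ c $ a *
        pd \<kappa> i (\<lambda>q. transition_derivative q $ a $ c) p)"
proof -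
  let ?d = "\<lambda>q. det (transition_derivative q)"
  let ?D = "\<lambda>q. \<bar>?d q\<bar>"
  have d: "chart_smooth \<kappa> ?d"
    by (rule chart_smooth_det[OF ch]) (simp add: chart_smooth_mat_iff[OF ch] chart_smooth_transition_derivative)
  have "chart_smooth \<kappa> (\<lambda>q. sqrt (?d q * ?d q))"
    by (intro chart_smooth_sqrt chart_smooth_mult ch d) (use det_transition_derivative in \<open>auto simp: zero_less_mult_iff neq_iff\<close>)
  then show D: "chart_smooth \<kappa> ?D" by simp
  let ?tr = "\<Sum>c\<in>UNIV. \<Sum>a\<in>UNIV. matrix_inv (transition_derivative p) $ c $ a * pd \<kappa> i (\<lambda>q. transition_derivative q $ a $ c) p"
  have pd_d: "pd \<kappa> i ?d p = ?d p * ?tr"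
    by (rule pd_det[OF ch assms chart_smooth_transition_derivative det_transition_derivative[OF assms]])
  have "pd \<kappa> i (\<lambda>q. ?D q * ?D q) p = pd \<kappa> i (\<lambda>q. ?d q * ?d q) p" by (simp add: abs_mult_self_eq)
  then have "2 * (?D p * pd \<kappa> i ?D p) = 2 * (?d p * (?d p * ?tr))"
    using pd_mult[OF ch D D assms, of i] pd_mult[OF ch d d assms, of i] by (simp add: pd_d algebra_simps)
  then have "?D p * pd \<kappa> i ?D p = ?D p * (?D p * ?tr)"
    by (simp add: mult.assoc[symmetric])
  then show "pd \<kappa> i ?D p = ?D p * ?tr" using det_transition_derivative[OF assms] by simp
qed

text \<open>Differentiate \<open>K J = 1\<close>, where \<open>K\<close> is the inverse of
  \<open>J\<close>, and multiply by \<open>K\<close> on the right.\<close>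

lemma pd_inv_transition:
  assumes "p \<in> cdom \<kappa>"
  shows "chart_smooth \<kappa> (\<lambda>q. matrix_inv (transition_derivative q) $ c $ e)"
    and "pd \<kappa> i (\<lambda>q. matrix_inv (transition_derivative q) $ c $ e) p =
      - (\<Sum>d\<in>UNIV. \<Sum>a\<in>UNIV. matrix_inv (transition_derivative p) $ c $ a *
        pd \<kappa> i (\<lambda>q. transition_derivative q $ a $ d) p * matrix_inv (transition_derivative p) $ d $ e)"
proof -
  let ?J = transition_derivative and ?K = "\<lambda>q. matrix_inv (transition_derivative q)"
  have K: "chart_smooth \<kappa> (\<lambda>q. ?K q $ c $ e)" for c e
    by (rule chart_smooth_matrix_inv[OF ch])
      (simp_all add: chart_smooth_mat_iff[OF ch] chart_smooth_transition_derivative det_transition_derivative)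
  then show "chart_smooth \<kappa> (\<lambda>q. ?K q $ c $ e)" .
  have *: "(\<Sum>a\<in>UNIV. pd \<kappa> i (\<lambda>q. ?K q $ c $ a) p * ?J p $ a $ d)
      = - (\<Sum>a\<in>UNIV. ?K p $ c $ a * pd \<kappa> i (\<lambda>q. ?J q $ a $ d) p)" for d
  proof -
    have "pd \<kappa> i (\<lambda>q. \<Sum>a\<in>UNIV. ?K q $ c $ a * ?J q $ a $ d) p = pd \<kappa> i (\<lambda>q. mat 1 $ c $ d) p"
      by (rule pd_cong[OF ch _ assms])
        (simp add: matrix_matrix_mult_component[symmetric] matrix_inv_of_det_nonzero det_transition_derivative)
    then show ?thesis
      by (simp add: pd_const pd_sum[OF ch _ assms] pd_mult[OF ch K chart_smooth_transition_derivative assms]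
          chart_smooth_mult[OF ch K chart_smooth_transition_derivative] sum.distrib)
  qed
  have "pd \<kappa> i (\<lambda>q. ?K q $ c $ e) p = (\<Sum>a\<in>UNIV. pd \<kappa> i (\<lambda>q. ?K q $ c $ a) p * mat 1 $ a $ e)"
    by (simp add: mat_def if_distrib cong: if_cong)
  also have "\<dots> = (\<Sum>a\<in>UNIV. pd \<kappa> i (\<lambda>q. ?K q $ c $ a) p * (\<Sum>d\<in>UNIV. ?J p $ a $ d * ?K p $ d $ e))"
    by (simp add: matrix_matrix_mult_component[symmetric] matrix_inv_of_det_nonzero det_transition_derivative assms)
  also have "\<dots> = (\<Sum>d\<in>UNIV. (\<Sum>a\<in>UNIV. pd \<kappa> i (\<lambda>q. ?K q $ c $ a) p * ?J p $ a $ d) * ?K p $ d $ e)"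
    unfolding sum_distrib_left sum_distrib_right by (subst sum.swap) (simp add: mult.assoc)
  also have "\<dots> = - (\<Sum>d\<in>UNIV. \<Sum>a\<in>UNIV. ?K p $ c $ a * pd \<kappa> i (\<lambda>q. ?J q $ a $ d) p * ?K p $ d $ e)"
    unfolding * by (simp add: sum_distrib_right sum_negf)
  finally show "pd \<kappa> i (\<lambda>q. ?K q $ c $ e) p = \<dots>" .
qed

text \<open>\<open>P\<close> is the Piola transform of \<open>P'\<close>, the law by which vector
  densities change charts; the divergence of a vector density is a scalar density.\<close>

lemma divergence_transformation:
  assumes p: "p \<in> cdom \<kappa>"
    and P': "\<And>a. chart_smooth \<kappa>' (P' a)"
    and P: "\<And>q i. q \<in> cdom \<kappa> \<Longrightarrow> P i q = \<bar>det (transition_derivative q)\<bar> *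
      (\<Sum>a\<in>UNIV. matrix_inv (transition_derivative q) $ i $ a * P' a q)"
  shows "(\<Sum>i\<in>UNIV. pd \<kappa> i (P i) p) = \<bar>det (transition_derivative p)\<bar> * (\<Sum>a\<in>UNIV. pd \<kappa>' a (P' a) p)"
proof -
  let ?J = transition_derivative and ?K = "\<lambda>q. matrix_inv (transition_derivative q)"
  let ?D = "\<lambda>q. \<bar>det (?J q)\<bar>"
  note D = pd_abs_det[OF p] and K = pd_inv_transition[OF p]
  note P'k = chart_smooth_chain[OF P']
  have "pd \<kappa> i (P i) p = (\<Sum>a\<in>UNIV. pd \<kappa> i ?D p * ?K p $ i $ a * P' a p
      + ?D p * pd \<kappa> i (\<lambda>q. ?K q $ i $ a) p * P' a p + ?D p * ?K p $ i $ a * pd \<kappa> i (P' a) p)" for i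
  proof -
    have "pd \<kappa> i (P i) p = pd \<kappa> i (\<lambda>q. ?D q * (\<Sum>a\<in>UNIV. ?K q $ i $ a * P' a q)) p"
      by (rule pd_cong[OF ch P p])
    also have "\<dots> = ?D p * (\<Sum>a\<in>UNIV. ?K p $ i $ a * pd \<kappa> i (P' a) p + pd \<kappa> i (\<lambda>q. ?K q $ i $ a) p * P' a p)
        + pd \<kappa> i ?D p * (\<Sum>a\<in>UNIV. ?K p $ i $ a * P' a p)"
      by (simp only: pd_mult[OF ch D(1) chart_smooth_sum[OF ch chart_smooth_mult[OF ch K(1) P'k]] p]
          pd_sum[OF ch chart_smooth_mult[OF ch K(1) P'k] p] pd_mult[OF ch K(1) P'k p])
    also have "\<dots> = (\<Sum>a\<in>UNIV. pd \<kappa> i ?D p * ?K p $ i $ a * P' a p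
      + ?D p * pd \<kappa> i (\<lambda>q. ?K q $ i $ a) p * P' a p + ?D p * ?K p $ i $ a * pd \<kappa> i (P' a) p)"
      by (simp add: sum_distrib_left sum.distrib[symmetric] algebra_simps)
    finally show ?thesis .
  qed
  then have "(\<Sum>i\<in>UNIV. pd \<kappa> i (P i) p) = (\<Sum>i\<in>UNIV. \<Sum>a\<in>UNIV. pd \<kappa> i ?D p * ?K p $ i $ a * P' a p
      + ?D p * pd \<kappa> i (\<lambda>q. ?K q $ i $ a) p * P' a p + ?D p * ?K p $ i $ a * pd \<kappa> i (P' a) p)" by simp
  also have "\<dots> = ?D p * (\<Sum>a\<in>UNIV. pd \<kappa>' a (P' a) p)"
  proof (rule divergence_transformation_algebra[where J="\<lambda>a i. ?J p $ a $ i" and K="\<lambda>i a. ?K p $ i $ a"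
        and dP'="\<lambda>b a. pd \<kappa>' b (P' a) p" and S="\<lambda>a c i. pd \<kappa> i (\<lambda>q. ?J q $ a $ c) p"
        and dK="\<lambda>i c e. pd \<kappa> i (\<lambda>q. ?K q $ c $ e) p" and dD="\<lambda>i. pd \<kappa> i ?D p" and dP="\<lambda>i a. pd \<kappa> i (P' a) p"])
    show "(\<Sum>i\<in>UNIV. ?J p $ b $ i * ?K p $ i $ a) = (if a = b then 1 else 0)" for a b
      by (simp add: matrix_matrix_mult_component[symmetric] matrix_inv_of_det_nonzero
          det_transition_derivative p mat_def)
    show "pd \<kappa> i (\<lambda>q. ?J q $ a $ c) p = pd \<kappa> c (\<lambda>q. ?J q $ a $ i) p" for a c i
    proof -
      have "chart_smooth \<kappa> (\<lambda>q. cmap \<kappa>' q $ a)" by (rule coordinate_smooth)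
      from pd_commute[OF ch this p] show ?thesis by (simp add: transition_derivative_def)
    qed
    show "pd \<kappa> i (P' a) p = (\<Sum>b\<in>UNIV. pd \<kappa>' b (P' a) p * ?J p $ b $ i)" for i a
      by (rule pd_chain[OF P' p])
  qed (rule D(2), rule K(2))
  finally show ?thesis .
qed

end


text \<open>Together the two parts say that \<open>sqrt (det g)\<close> times the raised form is a
  vector density: they supply the factor \<open>|det J|\<close> and the inverse of \<open>J\<close>
  of a Piola transform. The second part is checked by applying \<open>g\<close> to the right
  side.\<close>

lemma flux_transformation:
  fixes J g g' :: "real ^ 'm ^ 'm"
  assumes J: "det J \<noteq> 0" and g': "0 < det g'" and g: "g = transpose J ** g' ** J" and \<alpha>: "\<alpha> = transpose J *v \<alpha>'"
  shows "sqrt (det g) = \<bar>det J\<bar> * sqrt (det g')"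
    and "matrix_inv g *v \<alpha> = matrix_inv J *v (matrix_inv g' *v \<alpha>')"
proof -
  have det: "det g = (det J)\<^sup>2 * det g'"
    by (simp add: g det_mul power2_eq_square)
  then show "sqrt (det g) = \<bar>det J\<bar> * sqrt (det g')" by (simp add: real_sqrt_mult)
  let ?X = "matrix_inv J *v (matrix_inv g' *v \<alpha>')"
  have "g *v ?X = transpose J *v (g' *v (J *v ?X))"
    by (simp add: g matrix_vector_mul_assoc[symmetric] del: matrix_vector_mul_assoc)
  also have "J *v ?X = matrix_inv g' *v \<alpha>'"
    by (simp add: matrix_vector_mul_assoc[of J] matrix_inv_of_det_nonzero[OF J])
  also have "g' *v (matrix_inv g' *v \<alpha>') = \<alpha>'"
    using g' by (simp add: matrix_vector_mul_assoc[of g'] matrix_inv_of_det_nonzero)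
  finally have "g *v ?X = \<alpha>" by (simp add: \<alpha>)
  moreover have "det g \<noteq> 0" using det J g' by simp
  ultimately show "matrix_inv g *v \<alpha> = ?X"
    by (metis matrix_inv_of_det_nonzero(2) matrix_vector_mul_assoc matrix_vector_mul_lid)
qed

lemma chart_smooth_transition_restrict:
  fixes A :: "('a::{t2_space, second_countable_topology}, 'm::finite) chart set"
  assumes man: "closed_connected_manifold A" and \<kappa>: "\<kappa> \<in> A" and \<kappa>': "\<kappa>' \<in> A"
    and D: "open D" "D \<subseteq> cdom \<kappa>" "D \<subseteq> cdom \<kappa>'"
  shows "chart_smooth (D, cmap \<kappa>) (cmap (D, cmap \<kappa>'))"
proof -
  note ch = closed_manifold_chart[OF man \<kappa>] and ch' = closed_manifold_chart[OF man \<kappa>']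
  let ?E = "cdom \<kappa> \<inter> cdom \<kappa>'"
  have E: "open ?E" "?E \<subseteq> cdom \<kappa>" using open_cdom[OF ch] open_cdom[OF ch'] by auto
  have "smooth_on (cmap \<kappa> ` ?E) (\<lambda>y. cmap \<kappa>' (cinv \<kappa> y))"
    using man \<kappa> \<kappa>' unfolding closed_connected_manifold_def smooth_atlas_def by blast
  then have "\<forall>k. C_on k (cmap \<kappa> ` ?E) (\<lambda>y. cmap \<kappa>' (cinv \<kappa> y))"
    using smooth_on_open_iff[OF open_restrict_image[OF ch E]] by blast
  then have "C_on k (cmap \<kappa> ` D) (\<lambda>y. cmap \<kappa>' (cinv \<kappa> y))" for k
    using D(2,3) by (blast intro: C_on_subset)
  then show ?thesis
    unfolding chart_smooth_def cdom_restrict[OF ch D(1,2)] cmap_restrict[OF ch D(1,2)] cmap_restrict[OF ch' D(1,3)]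
    using C_on_cong[OF open_restrict_image[OF ch D(1,2)], of "\<lambda>y. cmap \<kappa>' (cinv \<kappa> y)"]
    by (simp add: cinv_restrict[OF ch D(1,2)])
qed

lemma jacobian_eq_transition_derivative:
  fixes A :: "('a::{t2_space, second_countable_topology}, 'm::finite) chart set"
  assumes man: "closed_connected_manifold A" and \<kappa>: "\<kappa> \<in> A" and \<kappa>': "\<kappa>' \<in> A"
    and D: "open D" "D \<subseteq> cdom \<kappa>" "D \<subseteq> cdom \<kappa>'" and q: "q \<in> D"
  shows "jacobian \<kappa> \<kappa>' q = transition_derivative (D, cmap \<kappa>) (D, cmap \<kappa>') q"
proof -
  note ch = closed_manifold_chart[OF man \<kappa>] and ch' = closed_manifold_chart[OF man \<kappa>']
  let ?k = "(D, cmap \<kappa>)" and ?k' = "(D, cmap \<kappa>')"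
  have "frechet_derivative (\<lambda>y. cmap \<kappa>' (cinv \<kappa> y)) (at (cmap \<kappa> q))
      = frechet_derivative (\<lambda>y. cmap ?k' (cinv ?k y)) (at (cmap \<kappa> q))"
    by (rule frechet_derivative_cong_open[OF open_restrict_image[OF ch D(1,2)]])
      (use q in \<open>auto simp: cinv_restrict[OF ch D(1,2)] cmap_restrict[OF ch' D(1,3)]\<close>)
  also have "\<dots> = (\<lambda>v. transition_derivative ?k ?k' q *v v)"
    using frechet_derivative_at[OF has_derivative_transition[OF is_chart_restrict[OF ch D(1,2)]
          is_chart_restrict[OF ch' D(1,3)] _ chart_smooth_transition_restrict[OF man \<kappa> \<kappa>' D]
          chart_smooth_transition_restrict[OF man \<kappa>' \<kappa> D(1,3,2)]]] q
    by (simp add: cdom_restrict[OF ch D(1,2)] cdom_restrict[OF ch' D(1,3)] cmap_restrict[OF ch D(1,2)])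
  finally show ?thesis by (simp add: jacobian_def)
qed

text \<open>The divergence of the flux and \<open>sqrt (det g)\<close> both acquire the factor
  \<open>|det J|\<close>, which cancels in the quotient. The charts are first cut down to their
  overlap \<open>D\<close>.\<close>

lemma codiff1_chart_independent:
  fixes A :: "('a::{t2_space, second_countable_topology}, 'm::finite) chart set"
  assumes man: "closed_connected_manifold A" and riem: "riemannian_metric A G" and \<alpha>: "one_form A \<alpha>"
    and \<kappa>: "\<kappa> \<in> A" and \<kappa>': "\<kappa>' \<in> A" and p: "p \<in> cdom \<kappa>" "p \<in> cdom \<kappa>'"
  shows "codiff1 G \<alpha> \<kappa> p = codiff1 G \<alpha> \<kappa>' p"
proof -
  define D where "D = cdom \<kappa> \<inter> cdom \<kappa>'"
  note ch = closed_manifold_chart[OF man \<kappa>] and ch' = closed_manifold_chart[OF man \<kappa>']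
  have D: "open D" "D \<subseteq> cdom \<kappa>" "D \<subseteq> cdom \<kappa>'"
    using open_cdom[OF ch] open_cdom[OF ch'] by (auto simp: D_def)
  let ?k = "(D, cmap \<kappa>)" and ?k' = "(D, cmap \<kappa>')"
  note ck = is_chart_restrict[OF ch D(1,2)] and ck' = is_chart_restrict[OF ch' D(1,3)]
  note r = cdom_restrict[OF ch D(1,2)] cmap_restrict[OF ch D(1,2)]
  note t1 = chart_smooth_transition_restrict[OF man \<kappa> \<kappa>' D]
    and t2 = chart_smooth_transition_restrict[OF man \<kappa>' \<kappa> D(1,3,2)]
  have dom: "cdom ?k' = cdom ?k" by (simp add: cdom_def)
  let ?J = "transition_derivative ?k ?k'"
  note J = jacobian_eq_transition_derivative[OF man \<kappa> \<kappa>' D]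
  let ?F = "\<lambda>\<kappa> i q. sqrt (det (G \<kappa> q)) * (matrix_inv (G \<kappa> q) *v \<alpha> \<kappa> q) $ i"
  have F': "chart_smooth ?k' (?F \<kappa>' a)" for a
    by (intro chart_smooth_restrict[OF ch' D(1,3)] chart_smooth_flux[where \<alpha>=\<alpha> and G=G] ch'
        metric_chart(2,3)[OF man riem \<kappa>'] one_form_chart_smooth[OF \<alpha> \<kappa>' ch'])
  have rel: "sqrt (det (G \<kappa> q)) = \<bar>det (?J q)\<bar> * sqrt (det (G \<kappa>' q))"
    "matrix_inv (G \<kappa> q) *v \<alpha> \<kappa> q = matrix_inv (?J q) *v (matrix_inv (G \<kappa>' q) *v \<alpha> \<kappa>' q)"
    if "q \<in> D" for q
  proof -
    have q: "q \<in> cdom \<kappa> \<inter> cdom \<kappa>'" using that by (simp add: D_def)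
    have "G \<kappa> q = transpose (?J q) ** G \<kappa>' q ** ?J q" "\<alpha> \<kappa> q = transpose (?J q) *v \<alpha> \<kappa>' q"
      unfolding J[OF that, symmetric] using riem \<alpha> \<kappa> \<kappa>' q
      unfolding riemannian_metric_def covariant_2_tensor_def one_form_def by blast+
    moreover have "det (?J q) \<noteq> 0"
      using det_transition_derivative[OF ck ck' dom t1 t2] that by (simp add: r)
    ultimately show "sqrt (det (G \<kappa> q)) = \<bar>det (?J q)\<bar> * sqrt (det (G \<kappa>' q))"
      "matrix_inv (G \<kappa> q) *v \<alpha> \<kappa> q = matrix_inv (?J q) *v (matrix_inv (G \<kappa>' q) *v \<alpha> \<kappa>' q)"
      using flux_transformation metric_chart(3)[OF man riem \<kappa>'] q by blast+
  qed
  have pD: "p \<in> D" using p by (simp add: D_def)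
  have "(\<Sum>i\<in>UNIV. pd ?k i (?F \<kappa> i) p) = \<bar>det (?J p)\<bar> * (\<Sum>a\<in>UNIV. pd ?k' a (?F \<kappa>' a) p)"
  proof (rule divergence_transformation[OF ck ck' dom t1 t2 _ F'])
    fix q i assume "q \<in> cdom ?k"
    then have "q \<in> D" by (simp add: r)
    from rel[OF this] show "?F \<kappa> i q = \<bar>det (?J q)\<bar> * (\<Sum>a\<in>UNIV. matrix_inv (?J q) $ i $ a * ?F \<kappa>' a q)"
      by (simp add: matrix_vector_mult_component[of "matrix_inv (?J q)"] sum_distrib_left algebra_simps)
  qed (simp add: r pD)
  then have "(\<Sum>i\<in>UNIV. pd \<kappa> i (?F \<kappa> i) p) = \<bar>det (?J p)\<bar> * (\<Sum>a\<in>UNIV. pd \<kappa>' a (?F \<kappa>' a) p)"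
    by (simp add: pd_restrict[OF ch D(1,2) pD] pd_restrict[OF ch' D(1,3) pD])
  moreover have "det (?J p) \<noteq> 0"
    using det_transition_derivative[OF ck ck' dom t1 t2] pD by (simp add: r)
  ultimately show ?thesis unfolding codiff1_def rel(1)[OF pD] by simp
qed

section \<open>Maximum principles\<close>

text \<open>For a nonnegative form this is a nonnegative quadratic polynomial in \<open>t\<close>.
  Suitable values of \<open>t\<close> force row \<open>k\<close> to vanish when
  \<open>a k k = 0\<close>, and complete the square otherwise.\<close>

lemma psd_expand_axis:
  fixes a :: "'m::finite \<Rightarrow> 'm \<Rightarrow> real"
  assumes sym: "\<And>i j. a i j = a j i"
  shows "(\<Sum>i\<in>UNIV. \<Sum>j\<in>UNIV. a i j * (x i + t * (if i = k then 1 else 0)) * (x j + t * (if j = k then 1 else 0)))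
    = (\<Sum>i\<in>UNIV. \<Sum>j\<in>UNIV. a i j * x i * x j) + 2 * t * (\<Sum>j\<in>UNIV. a k j * x j) + t\<^sup>2 * a k k"
proof -
  have expand: "\<alpha> * (y + t * d) * (z + t * e) = \<alpha> * y * z + t * (\<alpha> * y * e) + t * (\<alpha> * d * z) + t\<^sup>2 * (\<alpha> * d * e)"
    for \<alpha> y z d e :: real
    by (simp add: algebra_simps power2_eq_square)
  let ?d = "\<lambda>i. if i = k then 1 else (0::real)"
  have 1: "(\<Sum>i\<in>UNIV. \<Sum>j\<in>UNIV. t * (a i j * x i * ?d j)) = t * (\<Sum>i\<in>UNIV. a i k * x i)"
    unfolding sum_distrib_left by (rule sum.cong[OF refl]) (simp add: if_distrib cong: if_cong)
  have 2: "(\<Sum>i\<in>UNIV. \<Sum>j\<in>UNIV. t * (a i j * ?d i * x j)) = t * (\<Sum>j\<in>UNIV. a k j * x j)"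
    unfolding sum_distrib_left by (subst sum.swap, rule sum.cong[OF refl]) (simp add: if_distrib if_distribR cong: if_cong)
  have "(\<Sum>j\<in>UNIV. t\<^sup>2 * (a i j * ?d i * ?d j)) = (if i = k then t\<^sup>2 * a k k else 0)" for i
    by (cases "i = k") (simp_all add: if_distrib cong: if_cong)
  then have 3: "(\<Sum>i\<in>UNIV. \<Sum>j\<in>UNIV. t\<^sup>2 * (a i j * ?d i * ?d j)) = t\<^sup>2 * a k k" by simp
  have "(\<Sum>i\<in>UNIV. \<Sum>j\<in>UNIV. a i j * (x i + t * ?d i) * (x j + t * ?d j))
    = (\<Sum>i\<in>UNIV. \<Sum>j\<in>UNIV. a i j * x i * x j + t * (a i j * x i * ?d j) + t * (a i j * ?d i * x j)
        + t\<^sup>2 * (a i j * ?d i * ?d j))"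
    by (rule sum.cong[OF refl], rule sum.cong[OF refl], rule expand)
  also have "\<dots> = (\<Sum>i\<in>UNIV. \<Sum>j\<in>UNIV. a i j * x i * x j) + t * (\<Sum>i\<in>UNIV. a i k * x i)
      + t * (\<Sum>j\<in>UNIV. a k j * x j) + t\<^sup>2 * a k k"
    unfolding sum.distrib 1 2 3 ..
  also have "(\<Sum>i\<in>UNIV. a i k * x i) = (\<Sum>j\<in>UNIV. a k j * x j)"
    by (rule sum.cong[OF refl], subst sym, rule refl)
  finally show ?thesis by simp
qed

text \<open>Gaussian elimination in place of diagonalisation. One index of the support
  \<open>I\<close> is removed at a time by splitting off a rank one form from \<open>a\<close>; the
  rest is supported on the smaller set, and the rank one part contributes a nonnegative multiple of
  a value of the form \<open>H\<close>.\<close>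

lemma sum_psd_nsd_nonpos:
  fixes a H :: "'m::finite \<Rightarrow> 'm \<Rightarrow> real"
  assumes "finite I" and "\<And>i j. a i j = a j i"
    and "\<And>i j. i \<notin> I \<Longrightarrow> a i j = 0"
    and "\<And>x. 0 \<le> (\<Sum>i\<in>UNIV. \<Sum>j\<in>UNIV. a i j * x i * x j)"
    and H: "\<And>x. (\<Sum>i\<in>UNIV. \<Sum>j\<in>UNIV. H i j * x i * x j) \<le> 0"
  shows "(\<Sum>i\<in>UNIV. \<Sum>j\<in>UNIV. a i j * H i j) \<le> 0"
  using assms(1-4)
proof (induction I arbitrary: a rule: finite_induct)
  case empty
  then show ?case by simp
next
  case (insert k I)
  note sym = insert.prems(1) and psd = insert.prems(3)
  \<comment> \<open>The Schur complement of the pivot \<open>a k k\<close>. With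
    \<open>inverse 0 = 0\<close> it also covers a zero pivot: nothing is subtracted then, and
    \<open>zero\<close> shows that row \<open>k\<close> vanishes already.\<close>
  define a' where "a' i j = a i j - a k i * a k j * inverse (a k k)" for i j
  have akk: "0 \<le> a k k"
    using psd[of "\<lambda>i. 0 + 1 * (if i = k then 1 else 0)"]
    unfolding psd_expand_axis[of a "\<lambda>i. 0", OF sym] by simp
  have zero: "a k j = 0" if "a k k = 0" for j
  proof (rule ccontr)
    assume "a k j \<noteq> 0"
    \<comment> \<open>When \<open>a k k = 0\<close> the form is affine in \<open>t\<close> on the
      line through axis vector \<open>j\<close> in direction \<open>k\<close>; this \<open>t\<close>
      gives it the value -1.\<close>
    define t where "t = - (a j j + 1) / (2 * a k j)"
    let ?e = "\<lambda>i. if i = j then 1 else (0::real)"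
    have "0 \<le> (\<Sum>i\<in>UNIV. \<Sum>l\<in>UNIV. a i l * ?e i * ?e l) + 2 * t * (\<Sum>l\<in>UNIV. a k l * ?e l) + t\<^sup>2 * a k k"
      using psd[of "\<lambda>i. ?e i + t * (if i = k then 1 else 0)"] unfolding psd_expand_axis[of a, OF sym] .
    also have "(\<Sum>i\<in>UNIV. \<Sum>l\<in>UNIV. a i l * ?e i * ?e l) = a j j"
      using psd_expand_axis[of a "\<lambda>i. 0" 1 j, OF sym] by simp
    also have "(\<Sum>l\<in>UNIV. a k l * ?e l) = a k j" by (simp add: if_distrib cong: if_cong)
    also have "a j j + 2 * t * a k j + t\<^sup>2 * a k k = - 1"
      using \<open>a k j \<noteq> 0\<close> that by (simp add: t_def field_simps)
    finally show False by simp
  qed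
  have "(\<Sum>i\<in>UNIV. \<Sum>j\<in>UNIV. a' i j * H i j) \<le> 0"
  proof (rule insert.IH)
    show "a' i j = a' j i" for i j by (simp add: a'_def sym[of i j])
    show "a' i j = 0" if "i \<notin> I" for i j
    proof (cases "i = k")
      case True
      then show ?thesis using zero by (cases "a k k = 0") (auto simp: a'_def)
    next
      case False
      then have "a i l = 0" for l using insert.prems(2) that by blast
      then show ?thesis using sym[of k i] by (simp add: a'_def)
    qed
    show "0 \<le> (\<Sum>i\<in>UNIV. \<Sum>j\<in>UNIV. a' i j * x i * x j)" for x
    proof -
      define s where "s = (\<Sum>j\<in>UNIV. a k j * x j)"
      \<comment> \<open>For a nonzero pivot this minimises the form at \<open>x + t e_k\<close> over
        \<open>t\<close>, and the minimum is the Schur complement at \<open>x\<close>; for a zero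
        pivot it is 0.\<close>
      define t where "t = - s * inverse (a k k)"
      have ss: "(\<Sum>i\<in>UNIV. \<Sum>j\<in>UNIV. (a k i * x i) * (a k j * x j)) = s\<^sup>2"
        by (simp add: s_def power2_eq_square sum_product)
      have "(\<Sum>i\<in>UNIV. \<Sum>j\<in>UNIV. a' i j * x i * x j)
        = (\<Sum>i\<in>UNIV. \<Sum>j\<in>UNIV. a i j * x i * x j) - inverse (a k k) * (\<Sum>i\<in>UNIV. \<Sum>j\<in>UNIV. (a k i * x i) * (a k j * x j))"
        unfolding sum_distrib_left sum_subtractf[symmetric]
        by (intro sum.cong refl) (simp add: a'_def algebra_simps)
      also have "\<dots> = (\<Sum>i\<in>UNIV. \<Sum>j\<in>UNIV. a i j * x i * x j) + 2 * t * s + t\<^sup>2 * a k k"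
        unfolding ss t_def using zero by (cases "a k k = 0") (auto simp: field_simps power2_eq_square)
      also have "\<dots> \<ge> 0"
        using psd[of "\<lambda>i. x i + t * (if i = k then 1 else 0)"]
        unfolding psd_expand_axis[of a, OF sym] s_def .
      finally show ?thesis .
    qed
  qed
  moreover have "(\<Sum>i\<in>UNIV. \<Sum>j\<in>UNIV. a i j * H i j)
      = (\<Sum>i\<in>UNIV. \<Sum>j\<in>UNIV. a' i j * H i j) + inverse (a k k) * (\<Sum>i\<in>UNIV. \<Sum>j\<in>UNIV. H i j * a k i * a k j)"
    unfolding sum_distrib_left sum.distrib[symmetric]
    by (intro sum.cong refl) (simp add: a'_def algebra_simps)
  moreover have "inverse (a k k) * (\<Sum>i\<in>UNIV. \<Sum>j\<in>UNIV. H i j * a k i * a k j) \<le> 0"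
    using H[of "a k"] akk by (simp add: mult_nonneg_nonpos)
  ultimately show ?case by linarith
qed

lemma chart_line_derivative:
  fixes f :: "'a::topological_space \<Rightarrow> real"
  assumes "is_chart \<kappa>" "chart_smooth \<kappa> f" "y + t *\<^sub>R \<xi> \<in> cmap \<kappa> ` cdom \<kappa>"
  shows "((\<lambda>t. f (cinv \<kappa> (y + t *\<^sub>R \<xi>))) has_real_derivative
    (\<Sum>j\<in>UNIV. \<xi> $ j * pd \<kappa> j f (cinv \<kappa> (y + t *\<^sub>R \<xi>)))) (at t)"
proof -
  let ?p = "cinv \<kappa> (y + t *\<^sub>R \<xi>)"
  have "((\<lambda>y. f (cinv \<kappa> y)) has_derivative (\<lambda>v. \<Sum>i\<in>UNIV. v $ i * pd \<kappa> i f ?p)) (at (y + t *\<^sub>R \<xi>))"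
    using chart_smooth_has_derivative[OF assms(1,2) cinv_in_cdom[OF assms(1,3)]]
    by (simp add: cmap_cinv[OF assms(1,3)])
  moreover have "((\<lambda>t. y + t *\<^sub>R \<xi>) has_derivative (\<lambda>r. r *\<^sub>R \<xi>)) (at t)"
    by (auto intro!: derivative_eq_intros)
  ultimately have "((\<lambda>t. f (cinv \<kappa> (y + t *\<^sub>R \<xi>))) has_derivative
      (\<lambda>r. \<Sum>i\<in>UNIV. (r *\<^sub>R \<xi>) $ i * pd \<kappa> i f ?p)) (at t)"
    by (rule has_derivative_compose[rotated])
  moreover have "(\<lambda>r. \<Sum>i\<in>UNIV. (r *\<^sub>R \<xi>) $ i * pd \<kappa> i f ?p) = (*) (\<Sum>j\<in>UNIV. \<xi> $ j * pd \<kappa> j f ?p)"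
    by (simp add: fun_eq_iff sum_distrib_left sum_distrib_right mult_ac)
  ultimately show ?thesis by (simp only: has_field_derivative_def)
qed

text \<open>One-variable facts on coordinate lines through \<open>p\<close>. Were the second
  derivative along a line positive, the first one, which is 0 at \<open>p\<close>, would be positive
  just beyond \<open>p\<close>, and \<open>u\<close> would rise above its maximum.\<close>

lemma local_max_derivatives:
  fixes u :: "'a::topological_space \<Rightarrow> real"
  assumes ch: "is_chart \<kappa>" and u: "chart_smooth \<kappa> u" and p: "p \<in> cdom \<kappa>" and N: "open N" "p \<in> N"
    and max: "\<And>q. q \<in> N \<Longrightarrow> q \<in> cdom \<kappa> \<Longrightarrow> u q \<le> u p"
  shows "pd \<kappa> i u p = 0"
    and "(\<Sum>i\<in>UNIV. \<Sum>j\<in>UNIV. pd \<kappa> i (pd \<kappa> j u) p * \<xi> i * \<xi> j) \<le> 0"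
proof -
  let ?O = "cmap \<kappa> ` cdom \<kappa>"
  define W where "W = ?O \<inter> cinv \<kappa> -` N"
  have "open W" unfolding W_def
    by (rule continuous_open_preimage[OF continuous_on_cinv[OF ch] open_chart_image[OF ch] N(1)])
  moreover have "cmap \<kappa> p \<in> W" using p N(2) by (simp add: W_def cinv_cmap[OF ch])
  ultimately obtain e where e: "e > 0" "ball (cmap \<kappa> p) e \<subseteq> W" using open_contains_ball by blast
  have line: "\<exists>d>0. \<forall>t. \<bar>t\<bar> < d \<longrightarrow> cmap \<kappa> p + t *\<^sub>R v \<in> W" for v
  proof (intro exI[of _ "e / (norm v + 1)"] conjI allI impI)
    show "0 < e / (norm v + 1)" using e(1) by (simp add: add_nonneg_pos)
    fix t assume "\<bar>t\<bar> < e / (norm v + 1)"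
    then have "\<bar>t\<bar> * (norm v + 1) < e" by (simp add: pos_less_divide_eq add_nonneg_pos)
    then have "norm (t *\<^sub>R v) < e" by (simp add: distrib_left)
    then show "cmap \<kappa> p + t *\<^sub>R v \<in> W" using e(2) by (auto simp: dist_norm)
  qed
  define \<phi> where "\<phi> v t = u (cinv \<kappa> (cmap \<kappa> p + t *\<^sub>R v))" for v t
  define \<psi> where "\<psi> v q = (\<Sum>j\<in>UNIV. v $ j * pd \<kappa> j u q)" for v :: "real ^ 'b" and q
  have \<psi>: "chart_smooth \<kappa> (\<psi> v)" for v
    unfolding \<psi>_def by (intro chart_smooth_sum chart_smooth_mult chart_smooth_const chart_smooth_pd ch u)
  have \<phi>': "(\<phi> v has_real_derivative \<psi> v (cinv \<kappa> (cmap \<kappa> p + t *\<^sub>R v))) (at t)"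
    if "cmap \<kappa> p + t *\<^sub>R v \<in> W" for v t
    unfolding \<phi>_def \<psi>_def by (rule chart_line_derivative[OF ch u]) (use that in \<open>simp add: W_def\<close>)
  have \<phi>max: "\<phi> v t \<le> \<phi> v 0" if "cmap \<kappa> p + t *\<^sub>R v \<in> W" for v t
    using that max cinv_in_cdom[OF ch] by (simp add: \<phi>_def W_def cinv_cmap[OF ch p])
  have \<psi>0: "\<psi> v p = 0" for v
  proof -
    obtain d where d: "d > 0" "\<forall>t. \<bar>t\<bar> < d \<longrightarrow> cmap \<kappa> p + t *\<^sub>R v \<in> W" using line by blast
    show ?thesis
    proof (rule DERIV_local_max[of "\<phi> v" _ 0 d])
      show "(\<phi> v has_real_derivative \<psi> v p) (at 0)"
        using \<phi>'[of 0 v] d(2)[rule_format, of 0] d(1) by (simp add: cinv_cmap[OF ch p])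
    qed (use d \<phi>max in auto)
  qed
  have "\<psi> (axis i 1) p = pd \<kappa> i u p"
    unfolding \<psi>_def by (rule sum_axis)
  then show "pd \<kappa> i u p = 0" using \<psi>0 by metis
  define v :: "real ^ 'b" where "v = (\<chi> i. \<xi> i)"
  let ?H = "\<Sum>i\<in>UNIV. \<Sum>j\<in>UNIV. pd \<kappa> i (pd \<kappa> j u) p * \<xi> i * \<xi> j"
  show "?H \<le> 0"
  proof (rule ccontr)
    assume pos: "\<not> ?H \<le> 0"
    obtain d where d: "d > 0" "\<forall>t. \<bar>t\<bar> < d \<longrightarrow> cmap \<kappa> p + t *\<^sub>R v \<in> W" using line by blast
    have "((\<lambda>t. \<psi> v (cinv \<kappa> (cmap \<kappa> p + t *\<^sub>R v))) has_real_derivative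
      (\<Sum>i\<in>UNIV. v $ i * pd \<kappa> i (\<psi> v) (cinv \<kappa> (cmap \<kappa> p + 0 *\<^sub>R v)))) (at 0)"
      by (rule chart_line_derivative[OF ch \<psi>]) (use p in simp)
    moreover have "(\<Sum>i\<in>UNIV. v $ i * pd \<kappa> i (\<psi> v) (cinv \<kappa> (cmap \<kappa> p + 0 *\<^sub>R v))) = ?H"
    proof -
      have "pd \<kappa> i (\<psi> v) p = (\<Sum>j\<in>UNIV. v $ j * pd \<kappa> i (pd \<kappa> j u) p)" for i
        unfolding \<psi>_def
        by (simp add: pd_sum[OF ch _ p] pd_cmult[OF ch _ p] chart_smooth_mult[OF ch] chart_smooth_const[OF ch]
            chart_smooth_pd[OF ch u])
      then show ?thesis
        by (simp add: cinv_cmap[OF ch p] v_def sum_distrib_left algebra_simps)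
    qed
    ultimately have "\<exists>d'>0. \<forall>h>0. h < d' \<longrightarrow> \<psi> v (cinv \<kappa> (cmap \<kappa> p + 0 *\<^sub>R v)) < \<psi> v (cinv \<kappa> (cmap \<kappa> p + (0 + h) *\<^sub>R v))"
      using pos by (intro DERIV_pos_inc_right) auto
    then obtain d' where d': "d' > 0" "\<forall>h>0. h < d' \<longrightarrow> 0 < \<psi> v (cinv \<kappa> (cmap \<kappa> p + h *\<^sub>R v))"
      by (auto simp: cinv_cmap[OF ch p] \<psi>0)
    define h where "h = min d d' / 2"
    have h: "0 < h" "h < d" "h < d'" using d(1) d'(1) by (auto simp: h_def min_def)
    have "\<exists>z>0. z < h \<and> \<phi> v h - \<phi> v 0 = (h - 0) * \<psi> v (cinv \<kappa> (cmap \<kappa> p + z *\<^sub>R v))"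
      by (rule MVT2[OF h(1)]) (use \<phi>' d(2) h in auto)
    then obtain z where z: "0 < z" "z < h" "\<phi> v h - \<phi> v 0 = h * \<psi> v (cinv \<kappa> (cmap \<kappa> p + z *\<^sub>R v))" by auto
    then have "\<phi> v h - \<phi> v 0 > 0" using d'(2) h by simp
    then show False using \<phi>max[of h v] d(2) h by auto
  qed
qed


section \<open>Gaussian barriers and the Laplace-Beltrami operator\<close>

lemma C_on_exp:
  assumes "open S" "C_on k S f"
  shows "C_on k S (\<lambda>x. exp (f x :: real))"
  using assms(2)
proof (induction k)
  case 0
  then show ?case by (simp add: continuous_on_exp)
next
  case (Suc k)
  have IH: "C_on k S (\<lambda>x. exp (f x))" using Suc C_on_decSuc by blast
  show ?case
  proof (rule C_on_Suc_intro[OF assms(1)])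
    show "((\<lambda>x. exp (f x)) has_derivative (\<lambda>v. exp (f x) * frechet_derivative f (at x) v)) (at x)" if "x \<in> S" for x
      using has_derivative_exp[OF C_on_SucD[OF Suc.prems assms(1) that]] by (simp add: mult.commute)
    show "C_on k S (\<lambda>x. exp (f x) * frechet_derivative f (at x) v)" for v
      using Suc.prems by (intro C_on_mult IH assms(1)) auto
  qed
qed

lemma pd_exp:
  assumes "is_chart \<kappa>" "chart_smooth \<kappa> f" "p \<in> cdom \<kappa>"
  shows "chart_smooth \<kappa> (\<lambda>q. exp (f q))" "pd \<kappa> i (\<lambda>q. exp (f q)) p = exp (f p) * pd \<kappa> i f p"
proof -
  show "chart_smooth \<kappa> (\<lambda>q. exp (f q))"
    using assms(2) by (simp add: chart_smooth_def C_on_exp open_chart_image[OF assms(1)])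
  show "pd \<kappa> i (\<lambda>q. exp (f q)) p = exp (f p) * pd \<kappa> i f p"
    by (subst pd_eqI[OF has_derivative_exp[OF chart_smooth_has_derivative[OF assms]]])
      (simp add: sum_axis cinv_cmap[OF assms(1,3)])
qed

text \<open>Hopf's barrier without the additive constant that makes it vanish on a sphere. The
  squared distance is written as a polynomial in the coordinates, to be differentiated by the
  product rule.\<close>

definition gaussian :: "('a, 'm::finite) chart \<Rightarrow> real \<Rightarrow> real ^ 'm \<Rightarrow> 'a \<Rightarrow> real" where
  "gaussian \<kappa> \<Lambda> x q = exp (- \<Lambda> * (\<Sum>k\<in>UNIV. (cmap \<kappa> q $ k - x $ k) * (cmap \<kappa> q $ k - x $ k)))"

lemma gaussian_derivatives:
  fixes \<kappa> :: "('a::topological_space, 'm::finite) chart"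
  assumes ch: "is_chart \<kappa>" and p: "p \<in> cdom \<kappa>"
  shows "chart_smooth \<kappa> (gaussian \<kappa> \<Lambda> x)"
    and "pd \<kappa> j (gaussian \<kappa> \<Lambda> x) p = gaussian \<kappa> \<Lambda> x p * (- 2 * \<Lambda> * (cmap \<kappa> p $ j - x $ j))"
    and "pd \<kappa> i (pd \<kappa> j (gaussian \<kappa> \<Lambda> x)) p = gaussian \<kappa> \<Lambda> x p *
      (4 * \<Lambda>\<^sup>2 * (cmap \<kappa> p $ i - x $ i) * (cmap \<kappa> p $ j - x $ j) - (if i = j then 2 * \<Lambda> else 0))"
proof -
  let ?z = "\<lambda>k q. cmap \<kappa> q $ k - x $ k"
  let ?f = "\<lambda>q. - \<Lambda> * (\<Sum>k\<in>UNIV. ?z k q * ?z k q)"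
  have z: "chart_smooth \<kappa> (?z k)" for k
    by (intro chart_smooth_diff chart_smooth_coordinate chart_smooth_const ch)
  have pdz: "pd \<kappa> j (?z k) q = (if k = j then 1 else 0)" if "q \<in> cdom \<kappa>" for j k q
    using that by (simp add: pd_diff[OF ch] chart_smooth_coordinate[OF ch] chart_smooth_const[OF ch]
        pd_coordinate[OF ch] pd_const)
  have f: "chart_smooth \<kappa> ?f"
    by (intro chart_smooth_mult chart_smooth_sum chart_smooth_const z ch)
  have pdf: "pd \<kappa> j ?f q = - 2 * \<Lambda> * ?z j q" if q: "q \<in> cdom \<kappa>" for j q
  proof -
    have "pd \<kappa> j (\<lambda>q. \<Sum>k\<in>UNIV. ?z k q * ?z k q) q = (\<Sum>k\<in>UNIV. if k = j then 2 * ?z k q else 0)"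
      unfolding pd_sum[OF ch chart_smooth_mult[OF ch z z] q]
      by (intro sum.cong refl) (simp add: pd_mult[OF ch z z q] pdz[OF q])
    then show ?thesis
      unfolding pd_cmult[OF ch chart_smooth_sum[OF ch chart_smooth_mult[OF ch z z]] q] by simp
  qed
  show s: "chart_smooth \<kappa> (gaussian \<kappa> \<Lambda> x)"
    unfolding gaussian_def using pd_exp(1)[OF ch f p] .
  have pdg: "pd \<kappa> j (gaussian \<kappa> \<Lambda> x) q = gaussian \<kappa> \<Lambda> x q * (- 2 * \<Lambda> * ?z j q)" if q: "q \<in> cdom \<kappa>" for j q
    using pd_exp(2)[OF ch f q, of j] unfolding pdf[OF q] gaussian_def .
  then show "pd \<kappa> j (gaussian \<kappa> \<Lambda> x) p = gaussian \<kappa> \<Lambda> x p * (- 2 * \<Lambda> * ?z j p)" using p by blast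
  have "pd \<kappa> i (pd \<kappa> j (gaussian \<kappa> \<Lambda> x)) p = pd \<kappa> i (\<lambda>q. gaussian \<kappa> \<Lambda> x q * (- 2 * \<Lambda> * ?z j q)) p"
    by (rule pd_cong[OF ch pdg p])
  also have "\<dots> = gaussian \<kappa> \<Lambda> x p * pd \<kappa> i (\<lambda>q. - 2 * \<Lambda> * ?z j q) p
      + pd \<kappa> i (gaussian \<kappa> \<Lambda> x) p * (- 2 * \<Lambda> * ?z j p)"
    by (rule pd_mult[OF ch s _ p]) (intro chart_smooth_mult chart_smooth_const z ch)
  also have "pd \<kappa> i (\<lambda>q. - 2 * \<Lambda> * ?z j q) p = - 2 * \<Lambda> * (if j = i then 1 else 0)"
    unfolding pd_cmult[OF ch z p] pdz[OF p] ..
  finally show "pd \<kappa> i (pd \<kappa> j (gaussian \<kappa> \<Lambda> x)) p = gaussian \<kappa> \<Lambda> x p *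
      (4 * \<Lambda>\<^sup>2 * ?z i p * ?z j p - (if i = j then 2 * \<Lambda> else 0))"
    unfolding pdg[OF p] by (auto simp: algebra_simps power2_eq_square)
qed

text \<open>The Laplace-Beltrami operator multiplied by \<open>sqrt (det g)\<close>; the positive
  factor changes neither the signs nor the zeros on which the maximum principles depend.\<close>

definition laplace_beltrami :: "('a, 'm::finite) mat_field \<Rightarrow> ('a, 'm) chart \<Rightarrow> ('a \<Rightarrow> real) \<Rightarrow> 'a \<Rightarrow> real" where
  "laplace_beltrami G \<kappa> u p =
     (\<Sum>i\<in>UNIV. pd \<kappa> i (\<lambda>q. sqrt (det (G \<kappa> q)) * (matrix_inv (G \<kappa> q) *v d_fun u \<kappa> q) $ i) p)"

lemma codiff1_d_fun: "codiff1 G (d_fun u) \<kappa> p = - (1 / sqrt (det (G \<kappa> p))) * laplace_beltrami G \<kappa> u p"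
  by (simp add: codiff1_def laplace_beltrami_def)

definition principal_coeff :: "('a, 'm::finite) mat_field \<Rightarrow> ('a, 'm) chart \<Rightarrow> 'm \<Rightarrow> 'm \<Rightarrow> 'a \<Rightarrow> real" where
  "principal_coeff G \<kappa> i j q = sqrt (det (G \<kappa> q)) * matrix_inv (G \<kappa> q) $ i $ j"

context
  fixes A :: "('a::{t2_space, second_countable_topology}, 'm::finite) chart set" and G :: "('a, 'm) mat_field"
    and \<kappa> :: "('a, 'm) chart"
  assumes man: "closed_connected_manifold A" and riem: "riemannian_metric A G" and \<kappa>: "\<kappa> \<in> A"
begin

lemma chart_of_atlas: "is_chart \<kappa>"
  using closed_manifold_chart[OF man \<kappa>] .

lemma chart_smooth_principal_coeff: "chart_smooth \<kappa> (principal_coeff G \<kappa> i j)"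
  unfolding principal_coeff_def
  by (intro chart_smooth_mult chart_of_atlas chart_smooth_metric_det chart_smooth_metric_inv metric_chart[OF man riem] \<kappa>)

text \<open>Passage from divergence form to a second-order part plus a drift, so that the Hessian,
  about which a maximum gives information, appears explicitly.\<close>

lemma laplace_beltrami_expand:
  assumes u: "chart_smooth \<kappa> u" and p: "p \<in> cdom \<kappa>"
  shows "laplace_beltrami G \<kappa> u p =
    (\<Sum>i\<in>UNIV. \<Sum>j\<in>UNIV. principal_coeff G \<kappa> i j p * pd \<kappa> i (pd \<kappa> j u) p)
    + (\<Sum>j\<in>UNIV. (\<Sum>i\<in>UNIV. pd \<kappa> i (principal_coeff G \<kappa> i j) p) * pd \<kappa> j u p)"
proof -
  let ?a = "principal_coeff G \<kappa>"
  note s = chart_smooth_mult[OF chart_of_atlas chart_smooth_principal_coeff chart_smooth_pd[OF chart_of_atlas u]]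
  have "laplace_beltrami G \<kappa> u p = (\<Sum>i\<in>UNIV. pd \<kappa> i (\<lambda>q. \<Sum>j\<in>UNIV. ?a i j q * pd \<kappa> j u q) p)"
    unfolding laplace_beltrami_def matrix_vector_mult_component principal_coeff_def d_fun_def
    by (simp add: sum_distrib_left mult.assoc)
  also have "\<dots> = (\<Sum>i\<in>UNIV. \<Sum>j\<in>UNIV. ?a i j p * pd \<kappa> i (pd \<kappa> j u) p + pd \<kappa> i (?a i j) p * pd \<kappa> j u p)"
    by (simp only: pd_sum[OF chart_of_atlas s p] pd_mult[OF chart_of_atlas chart_smooth_principal_coeff chart_smooth_pd[OF chart_of_atlas u] p])
  also have "\<dots> = (\<Sum>i\<in>UNIV. \<Sum>j\<in>UNIV. ?a i j p * pd \<kappa> i (pd \<kappa> j u) p)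
      + (\<Sum>j\<in>UNIV. \<Sum>i\<in>UNIV. pd \<kappa> i (?a i j) p * pd \<kappa> j u p)"
    unfolding sum.distrib by (subst sum.swap[of "\<lambda>i j. pd \<kappa> i (?a i j) p * pd \<kappa> j u p"]) simp
  finally show ?thesis by (simp add: sum_distrib_right)
qed

lemma laplace_beltrami_lincomb:
  assumes u: "chart_smooth \<kappa> u" and v: "chart_smooth \<kappa> v" and p: "p \<in> cdom \<kappa>"
  shows "laplace_beltrami G \<kappa> (\<lambda>q. u q + c * v q) p = laplace_beltrami G \<kappa> u p + c * laplace_beltrami G \<kappa> v p"
proof -
  note cv = chart_smooth_mult[OF chart_of_atlas chart_smooth_const[OF chart_of_atlas] v]
  note uv = chart_smooth_add[OF chart_of_atlas u cv]
  have 1: "pd \<kappa> j (\<lambda>q. u q + c * v q) q = pd \<kappa> j u q + c * pd \<kappa> j v q" if "q \<in> cdom \<kappa>" for j q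
    by (simp only: pd_add[OF chart_of_atlas u cv that] pd_cmult[OF chart_of_atlas v that])
  have 2: "pd \<kappa> i (pd \<kappa> j (\<lambda>q. u q + c * v q)) p = pd \<kappa> i (pd \<kappa> j u) p + c * pd \<kappa> i (pd \<kappa> j v) p" for i j
  proof -
    have "pd \<kappa> i (pd \<kappa> j (\<lambda>q. u q + c * v q)) p = pd \<kappa> i (\<lambda>q. pd \<kappa> j u q + c * pd \<kappa> j v q) p"
      by (rule pd_cong[OF chart_of_atlas 1 p])
    then show ?thesis
      by (simp only: pd_add[OF chart_of_atlas chart_smooth_pd[OF chart_of_atlas u] chart_smooth_mult[OF chart_of_atlas chart_smooth_const[OF chart_of_atlas] chart_smooth_pd[OF chart_of_atlas v]] p]
          pd_cmult[OF chart_of_atlas chart_smooth_pd[OF chart_of_atlas v] p])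
  qed
  show ?thesis
    unfolding laplace_beltrami_expand[OF u p] laplace_beltrami_expand[OF v p] laplace_beltrami_expand[OF uv p] 1[OF p] 2
    by (simp add: distrib_left sum.distrib sum_distrib_left algebra_simps)
qed

text \<open>Substituting \<open>x = g y\<close> turns the quadratic form of the inverse into that of
  \<open>g\<close>.\<close>

lemma matrix_inv_symmetric_positive:
  assumes "p \<in> cdom \<kappa>"
  shows "matrix_inv (G \<kappa> p) $ i $ j = matrix_inv (G \<kappa> p) $ j $ i"
    and "x \<noteq> 0 \<Longrightarrow> 0 < x \<bullet> (matrix_inv (G \<kappa> p) *v x)"
proof -
  let ?g = "G \<kappa> p" and ?K = "matrix_inv (G \<kappa> p)"
  have sym: "transpose ?g = ?g" and pos: "\<And>v. v \<noteq> 0 \<Longrightarrow> 0 < v \<bullet> (?g *v v)"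
    using riem \<kappa> assms unfolding riemannian_metric_def by blast+
  have d: "det ?g \<noteq> 0" using riemannian_metric_det_pos[OF riem \<kappa> assms] by simp
  note inv = matrix_inv_of_det_nonzero[OF d]
  have "transpose ?K ** ?g = mat 1"
    using arg_cong[OF inv(1), of transpose] by (simp add: matrix_transpose_mul sym)
  then have "(transpose ?K ** ?g) ** ?K = ?K" by simp
  then have "transpose ?K = ?K" by (simp only: matrix_mul_assoc[symmetric] inv(1) matrix_mul_rid)
  then have "transpose ?K $ j $ i = ?K $ j $ i" by (rule arg_cong)
  then show "?K $ i $ j = ?K $ j $ i" by (simp only: transpose_def vec_lambda_beta)
  assume x: "x \<noteq> 0"
  define y where "y = ?K *v x"
  have gy: "?g *v y = x" by (simp add: y_def matrix_vector_mul_assoc inv)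
  then have "y \<noteq> 0" using x by auto
  then show "0 < x \<bullet> (?K *v x)"
    using pos[of y] unfolding gy y_def[symmetric] by (simp add: inner_commute)
qed

lemma principal_coeff_positive:
  assumes "p \<in> cdom \<kappa>" "x \<noteq> 0"
  shows "0 < (\<Sum>i\<in>UNIV. \<Sum>j\<in>UNIV. principal_coeff G \<kappa> i j p * x $ i * x $ j)"
proof -
  have "(\<Sum>i\<in>UNIV. \<Sum>j\<in>UNIV. principal_coeff G \<kappa> i j p * x $ i * x $ j)
      = sqrt (det (G \<kappa> p)) * (x \<bullet> (matrix_inv (G \<kappa> p) *v x))"
    by (simp add: inner_vec_def matrix_vector_mult_component principal_coeff_def sum_distrib_left algebra_simps)
  then show ?thesis
    using riemannian_metric_det_pos[OF riem \<kappa> assms(1)] matrix_inv_symmetric_positive(2)[OF assms] by simp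
qed

text \<open>At the maximum the drift vanishes with the gradient, and the second-order part contracts
  a positive semidefinite matrix with a negative semidefinite Hessian.\<close>

lemma laplace_beltrami_local_max:
  assumes u: "chart_smooth \<kappa> u" and p: "p \<in> cdom \<kappa>" and N: "open N" "p \<in> N"
    and max: "\<And>q. q \<in> N \<Longrightarrow> q \<in> cdom \<kappa> \<Longrightarrow> u q \<le> u p"
  shows "laplace_beltrami G \<kappa> u p \<le> 0"
proof -
  note d = local_max_derivatives[OF chart_of_atlas u p N max]
  have "(\<Sum>i\<in>UNIV. \<Sum>j\<in>UNIV. principal_coeff G \<kappa> i j p * pd \<kappa> i (pd \<kappa> j u) p) \<le> 0"
  proof (rule sum_psd_nsd_nonpos[of UNIV])
    show "principal_coeff G \<kappa> i j p = principal_coeff G \<kappa> j i p" for i j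
      by (simp add: principal_coeff_def matrix_inv_symmetric_positive(1)[OF p, of i])
    show "0 \<le> (\<Sum>i\<in>UNIV. \<Sum>j\<in>UNIV. principal_coeff G \<kappa> i j p * x i * x j)" for x
      using principal_coeff_positive[OF p, of "\<chi> i. x i"] by (cases "(\<chi> i. x i) = 0") (auto simp: vec_eq_iff)
  qed (use d(2) in auto)
  then show ?thesis unfolding laplace_beltrami_expand[OF u p] by (simp add: d(1))
qed

end

lemma chart_smooth_continuous_on:
  "chart_smooth \<kappa> u \<Longrightarrow> continuous_on (cmap \<kappa> ` cdom \<kappa>) (\<lambda>y. u (cinv \<kappa> y))"
  unfolding chart_smooth_def using C_on_imp_continuous_on by blast

context
  fixes A :: "('a::{t2_space, second_countable_topology}, 'm::finite) chart set" and G :: "('a, 'm) mat_field"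
    and \<kappa> :: "('a, 'm) chart"
  assumes man: "closed_connected_manifold A" and riem: "riemannian_metric A G" and \<kappa>: "\<kappa> \<in> A"
begin

text \<open>On the Gaussian the operator equals the Gaussian times
  \<open>4 \<Lambda>^2 Q1 - 2 \<Lambda> Q2\<close>. Away from the centre \<open>x\<close> the form
  \<open>Q1\<close> is positive, hence bounded below on the compact set \<open>C\<close>, and its
  quadratic weight wins for large \<open>\<Lambda>\<close>.\<close>

lemma gaussian_barrier:
  assumes C: "compact C" "C \<subseteq> cmap \<kappa> ` cdom \<kappa>" "x \<notin> C"
  obtains \<Lambda> where "\<Lambda> > 0" "\<And>y. y \<in> C \<Longrightarrow> 0 < laplace_beltrami G \<kappa> (gaussian \<kappa> \<Lambda> x) (cinv \<kappa> y)"
proof (cases "C = {}")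
  case True
  then show ?thesis using that[of 1] by auto
next
  case False
  note ch = closed_manifold_chart[OF man \<kappa>]
  let ?a = "principal_coeff G \<kappa>"
  define Q1 where "Q1 y = (\<Sum>i\<in>UNIV. \<Sum>j\<in>UNIV. ?a i j (cinv \<kappa> y) * (y - x) $ i * (y - x) $ j)" for y
  define Q2 where "Q2 y = (\<Sum>i\<in>UNIV. ?a i i (cinv \<kappa> y))
    + (\<Sum>j\<in>UNIV. (\<Sum>i\<in>UNIV. pd \<kappa> i (?a i j) (cinv \<kappa> y)) * (y - x) $ j)" for y
  note ca = chart_smooth_principal_coeff[OF man riem \<kappa>]
  note cont = chart_smooth_continuous_on[OF ca] chart_smooth_continuous_on[OF chart_smooth_pd[OF ch ca]]
  have c1: "continuous_on C Q1" and c2: "continuous_on C Q2"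
    unfolding Q1_def Q2_def
    by (intro continuous_intros continuous_on_subset[OF cont(1) C(2)] continuous_on_subset[OF cont(2) C(2)])+
  have pos: "0 < Q1 y" if "y \<in> C" for y
  proof -
    have "y - x \<noteq> 0" using that C(3) by auto
    then show ?thesis unfolding Q1_def
      using principal_coeff_positive[OF man riem \<kappa> cinv_in_cdom[OF ch]] that C(2) by blast
  qed
  obtain ym where ym: "ym \<in> C" "\<And>y. y \<in> C \<Longrightarrow> Q1 ym \<le> Q1 y"
    using continuous_attains_inf[OF C(1) False c1] by blast
  obtain yM where yM: "yM \<in> C" "\<And>y. y \<in> C \<Longrightarrow> Q2 y \<le> Q2 yM"
    using continuous_attains_sup[OF C(1) False c2] by blast
  \<comment> \<open>Chosen so that \<open>2 * \<Lambda> * Q1 ym\<close> exceeds every value of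
    \<open>Q2\<close> on \<open>C\<close> by at least 1.\<close>
  define \<Lambda> where "\<Lambda> = (\<bar>Q2 yM\<bar> + 1) / (2 * Q1 ym)"
  have \<theta>: "0 < Q1 ym" using pos ym(1) by blast
  then have \<Lambda>: "\<Lambda> > 0" by (simp add: \<Lambda>_def)
  show ?thesis
  proof (rule that[OF \<Lambda>])
    fix y assume y: "y \<in> C"
    let ?p = "cinv \<kappa> y" and ?g = "gaussian \<kappa> \<Lambda> x (cinv \<kappa> y)"
    have p: "?p \<in> cdom \<kappa>" "cmap \<kappa> ?p = y"
      using y C(2) cinv_in_cdom[OF ch] cmap_cinv[OF ch] by auto
    have "laplace_beltrami G \<kappa> (gaussian \<kappa> \<Lambda> x) ?p
      = (\<Sum>i\<in>UNIV. \<Sum>j\<in>UNIV. ?g * (4 * \<Lambda>\<^sup>2 * (?a i j ?p * (y - x) $ i * (y - x) $ j)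
            - (if i = j then 2 * \<Lambda> * ?a i j ?p else 0)))
        + (\<Sum>j\<in>UNIV. ?g * (- 2 * \<Lambda>) * ((\<Sum>i\<in>UNIV. pd \<kappa> i (?a i j) ?p) * (y - x) $ j))"
      unfolding laplace_beltrami_expand[OF man riem \<kappa> gaussian_derivatives(1)[OF ch p(1)] p(1)]
        gaussian_derivatives(2,3)[OF ch p(1)] p(2)
      by (intro arg_cong2[where f="(+)"] sum.cong refl) (auto simp: algebra_simps)
    also have "\<dots> = ?g * (4 * \<Lambda>\<^sup>2 * Q1 y - 2 * \<Lambda> * Q2 y)"
      unfolding Q1_def Q2_def sum_distrib_left[symmetric] sum_subtractf
      by (simp add: sum_distrib_left[symmetric] algebra_simps)
    also have "\<dots> > 0"
    proof -
      have "Q2 y \<le> \<bar>Q2 yM\<bar>" using yM(2)[OF y] by linarith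
      also have "\<dots> < 2 * \<Lambda> * Q1 ym" using \<theta> by (simp add: \<Lambda>_def)
      also have "\<dots> \<le> 2 * \<Lambda> * Q1 y" using ym(2)[OF y] \<Lambda> by simp
      finally have "0 < (2 * \<Lambda>) * (2 * \<Lambda> * Q1 y - Q2 y)" using \<Lambda> by simp
      then have "0 < 4 * \<Lambda>\<^sup>2 * Q1 y - 2 * \<Lambda> * Q2 y" by (simp add: algebra_simps power2_eq_square)
      moreover have "0 < ?g" by (simp add: gaussian_def)
      ultimately show ?thesis by simp
    qed
    finally show "0 < laplace_beltrami G \<kappa> (gaussian \<kappa> \<Lambda> x) ?p" .
  qed
qed

lemma gaussian_eq_exp_dist:
  assumes "q \<in> cdom \<kappa>"
  shows "gaussian \<kappa> \<Lambda> x q = exp (- \<Lambda> * (dist x (cmap \<kappa> q))\<^sup>2)"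
proof -
  have "(dist x (cmap \<kappa> q))\<^sup>2 = (cmap \<kappa> q - x) \<bullet> (cmap \<kappa> q - x)"
    by (simp add: dist_norm power2_norm_eq_inner inner_diff_left inner_diff_right inner_commute)
  then show ?thesis by (simp add: gaussian_def inner_vec_def)
qed

text \<open>Hopf's barrier argument: on the boundary of a maximal ball on which \<open>u < M\<close>, adding a small
  multiple of a Gaussian centred in the ball produces an interior maximum of a strict subsolution.\<close>

lemma strong_maximum_principle_local:
  assumes u: "chart_smooth \<kappa> u" and L: "\<And>q. q \<in> cdom \<kappa> \<Longrightarrow> laplace_beltrami G \<kappa> u q = 0"
    and M: "\<And>q. q \<in> cdom \<kappa> \<Longrightarrow> u q \<le> M" and p: "p \<in> cdom \<kappa>" "u p = M"
  shows "\<exists>N. open N \<and> p \<in> N \<and> (\<forall>q\<in>N. u q = M)"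
proof -
  note ch = closed_manifold_chart[OF man \<kappa>]
  let ?O = "cmap \<kappa> ` cdom \<kappa>"
  define v where "v y = u (cinv \<kappa> y)" for y
  have contv: "continuous_on ?O v" unfolding v_def by (rule chart_smooth_continuous_on[OF u])
  have vM: "v y \<le> M" if "y \<in> ?O" for y unfolding v_def using M cinv_in_cdom[OF ch that] .
  define y0 where "y0 = cmap \<kappa> p"
  have y0: "y0 \<in> ?O" "v y0 = M" using p by (auto simp: y0_def v_def cinv_cmap[OF ch])
  obtain R where R: "R > 0" "cball y0 R \<subseteq> ?O"
    using open_contains_cball open_chart_image[OF ch] y0(1) by blast
  \<comment> \<open>Half the radius: a point \<open>z\<close> of the contact set nearest to
    \<open>y1\<close> is at distance at most \<open>dist y1 y0 < R / 2\<close>, so the ball about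
    \<open>y1\<close> reaching to \<open>z\<close> stays inside \<open>cball y0 R\<close>.\<close>
  have eq: "v y1 = M" if y1: "y1 \<in> ball y0 (R / 2)" for y1
  proof (rule ccontr)
    assume "v y1 \<noteq> M"
    define Z where "Z = {y \<in> cball y0 R. v y = M}"
    have "closed Z" unfolding Z_def
      by (rule continuous_closed_preimage_constant[OF continuous_on_subset[OF contv R(2)] closed_cball])
    moreover have "y0 \<in> Z" using y0 R by (simp add: Z_def)
    ultimately obtain z where z: "z \<in> Z" "\<And>y. y \<in> Z \<Longrightarrow> dist y1 z \<le> dist y1 y"
      using distance_attains_inf[of Z y1] by blast
    define r where "r = dist y1 z"
    have r2: "r < R / 2" using z(2)[OF \<open>y0 \<in> Z\<close>] y1 by (simp add: r_def dist_commute)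
    have "y1 \<noteq> z" using z(1) \<open>v y1 \<noteq> M\<close> by (auto simp: Z_def)
    then have r: "r > 0" by (simp add: r_def)
    have inner: "v y < M" if "dist y1 y < r" for y
    proof -
      have "dist y0 y \<le> dist y0 y1 + dist y1 y" by (rule dist_triangle)
      then have "y \<in> cball y0 R" using y1 that r2 by simp
      moreover have "y \<notin> Z" using z(2)[of y] that by (auto simp: r_def)
      ultimately show ?thesis using vM[of y] R(2) by (force simp: Z_def)
    qed
    \<comment> \<open>The ball of half the radius centred midway between \<open>y1\<close> and
      \<open>z\<close> touches the sphere about \<open>y1\<close> only at \<open>z\<close>. Hence
      \<open>v < M\<close> on that closed ball except at \<open>z\<close>.\<close>
    define x where "x = y1 + (1/2) *\<^sub>R (z - y1)"
    have xz: "dist x z = r / 2"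
    proof -
      have "x - z = (1/2) *\<^sub>R (y1 - z)" by (simp add: x_def algebra_simps scaleR_add_left[symmetric] flip: scaleR_2)
      then show ?thesis by (simp add: dist_norm r_def)
    qed
    have touch: "dist y1 y < r" if "dist x y \<le> r / 2" "y \<noteq> z" for y
    proof (rule ccontr)
      assume "\<not> dist y1 y < r"
      define d e where "d = y - y1" and "e = z - y1"
      have ne: "norm e = r" by (simp add: e_def r_def dist_norm norm_minus_commute)
      have "x - y = (1/2) *\<^sub>R e - d" by (simp add: x_def d_def e_def)
      then have "norm ((1/2) *\<^sub>R e - d) \<le> r / 2" using that(1) by (simp add: dist_norm)
      then have "(norm ((1/2) *\<^sub>R e - d))\<^sup>2 \<le> (r / 2)\<^sup>2" by (rule power_mono) simp
      then have 1: "(e \<bullet> e) / 4 - e \<bullet> d + d \<bullet> d \<le> r\<^sup>2 / 4"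
        by (simp add: power2_norm_eq_inner inner_diff_left inner_diff_right inner_commute power_divide)
      have ee: "e \<bullet> e = r\<^sup>2" using ne by (simp add: power2_norm_eq_inner[symmetric])
      have "norm d \<le> norm (d - (1/2) *\<^sub>R e) + norm ((1/2) *\<^sub>R e)" by (metis norm_triangle_sub add.commute)
      also have "\<dots> \<le> r" using \<open>norm ((1/2) *\<^sub>R e - d) \<le> r / 2\<close> ne by (simp add: norm_minus_commute)
      finally have "norm d = r"
        using \<open>\<not> dist y1 y < r\<close> by (simp add: d_def dist_norm norm_minus_commute)
      then have dd: "d \<bullet> d = r\<^sup>2" by (simp add: power2_norm_eq_inner[symmetric])
      have "(norm (d - e))\<^sup>2 = d \<bullet> d - 2 * (e \<bullet> d) + e \<bullet> e"
        by (simp add: power2_norm_eq_inner inner_diff_left inner_diff_right inner_commute)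
      also have "\<dots> \<le> 0" using 1 ee dd by simp
      finally show False using that(2) by (simp add: d_def e_def)
    qed
    have zO: "z \<in> ball y0 R"
      using dist_triangle[of y0 z y1] y1 r2 by (simp add: r_def)
    then obtain s0 where s0: "s0 > 0" "cball z s0 \<subseteq> ball y0 R"
      using open_contains_cball open_ball by blast
    \<comment> \<open>\<open>s < r / 2\<close> keeps the centre \<open>x\<close> out of
      \<open>cball z s\<close>, as the barrier requires; \<open>s \<le> s0\<close> keeps that ball
      inside the chart.\<close>
    define s where "s = min s0 (r / 4)"
    have s: "s > 0" "s < r / 2" "cball z s \<subseteq> ?O"
      using s0 r R(2) ball_subset_cball[of y0 R] by (auto simp: s_def subset_iff)
    obtain \<Lambda> where \<Lambda>: "\<Lambda> > 0" "\<And>y. y \<in> cball z s \<Longrightarrow> 0 < laplace_beltrami G \<kappa> (gaussian \<kappa> \<Lambda> x) (cinv \<kappa> y)"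
    proof (rule gaussian_barrier[OF compact_cball s(3)])
      show "x \<notin> cball z s" using xz s(2) by (simp add: dist_commute)
    qed auto
    \<comment> \<open>Vanishes on the sphere of radius \<open>r / 2\<close> about \<open>x\<close>,
      in particular at \<open>z\<close>, and is negative outside it.\<close>
    define w where "w y = exp (- \<Lambda> * (dist x y)\<^sup>2) - exp (- \<Lambda> * (r/2)\<^sup>2)" for y
    have w_out: "w y < 0" if "dist x y > r / 2" for y
    proof -
      have "(r/2)\<^sup>2 < (dist x y)\<^sup>2" using that r by (intro power_strict_mono) auto
      then show ?thesis using \<Lambda>(1) by (simp add: w_def)
    qed
    have w_le: "w y < 1" for y
    proof -
      have "exp (- \<Lambda> * (dist x y)\<^sup>2) \<le> 1" using \<Lambda>(1) by simp
      moreover have "0 < exp (- \<Lambda> * (r/2)\<^sup>2)" by simp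
      ultimately show ?thesis unfolding w_def by linarith
    qed
    \<comment> \<open>On the sphere about \<open>z\<close> there are two regions: within the
      touching ball \<open>v\<close> stays below \<open>M\<close> by a margin, by compactness;
      outside it \<open>w < 0\<close> and any positive \<open>\<epsilon>\<close> will do.\<close>
    obtain \<epsilon> where \<epsilon>: "\<epsilon> > 0" "\<And>y. y \<in> sphere z s \<Longrightarrow> v y + \<epsilon> * w y < M"
    proof -
      let ?K = "sphere z s \<inter> cball x (r/2)"
      have K: "?K \<subseteq> ?O" using s(3) sphere_cball[of z s] by blast
      have Kv: "v y < M" if "y \<in> ?K" for y
        using that s(1) by (intro inner touch) auto
      have "\<exists>\<epsilon>>0. \<forall>y\<in>?K. v y + \<epsilon> < M"
      proof (cases "?K = {}")
        case False
        then obtain k where k: "k \<in> ?K" "\<forall>y\<in>?K. v y \<le> v k"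
          using continuous_attains_sup[OF compact_Int[OF compact_sphere compact_cball] False
              continuous_on_subset[OF contv K]] by blast
        have "v y + (M - v k) / 2 < M" if "y \<in> ?K" for y
          using k(2)[rule_format, OF that] Kv[OF k(1)] by (simp add: field_simps)
        then show ?thesis using Kv[OF k(1)]
          by (intro exI[of _ "(M - v k) / 2"] conjI ballI) simp_all
      qed (auto intro: exI[of _ 1])
      then obtain \<epsilon> where \<epsilon>: "\<epsilon> > 0" "\<And>y. y \<in> ?K \<Longrightarrow> v y + \<epsilon> < M" by blast
      show ?thesis
      proof (rule that[OF \<epsilon>(1)])
        fix y assume y: "y \<in> sphere z s"
        show "v y + \<epsilon> * w y < M"
        proof (cases "dist x y \<le> r / 2")
          case True
          then have "v y + \<epsilon> < M" using y \<epsilon>(2) by simp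
          moreover have "\<epsilon> * w y < \<epsilon>" using w_le[of y] \<epsilon>(1) by simp
          ultimately show ?thesis by linarith
        next
          case False
          then have "\<epsilon> * w y < 0" using w_out[of y] \<epsilon>(1) by (simp add: mult_pos_neg)
          moreover have "v y \<le> M" using vM y s(3) sphere_cball[of z s] by blast
          ultimately show ?thesis by linarith
        qed
      qed
    qed
    have "continuous_on (cball z s) (\<lambda>y. v y + \<epsilon> * w y)"
      unfolding w_def by (intro continuous_intros continuous_on_subset[OF contv s(3)])
    then obtain k where k: "k \<in> cball z s" "\<And>y. y \<in> cball z s \<Longrightarrow> v y + \<epsilon> * w y \<le> v k + \<epsilon> * w k"
      using continuous_attains_sup[of "cball z s" "\<lambda>y. v y + \<epsilon> * w y"] s(1) by fastforce
    \<comment> \<open>At \<open>z\<close> the comparison function equals \<open>M\<close>, more than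
      anywhere on the sphere, so its maximum over the closed ball is interior; there the positive
      operator value contradicts \<open>laplace_beltrami_local_max\<close>.\<close>
    have "M \<le> v k + \<epsilon> * w k"
      using k(2)[of z] z(1) s(1) xz by (simp add: Z_def w_def)
    then have "k \<notin> sphere z s" using \<epsilon>(2)[of k] by auto
    then have kb: "k \<in> ball z s" using k(1) by auto
    then have kO: "k \<in> ?O" using s(3) by (auto simp: subset_iff)
    let ?p = "cinv \<kappa> k" and ?N = "cdom \<kappa> \<inter> cmap \<kappa> -` ball z s"
    have kp: "?p \<in> cdom \<kappa>" "cmap \<kappa> ?p = k" using kO cinv_in_cdom[OF ch] cmap_cinv[OF ch] by auto
    note gs = gaussian_derivatives(1)[OF ch kp(1), of \<Lambda> x]
    have "laplace_beltrami G \<kappa> (\<lambda>q. u q + \<epsilon> * gaussian \<kappa> \<Lambda> x q) ?p \<le> 0"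
    proof (rule laplace_beltrami_local_max[OF man riem \<kappa> _ kp(1), of _ ?N])
      show "chart_smooth \<kappa> (\<lambda>q. u q + \<epsilon> * gaussian \<kappa> \<Lambda> x q)"
        by (intro chart_smooth_add chart_smooth_mult chart_smooth_const u gs ch)
      show "open ?N" by (rule continuous_open_preimage[OF continuous_on_cmap[OF ch] open_cdom[OF ch] open_ball])
      show "?p \<in> ?N" using kp kb by simp
      fix q assume q: "q \<in> ?N" "q \<in> cdom \<kappa>"
      then have "v (cmap \<kappa> q) + \<epsilon> * w (cmap \<kappa> q) \<le> v k + \<epsilon> * w k"
        by (intro k(2)) auto
      then show "u q + \<epsilon> * gaussian \<kappa> \<Lambda> x q \<le> u ?p + \<epsilon> * gaussian \<kappa> \<Lambda> x ?p"
        using q kp by (simp add: v_def w_def cinv_cmap[OF ch] gaussian_eq_exp_dist algebra_simps)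
    qed
    then show False
      unfolding laplace_beltrami_lincomb[OF man riem \<kappa> u gs kp(1)] L[OF kp(1)]
      using mult_pos_pos[OF \<epsilon>(1) \<Lambda>(2)[OF k(1)]] by simp
  qed
  show ?thesis
  proof (intro exI[of _ "cdom \<kappa> \<inter> cmap \<kappa> -` ball y0 (R/2)"] conjI ballI)
    show "open (cdom \<kappa> \<inter> cmap \<kappa> -` ball y0 (R/2))"
      by (rule continuous_open_preimage[OF continuous_on_cmap[OF ch] open_cdom[OF ch] open_ball])
    show "p \<in> cdom \<kappa> \<inter> cmap \<kappa> -` ball y0 (R/2)" using p R(1) by (simp add: y0_def)
    fix q assume "q \<in> cdom \<kappa> \<inter> cmap \<kappa> -` ball y0 (R/2)"
    then show "u q = M" using eq[of "cmap \<kappa> q"] by (simp add: v_def cinv_cmap[OF ch])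
  qed
qed

lemma zero_pd_locally_constant:
  assumes u: "chart_smooth \<kappa> u" and z: "\<And>q i. q \<in> cdom \<kappa> \<Longrightarrow> pd \<kappa> i u q = 0" and p: "p \<in> cdom \<kappa>"
  shows "\<exists>N. open N \<and> p \<in> N \<and> N \<subseteq> cdom \<kappa> \<and> (\<forall>q\<in>N. (u q :: real) = u p)"
proof -
  note ch = closed_manifold_chart[OF man \<kappa>]
  let ?O = "cmap \<kappa> ` cdom \<kappa>"
  obtain R where R: "R > 0" "ball (cmap \<kappa> p) R \<subseteq> ?O"
    using open_contains_ball open_chart_image[OF ch] p by blast
  let ?N = "cdom \<kappa> \<inter> cmap \<kappa> -` ball (cmap \<kappa> p) R"
  have "\<exists>c. \<forall>y\<in>ball (cmap \<kappa> p) R. u (cinv \<kappa> y) = c"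
  proof (rule has_derivative_zero_constant[OF convex_ball])
    fix y assume "y \<in> ball (cmap \<kappa> p) R"
    then have y: "y \<in> ?O" using R(2) by blast
    have "((\<lambda>y. u (cinv \<kappa> y)) has_derivative (\<lambda>h. 0)) (at y)"
      using chart_smooth_has_derivative[OF ch u cinv_in_cdom[OF ch y]]
      by (simp add: z[OF cinv_in_cdom[OF ch y]] cmap_cinv[OF ch y])
    then show "((\<lambda>y. u (cinv \<kappa> y)) has_derivative (\<lambda>h. 0)) (at y within ball (cmap \<kappa> p) R)"
      by (rule has_derivative_at_withinI)
  qed
  then obtain c where c: "\<And>y. y \<in> ball (cmap \<kappa> p) R \<Longrightarrow> u (cinv \<kappa> y) = c" by blast
  have "u q = c" if "q \<in> ?N" for q using c[of "cmap \<kappa> q"] that by (simp add: cinv_cmap[OF ch])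
  moreover have "p \<in> ?N" using p R(1) by simp
  moreover have "open ?N"
    by (rule continuous_open_preimage[OF continuous_on_cmap[OF ch] open_cdom[OF ch] open_ball])
  ultimately show ?thesis by (intro exI[of _ ?N]) auto
qed

end

text \<open>\<open>f\<close> may be truth-valued: then this propagates a condition that is both open
  and closed. It is applied so to the set of maximum points of a function and to a class of an
  equivalence relation between points.\<close>

lemma connected_locally_constant:
  assumes "connected (UNIV :: 'a::topological_space set)"
    and "\<And>p :: 'a. \<exists>N. open N \<and> p \<in> N \<and> (\<forall>q\<in>N. f q = f p)"
  shows "f x = f y"
proof (rule connected_local_const[OF assms(1)])
  show "\<forall>a\<in>UNIV. \<forall>\<^sub>F b in at a within UNIV. f a = f b"
  proof
    fix a
    from assms(2)[of a] obtain N where N: "open N" "a \<in> N" "\<forall>q\<in>N. f q = f a" by (elim exE conjE)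
    have "f a = f b" if "b \<in> N" for b using N(3)[rule_format, OF that] by (rule sym)
    then show "\<forall>\<^sub>F b in at a within UNIV. f a = f b"
      unfolding eventually_at_topological using N(1,2) by blast
  qed
qed auto

context
  fixes A :: "('a::{t2_space, second_countable_topology}, 'm::finite) chart set"
  assumes man: "closed_connected_manifold A"
begin

lemma chart_at: "\<exists>\<kappa>\<in>A. p \<in> cdom \<kappa>"
  using man unfolding closed_connected_manifold_def smooth_atlas_def by blast

lemma smooth_fun_continuous:
  assumes "smooth_fun A u"
  shows "continuous_on UNIV u"
proof (rule continuous_at_imp_continuous_on, rule ballI)
  fix p
  obtain \<kappa> where \<kappa>: "\<kappa> \<in> A" "p \<in> cdom \<kappa>" using chart_at by blast
  note ch = closed_manifold_chart[OF man \<kappa>(1)]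
  have "continuous_on (cdom \<kappa>) (\<lambda>q. u (cinv \<kappa> (cmap \<kappa> q)))"
    by (rule continuous_on_compose2[OF chart_smooth_continuous_on[OF smooth_fun_chart_smooth[OF assms \<kappa>(1) ch]]
          continuous_on_cmap[OF ch]]) auto
  then have "continuous_on (cdom \<kappa>) u"
    by (rule continuous_on_eq) (simp add: cinv_cmap[OF ch])
  then show "isCont u p" using \<kappa>(2) open_cdom[OF ch] continuous_on_eq_continuous_at by blast
qed

end

section \<open>Exact harmonic forms vanish\<close>

context
  fixes A :: "('a::{t2_space, second_countable_topology}, 'm::finite) chart set" and G :: "('a, 'm) mat_field"
  assumes man: "closed_connected_manifold A" and riem: "riemannian_metric A G"
begin

lemma exact_harmonic_constant:
  assumes u: "smooth_fun A u" and harm: "harmonic A G (d_fun u)"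
  shows "u x = u y"
proof -
  note ch = closed_manifold_chart[OF man]
  have us: "chart_smooth \<kappa> u" if "\<kappa> \<in> A" for \<kappa>
    by (rule smooth_fun_chart_smooth[OF u that ch[OF that]])
  have of: "one_form A (d_fun u)" using harm by (simp add: harmonic_def)
  \<comment> \<open>Since \<open>d d u = 0\<close>, the Laplacian of \<open>d u\<close> is just
    \<open>d\<close> of its codifferential.\<close>
  have pd_codiff: "pd \<kappa> j (codiff1 G (d_fun u) \<kappa>) p = 0" if \<kappa>: "\<kappa> \<in> A" "p \<in> cdom \<kappa>" for \<kappa> p j
  proof -
    have z: "d_form (d_fun u) \<kappa> q = 0" if "q \<in> cdom \<kappa>" for q
      using pd_commute[OF ch[OF \<kappa>(1)] us[OF \<kappa>(1)] that] by (simp add: d_form_def d_fun_def vec_eq_iff)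
    have "pd \<kappa> i (\<lambda>q. sqrt (det (G \<kappa> q)) *
        (matrix_inv (G \<kappa> q) ** d_form (d_fun u) \<kappa> q ** transpose (matrix_inv (G \<kappa> q))) $ i $ l) p = pd \<kappa> i (\<lambda>q. 0) p" for i l
      by (rule pd_cong[OF ch[OF \<kappa>(1)] _ \<kappa>(2)]) (simp add: z matrix_matrix_mult_component)
    then have "codiff2 G (d_form (d_fun u)) \<kappa> p = 0"
      by (simp add: codiff2_def pd_const vec_eq_iff matrix_vector_mult_component)
    moreover have "laplacian G (d_fun u) \<kappa> p = 0" using harm \<kappa> by (simp add: harmonic_def)
    ultimately have "(\<chi> j. pd \<kappa> j (codiff1 G (d_fun u) \<kappa>) p) = 0" by (simp add: laplacian_def)
    then show ?thesis by (simp add: vec_eq_iff)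
  qed
  \<comment> \<open>One chart chosen at each point, so that the codifferential becomes a single
    function \<open>f\<close> on the manifold.\<close>
  define \<K> where "\<K> p = (SOME \<kappa>. \<kappa> \<in> A \<and> p \<in> cdom \<kappa>)" for p
  have \<K>: "\<K> p \<in> A" "p \<in> cdom (\<K> p)" for p
    using someI_ex[of "\<lambda>\<kappa>. \<kappa> \<in> A \<and> p \<in> cdom \<kappa>"] chart_at[OF man, of p] by (auto simp: \<K>_def)
  define f where "f p = codiff1 G (d_fun u) (\<K> p) p" for p
  have f: "codiff1 G (d_fun u) \<kappa> p = f p" if "\<kappa> \<in> A" "p \<in> cdom \<kappa>" for \<kappa> p
    unfolding f_def by (rule codiff1_chart_independent[OF man riem of that(1) \<K>(1) that(2) \<K>(2)])
  have f_const: "f p = f q" for p q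
  proof (rule connected_locally_constant[where f=f])
    show "connected (UNIV :: 'a set)" using man by (simp add: closed_connected_manifold_def)
    fix p
    have cs: "chart_smooth (\<K> p) (codiff1 G (d_fun u) (\<K> p))"
      by (intro chart_smooth_codiff1[where \<alpha>="d_fun u"] metric_chart[OF man riem] one_form_chart_smooth[OF of] \<K>(1))
    obtain N where N: "open N" "p \<in> N" "N \<subseteq> cdom (\<K> p)" "\<forall>q\<in>N. codiff1 G (d_fun u) (\<K> p) q = codiff1 G (d_fun u) (\<K> p) p"
      using zero_pd_locally_constant[OF man riem \<K>(1) cs pd_codiff[OF \<K>(1)] \<K>(2)] by blast
    have "f q = f p" if "q \<in> N" for q
      using N(4) that f[OF \<K>(1)[of p], of q] f[OF \<K>(1)[of p] \<K>(2)] subsetD[OF N(3) that] by simp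
    then show "\<exists>N. open N \<and> p \<in> N \<and> (\<forall>q\<in>N. f q = f p)"
      using N by blast
  qed
  \<comment> \<open>The operator applied to \<open>u\<close> is a negative multiple of the constant
    \<open>f\<close>: a maximum of \<open>u\<close> gives \<open>f \<ge> 0\<close>, a minimum
    \<open>f \<le> 0\<close>.\<close>
  have LB: "laplace_beltrami G \<kappa> u p = - sqrt (det (G \<kappa> p)) * f p" if "\<kappa> \<in> A" "p \<in> cdom \<kappa>" for \<kappa> p
    using f[OF that] riemannian_metric_det_pos[OF riem that] unfolding codiff1_d_fun by (auto simp: field_simps)
  have comp: "compact (UNIV :: 'a set)" using man by (simp add: closed_connected_manifold_def)
  obtain pM where pM: "\<And>q. u q \<le> u pM"
    using continuous_attains_sup[OF comp _ smooth_fun_continuous[OF man u]] by auto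
  obtain pm where pm: "\<And>q. u pm \<le> u q"
    using continuous_attains_inf[OF comp _ smooth_fun_continuous[OF man u]] by auto
  have "laplace_beltrami G (\<K> pM) u pM \<le> 0"
    by (rule laplace_beltrami_local_max[OF man riem \<K>(1) us[OF \<K>(1)] \<K>(2) open_UNIV UNIV_I pM])
  then have "0 \<le> f pM"
    using riemannian_metric_det_pos[OF riem \<K>, of pM] by (simp add: LB[OF \<K>] mult_le_0_iff zero_le_mult_iff)
  moreover have "f pm \<le> 0"
  proof -
    have z: "chart_smooth (\<K> pm) (\<lambda>q. 0 :: real)" by (rule chart_smooth_const[OF ch[OF \<K>(1)]])
    have pd0: "pd (\<K> pm) i (\<lambda>q. 0) = (\<lambda>q. 0)" for i
      by (rule ext, rule pd_const)
    \<comment> \<open>A minimum of \<open>u\<close> is a maximum of \<open>- u\<close>, written as a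
      combination with the zero function to match \<open>laplace_beltrami_lincomb\<close>.\<close>
    have "laplace_beltrami G (\<K> pm) (\<lambda>q. 0 + (-1) * u q) pm \<le> 0"
      by (rule laplace_beltrami_local_max[OF man riem \<K>(1) _ \<K>(2) open_UNIV UNIV_I])
        (intro chart_smooth_add chart_smooth_mult chart_smooth_const us ch \<K>(1), simp add: pm)
    moreover have "laplace_beltrami G (\<K> pm) (\<lambda>q. 0) pm = 0"
      unfolding laplace_beltrami_expand[OF man riem \<K>(1) z \<K>(2)]
      by (simp add: pd0)
    ultimately have "0 \<le> laplace_beltrami G (\<K> pm) u pm"
      unfolding laplace_beltrami_lincomb[OF man riem \<K>(1) z us[OF \<K>(1)] \<K>(2)] by simp
    then show ?thesis
      using riemannian_metric_det_pos[OF riem \<K>, of pm] by (simp add: LB[OF \<K>] mult_le_0_iff zero_le_mult_iff)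
  qed
  ultimately have f0: "f p = 0" for p using f_const[of p pM] f_const[of p pm] by simp
  \<comment> \<open>The set of maximum points is open by the strong maximum principle, its
    complement by continuity.\<close>
  have "(u q = u pM) = (u p = u pM)" for p q
  proof (rule connected_locally_constant[where f="\<lambda>p. u p = u pM"])
    show "connected (UNIV :: 'a set)" using man by (simp add: closed_connected_manifold_def)
    fix p
    show "\<exists>N. open N \<and> p \<in> N \<and> (\<forall>q\<in>N. (u q = u pM) = (u p = u pM))"
    proof (cases "u p = u pM")
      case True
      then show ?thesis
        using strong_maximum_principle_local[OF man riem \<K>(1) us[OF \<K>(1)] _ pM \<K>(2) True] LB[OF \<K>(1)] f0 by auto
    next
      case False
      have "open (u -` (- {u pM}))"
        using smooth_fun_continuous[OF man u] by (simp add: continuous_on_open_vimage open_Compl)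
      then show ?thesis using False by (intro exI[of _ "u -` (- {u pM})"]) auto
    qed
  qed
  then have "u p = u pM" for p by blast
  then show ?thesis by metis
qed

end

section \<open>The velocity of a smooth family of diffeomorphisms\<close>

context
  fixes A :: "('a::{t2_space, second_countable_topology}, 'm::finite) chart set" and \<Phi> :: "real \<Rightarrow> 'a \<Rightarrow> 'a"
  assumes man: "closed_connected_manifold A" and fam: "smooth_family A \<Phi>"
    and bij: "\<And>t. t \<in> {0..1} \<Longrightarrow> bij (\<Phi> t)"
begin

lemma continuous_on_family: "continuous_on ({0..1} \<times> UNIV) (\<lambda>(t, x). \<Phi> t x)"
  using fam by (simp add: smooth_family_def)

text \<open>The map \<open>(t, x) \<mapsto> (t, \<Phi> t x)\<close> is a continuous bijection of a
  compact Hausdorff space onto itself, so its inverse is continuous.\<close>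

lemma continuous_on_inverse_family: "continuous_on ({0..1} \<times> UNIV) (\<lambda>(t, p). inv (\<Phi> t) p)"
proof -
  let ?S = "{0..1::real} \<times> (UNIV :: 'a set)"
  let ?f = "\<lambda>z. (fst z, \<Phi> (fst z) (snd z))" and ?g = "\<lambda>z. (fst z, inv (\<Phi> (fst z)) (snd z))"
  have "continuous_on ?S ?f"
    using continuous_on_family by (intro continuous_on_Pair continuous_on_fst continuous_on_id) (simp add: case_prod_unfold)
  moreover have "compact ?S"
    using man by (intro compact_Times) (simp_all add: closed_connected_manifold_def)
  moreover have "\<forall>z\<in>?S. ?g (?f z) = z" using bij by (auto simp: bij_is_inj)
  ultimately have "continuous_on (?f ` ?S) ?g" by (rule continuous_on_inv)
  moreover have "?f ` ?S = ?S"
  proof (intro subset_antisym subsetI)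
    fix z assume z: "z \<in> ?S"
    then have "z = ?f (?g z)" using bij by (cases z) (simp add: bij_is_surj surj_f_inv_f)
    then show "z \<in> ?f ` ?S" by (rule image_eqI) (use z in auto)
  qed auto
  ultimately have "continuous_on ?S (\<lambda>z. snd (?g z))" by (intro continuous_on_snd) simp
  then show ?thesis by (simp add: case_prod_unfold)
qed

text \<open>The smooth extension \<open>F\<close> of the family in coordinates is defined on both
  sides of the endpoint times, so its time derivative is continuous up to them; composed with the
  continuous inverse family it gives the velocity. \<open>N\<close> collects the points at which
  this pair of charts and this extension apply.\<close>

lemma velocity_local:
  assumes \<kappa>: "\<kappa> \<in> A" and t0: "t0 \<in> {0..1}" and p0: "p0 \<in> cdom \<kappa>"
  obtains N V where "open N" "(t0, p0) \<in> N"
    "continuous_on (N \<inter> {0..1} \<times> cdom \<kappa>) V"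
    "\<And>t p. (t, p) \<in> N \<Longrightarrow> t \<in> {0..1} \<Longrightarrow> p \<in> cdom \<kappa> \<Longrightarrow>
      ((\<lambda>s. cmap \<kappa> (\<Phi> s (inv (\<Phi> t) p))) has_vector_derivative V (t, p)) (at t within {0..1})"
proof -
  note ch = closed_manifold_chart[OF man \<kappa>]
  define x0 where "x0 = inv (\<Phi> t0) p0"
  obtain \<kappa>' where \<kappa>': "\<kappa>' \<in> A" "x0 \<in> cdom \<kappa>'" using chart_at[OF man] by blast
  note ch' = closed_manifold_chart[OF man \<kappa>'(1)]
  define S where "S = {(t, y). t \<in> {0..1} \<and> y \<in> cmap \<kappa>' ` cdom \<kappa>' \<and> \<Phi> t (cinv \<kappa>' y) \<in> cdom \<kappa>}"
  have "smooth_on S (\<lambda>(t, y). cmap \<kappa> (\<Phi> t (cinv \<kappa>' y)))"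
    using fam \<kappa> \<kappa>'(1) unfolding smooth_family_def S_def by blast
  moreover have "(t0, cmap \<kappa>' x0) \<in> S"
    using t0 p0 \<kappa>'(2) bij[OF t0] by (auto simp: S_def cinv_cmap[OF ch'] x0_def bij_is_surj surj_f_inv_f)
  ultimately obtain W F where W: "open W" "(t0, cmap \<kappa>' x0) \<in> W" "\<And>k. C_on k W F"
    "\<And>t y. (t, y) \<in> W \<inter> S \<Longrightarrow> F (t, y) = cmap \<kappa> (\<Phi> t (cinv \<kappa>' y))"
    unfolding smooth_on_def by (metis (no_types, lifting) case_prod_conv)
  let ?I = "{0..1::real} \<times> (UNIV :: 'a set)"
  let ?X = "\<lambda>z. inv (\<Phi> (fst z)) (snd z)"
  have contX: "continuous_on ?I ?X"
    using continuous_on_inverse_family by (simp add: case_prod_unfold)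
  obtain N1 where N1: "open N1" "N1 \<inter> ?I = ?X -` cdom \<kappa>' \<inter> ?I"
    using iffD1[OF continuous_on_open_invariant contX, rule_format, OF open_cdom[OF ch']] by (elim exE conjE)
  let ?Y = "\<lambda>z. (fst z, cmap \<kappa>' (?X z))"
  have contY: "continuous_on (N1 \<inter> ?I) ?Y"
    by (intro continuous_on_Pair continuous_on_fst continuous_on_id
        continuous_on_compose2[OF continuous_on_cmap[OF ch'] continuous_on_subset[OF contX]])
      (use N1(2) in auto)
  obtain N2 where N2: "open N2" "N2 \<inter> (N1 \<inter> ?I) = ?Y -` W \<inter> (N1 \<inter> ?I)"
    using iffD1[OF continuous_on_open_invariant contY, rule_format, OF W(1)] by (elim exE conjE)
  define N where "N = N1 \<inter> N2"
  \<comment> \<open>The time derivative of the extension at the coordinates of the point that the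
    isotopy carries to \<open>p\<close> at time \<open>t\<close>.\<close>
  define V where "V z = frechet_derivative F (at (?Y z)) (1, 0)" for z
  have inN: "?X z \<in> cdom \<kappa>'" "?Y z \<in> W" if "z \<in> N" "z \<in> ?I" for z
    using that N1(2) N2(2) unfolding N_def by blast+
  show thesis
  proof (rule that)
    show "open N" using N1 N2 by (auto simp: N_def)
    show "(t0, p0) \<in> N"
    proof -
      have "(t0, p0) \<in> ?X -` cdom \<kappa>' \<inter> ?I" using t0 \<kappa>'(2) by (auto simp: x0_def)
      then have "(t0, p0) \<in> N1" unfolding N1(2)[symmetric] by blast
      moreover then have "(t0, p0) \<in> ?Y -` W \<inter> (N1 \<inter> ?I)" using t0 W(2) by (auto simp: x0_def)
      then have "(t0, p0) \<in> N2" unfolding N2(2)[symmetric] by blast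
      ultimately show ?thesis by (simp add: N_def)
    qed
    have "C_on (Suc 0) W F" by (rule W(3))
    then have c1: "continuous_on W (\<lambda>w. frechet_derivative F (at w) (1, 0))" by simp
    have c2: "continuous_on (N \<inter> {0..1} \<times> cdom \<kappa>) ?Y"
      by (rule continuous_on_subset[OF contY]) (auto simp: N_def)
    show "continuous_on (N \<inter> {0..1} \<times> cdom \<kappa>) V"
      unfolding V_def
      by (rule continuous_on_compose2[OF c1 c2], rule image_subsetI, rule inN(2)) auto
    fix t p assume tp: "(t, p) \<in> N" "t \<in> {0..1}" "p \<in> cdom \<kappa>"
    define x where "x = inv (\<Phi> t) p"
    define y where "y = cmap \<kappa>' x"
    have x: "x \<in> cdom \<kappa>'" "(t, y) \<in> W" using inN[OF tp(1)] tp by (auto simp: x_def y_def)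
    have \<Phi>x: "\<Phi> t x = p" using bij[OF tp(2)] by (simp add: x_def bij_is_surj surj_f_inv_f)
    have cs: "continuous_on {0..1} (\<lambda>s. \<Phi> s x)"
      using continuous_on_compose2[OF continuous_on_family, of "{0..1}" "\<lambda>s. (s, x)"]
      by (simp add: continuous_on_Pair continuous_on_id continuous_on_const image_subset_iff)
    obtain B1 where B1: "open B1" "B1 \<inter> {0..1} = (\<lambda>s. \<Phi> s x) -` cdom \<kappa> \<inter> {0..1}"
      using iffD1[OF continuous_on_open_invariant cs, rule_format, OF open_cdom[OF ch]] by (elim exE conjE)
    define B where "B = B1 \<inter> (\<lambda>s. (s, y)) -` W"
    have B: "open B" unfolding B_def
      by (intro open_Int B1(1) open_vimage[OF W(1)] continuous_intros)
    have "t \<in> (\<lambda>s. \<Phi> s x) -` cdom \<kappa> \<inter> {0..1}" using tp \<Phi>x by auto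
    then have "t \<in> B1" unfolding B1(2)[symmetric] by blast
    then have tB: "t \<in> B" using x(2) by (simp add: B_def)
    have "(F has_derivative frechet_derivative F (at (t, y))) (at (t, y))"
      by (rule C_on_SucD[OF W(3) W(1) x(2)])
    moreover have "((\<lambda>s. (s, y)) has_derivative (\<lambda>h. (h, 0))) (at t within {0..1})"
      by (auto intro!: derivative_eq_intros)
    ultimately have "((\<lambda>s. F (s, y)) has_derivative (\<lambda>h. frechet_derivative F (at (t, y)) (h, 0))) (at t within {0..1})"
      by (rule has_derivative_compose[rotated])
    moreover have "frechet_derivative F (at (t, y)) (h, 0) = h *\<^sub>R V (t, p)" for h
    proof -
      have "linear (frechet_derivative F (at (t, y)))"
        using \<open>(F has_derivative _) _\<close> has_derivative_linear by blast
      from linear_cmul[OF this, of h "(1, 0)"] show ?thesis by (simp add: V_def x_def y_def)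
    qed
    ultimately have "((\<lambda>s. F (s, y)) has_vector_derivative V (t, p)) (at t within {0..1})"
      by (simp add: has_vector_derivative_def)
    moreover have "F (s, y) = cmap \<kappa> (\<Phi> s x)" if "s \<in> B \<inter> {0..1}" for s
    proof -
      have "s \<in> (\<lambda>s. \<Phi> s x) -` cdom \<kappa> \<inter> {0..1}" unfolding B1(2)[symmetric] using that by (simp add: B_def)
      then have "(s, y) \<in> W \<inter> S" using that x(1) by (auto simp: S_def B_def y_def cinv_cmap[OF ch'])
      from W(4)[OF this] show ?thesis by (simp add: y_def cinv_cmap[OF ch' x(1)])
    qed
    ultimately have "((\<lambda>s. cmap \<kappa> (\<Phi> s x)) has_vector_derivative V (t, p)) (at t within {0..1})"
    proof -
      assume D: "((\<lambda>s. F (s, y)) has_vector_derivative V (t, p)) (at t within {0..1})"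
        and eq: "\<And>s. s \<in> B \<inter> {0..1} \<Longrightarrow> F (s, y) = cmap \<kappa> (\<Phi> s x)"
      obtain d where d: "d > 0" "ball t d \<subseteq> B" using B tB open_contains_ball by blast
      show ?thesis
        by (rule has_vector_derivative_transform_within[OF D d(1) tp(2) eq])
          (use d(2) in \<open>auto simp: dist_commute subset_iff\<close>)
    qed
    then show "((\<lambda>s. cmap \<kappa> (\<Phi> s (inv (\<Phi> t) p))) has_vector_derivative V (t, p)) (at t within {0..1})"
      by (simp add: x_def)
  qed
qed

lemma velocity_has_vector_derivative:
  assumes "\<kappa> \<in> A" "t \<in> {0..1}" "p \<in> cdom \<kappa>"
  shows "((\<lambda>s. cmap \<kappa> (\<Phi> s (inv (\<Phi> t) p))) has_vector_derivative velocity \<Phi> t \<kappa> p) (at t within {0..1})"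
proof -
  obtain D where "((\<lambda>s. cmap \<kappa> (\<Phi> s (inv (\<Phi> t) p))) has_vector_derivative D) (at t within {0..1})"
    using velocity_local[OF assms] assms by metis
  moreover from this have "velocity \<Phi> t \<kappa> p = D"
    unfolding velocity_def using assms(2) by (intro vector_derivative_within_closed_interval) auto
  ultimately show ?thesis by simp
qed

lemma continuous_on_velocity:
  assumes \<kappa>: "\<kappa> \<in> A"
  shows "continuous_on ({0..1} \<times> cdom \<kappa>) (\<lambda>(t, p). velocity \<Phi> t \<kappa> p)"
  unfolding continuous_on_topological
proof (intro ballI allI impI)
  fix z :: "real \<times> 'a" and B :: "(real ^ 'm) set"
  assume z: "z \<in> {0..1} \<times> cdom \<kappa>" and B: "open B" "(case z of (t, p) \<Rightarrow> velocity \<Phi> t \<kappa> p) \<in> B"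
  obtain t0 p0 where z0: "z = (t0, p0)" "t0 \<in> {0..1}" "p0 \<in> cdom \<kappa>" using z by auto
  from velocity_local[OF \<kappa> z0(2,3)] obtain N V where N: "open N" "z \<in> N"
    and V: "continuous_on (N \<inter> {0..1} \<times> cdom \<kappa>) V"
      "\<And>t p. (t, p) \<in> N \<Longrightarrow> t \<in> {0..1} \<Longrightarrow> p \<in> cdom \<kappa> \<Longrightarrow>
      ((\<lambda>s. cmap \<kappa> (\<Phi> s (inv (\<Phi> t) p))) has_vector_derivative V (t, p)) (at t within {0..1})"
    unfolding z0(1) by blast
  have eq: "velocity \<Phi> t \<kappa> p = V (t, p)" if "(t, p) \<in> N \<inter> {0..1} \<times> cdom \<kappa>" for t p
    unfolding velocity_def
    using that by (intro vector_derivative_within_closed_interval V(2)) auto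
  have "V z \<in> B" using B(2) eq[of t0 p0] N(2) z0 by simp
  then obtain C where "open C" "z \<in> C" "\<forall>y\<in>N \<inter> {0..1} \<times> cdom \<kappa>. y \<in> C \<longrightarrow> V y \<in> B"
    using V(1) B(1) N(2) z unfolding continuous_on_topological by blast
  then show "\<exists>C. open C \<and> z \<in> C \<and> (\<forall>y\<in>{0..1} \<times> cdom \<kappa>. y \<in> C \<longrightarrow> (case y of (t, p) \<Rightarrow> velocity \<Phi> t \<kappa> p) \<in> B)"
    using N eq by (intro exI[of _ "C \<inter> N"]) auto
qed

end

section \<open>Stability of the Hodge decomposition\<close>

text \<open>The open balls cover while bounds are taken on the closed ones: compactness and
  convexity of the latter give finite bounds and mean value estimates, the former give
  neighbourhoods.\<close>

definition ball_cover :: "('a, 'm::finite) chart set \<Rightarrow> (('a, 'm) chart \<times> (real ^ 'm) \<times> real) set \<Rightarrow> bool" where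
  "ball_cover A P \<longleftrightarrow> finite P \<and> (\<forall>(\<kappa>, y, r)\<in>P. \<kappa> \<in> A \<and> 0 < r \<and> cball y r \<subseteq> cmap \<kappa> ` cdom \<kappa>) \<and>
     (\<forall>p. \<exists>(\<kappa>, y, r)\<in>P. p \<in> cdom \<kappa> \<and> cmap \<kappa> p \<in> ball y r)"

text \<open>The uniform size of a 1-form measured in the finitely many balls of \<open>P\<close>. A
  relation rather than a norm, so that no supremum over a possibly unbounded field occurs.\<close>

definition bounded_by :: "(('a, 'm::finite) chart \<times> (real ^ 'm) \<times> real) set \<Rightarrow> ('a, 'm) vec_field \<Rightarrow> real \<Rightarrow> bool" where
  "bounded_by P \<alpha> \<delta> \<longleftrightarrow> (\<forall>(\<kappa>, y, r)\<in>P. \<forall>z\<in>cball y r. \<forall>i. \<bar>\<alpha> \<kappa> (cinv \<kappa> z) $ i\<bar> \<le> \<delta>)"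

lemma bounded_byD: "bounded_by P \<alpha> \<delta> \<Longrightarrow> (\<kappa>, y, r) \<in> P \<Longrightarrow> z \<in> cball y r \<Longrightarrow> \<bar>\<alpha> \<kappa> (cinv \<kappa> z) $ i\<bar> \<le> \<delta>"
  unfolding bounded_by_def by fast

context
  fixes A :: "('a::{t2_space, second_countable_topology}, 'm::finite) chart set"
  assumes man: "closed_connected_manifold A"
begin

text \<open>Regularity by bootstrapping: \<open>w\<close> is only known to be differentiable, near
  each point in some chart, but its derivative is the smooth form \<open>\<beta>\<close>, so all
  orders of smoothness follow. The transformation law of \<open>\<beta>\<close> carries
  \<open>d w = \<beta>\<close> to the other charts.\<close>

lemma primitive_of_one_form:
  assumes \<beta>: "one_form A \<beta>"
    and w: "\<And>p. \<exists>\<kappa>\<in>A. \<exists>N. open N \<and> p \<in> N \<and> N \<subseteq> cdom \<kappa> \<and> (\<forall>q\<in>N.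
      ((\<lambda>z. w (cinv \<kappa> z)) has_derivative (\<lambda>v. \<Sum>i\<in>UNIV. v $ i * \<beta> \<kappa> q $ i)) (at (cmap \<kappa> q)))"
  shows "smooth_fun A w" and "\<And>\<kappa> p. \<kappa> \<in> A \<Longrightarrow> p \<in> cdom \<kappa> \<Longrightarrow> d_fun w \<kappa> p = \<beta> \<kappa> p"
proof -
  have local: "\<exists>D. open D \<and> p \<in> D \<and> D \<subseteq> cdom \<kappa> \<and> chart_smooth (D, cmap \<kappa>) w \<and> d_fun w \<kappa> p = \<beta> \<kappa> p"
    if \<kappa>: "\<kappa> \<in> A" and p: "p \<in> cdom \<kappa>" for \<kappa> p
  proof -
    note ch = closed_manifold_chart[OF man \<kappa>]
    obtain \<kappa>' N where \<kappa>': "\<kappa>' \<in> A" and N: "open N" "p \<in> N" "N \<subseteq> cdom \<kappa>'"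
      and der: "\<And>q. q \<in> N \<Longrightarrow>
        ((\<lambda>z. w (cinv \<kappa>' z)) has_derivative (\<lambda>v. \<Sum>i\<in>UNIV. v $ i * \<beta> \<kappa>' q $ i)) (at (cmap \<kappa>' q))"
      using w[of p] by blast
    note ch' = closed_manifold_chart[OF man \<kappa>']
    define D where "D = N \<inter> cdom \<kappa>"
    have D: "open D" "D \<subseteq> cdom \<kappa>" "D \<subseteq> cdom \<kappa>'" and pD: "p \<in> D"
      using N p open_cdom[OF ch] by (auto simp: D_def)
    let ?k = "(D, cmap \<kappa>)" and ?k' = "(D, cmap \<kappa>')"
    note ck = is_chart_restrict[OF ch D(1,2)] and ck' = is_chart_restrict[OF ch' D(1,3)]
    note t1 = chart_smooth_transition_restrict[OF man \<kappa> \<kappa>' D]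
      and t2 = chart_smooth_transition_restrict[OF man \<kappa>' \<kappa> D(1,3,2)]
    have dom: "cdom ?k' = cdom ?k" by (simp add: cdom_def)
    note op = open_restrict_image[OF ch' D(1,3)]
    have der': "((\<lambda>z. w (cinv \<kappa>' z)) has_derivative (\<lambda>v. \<Sum>i\<in>UNIV. v $ i * \<beta> \<kappa>' (cinv \<kappa>' y) $ i)) (at y)"
      if "y \<in> cmap \<kappa>' ` D" for y
      using that der D(3) by (auto simp: D_def cinv_cmap[OF ch'])
    have \<beta>s: "chart_smooth ?k' (\<lambda>q. \<beta> \<kappa>' q $ i)" for i
      using one_form_chart_smooth[OF \<beta> \<kappa>' ch']
      by (intro chart_smooth_restrict[OF ch' D(1,3)]) (simp add: chart_smooth_vec_iff[OF ch'])
    have "C_on k (cmap \<kappa>' ` D) (\<lambda>y. \<beta> \<kappa>' (cinv \<kappa>' y) $ i)" for k i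
      by (rule C_on_cong[OF op, of "\<lambda>y. \<beta> \<kappa>' (cinv ?k' y) $ i"])
        (use \<beta>s in \<open>auto simp: chart_smooth_def cdom_restrict[OF ch' D(1,3)] cmap_restrict[OF ch' D(1,3)]
            cinv_restrict[OF ch' D(1,3)]\<close>)
    then have "C_on (Suc k) (cmap \<kappa>' ` D) (\<lambda>y. w (cinv \<kappa>' y))" for k
      by (intro C_on_Suc_intro[OF op der'] C_on_sum C_on_mult C_on_const op)
    then have "C_on k (cmap \<kappa>' ` D) (\<lambda>y. w (cinv \<kappa>' y))" for k
      by (rule C_on_decSuc)
    then have "C_on k (cmap \<kappa>' ` D) (\<lambda>y. w (cinv ?k' y))" for k
      using C_on_cong[OF op, of "\<lambda>y. w (cinv \<kappa>' y)"] by (simp add: cinv_restrict[OF ch' D(1,3)])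
    then have ws': "chart_smooth ?k' w"
      by (simp add: chart_smooth_def cdom_restrict[OF ch' D(1,3)] cmap_restrict[OF ch' D(1,3)])
    have ws: "chart_smooth ?k w" by (rule chart_smooth_chain[OF ck ck' dom t1 t2 ws'])
    have pd': "pd \<kappa>' a w p = \<beta> \<kappa>' p $ a" for a
      using pd_eqI[OF der[of p]] pD by (simp add: D_def sum_axis)
    have "pd \<kappa> i w p = \<beta> \<kappa> p $ i" for i
    proof -
      have "pd \<kappa> i w p = pd ?k i w p" by (rule pd_restrict[OF ch D(1,2) pD, symmetric])
      also have "\<dots> = (\<Sum>a\<in>UNIV. pd ?k' a w p * transition_derivative ?k ?k' p $ a $ i)"
        by (rule pd_chain[OF ck ck' dom t1 t2 ws']) (simp add: cdom_def pD)
      also have "\<dots> = (transpose (jacobian \<kappa> \<kappa>' p) *v \<beta> \<kappa>' p) $ i"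
        unfolding jacobian_eq_transition_derivative[OF man \<kappa> \<kappa>' D pD] pd_restrict[OF ch' D(1,3) pD] pd'
        by (simp only: matrix_vector_mult_component transpose_def vec_lambda_beta mult.commute)
      also have "\<dots> = \<beta> \<kappa> p $ i" using \<beta> \<kappa> \<kappa>' D pD unfolding one_form_def by (metis IntI subsetD)
      finally show ?thesis .
    qed
    then have "d_fun w \<kappa> p = \<beta> \<kappa> p" by (simp add: d_fun_def vec_eq_iff)
    then show ?thesis using D pD ws by blast
  qed
  show "\<And>\<kappa> p. \<kappa> \<in> A \<Longrightarrow> p \<in> cdom \<kappa> \<Longrightarrow> d_fun w \<kappa> p = \<beta> \<kappa> p" using local by blast
  show "smooth_fun A w"
    unfolding smooth_fun_def
  proof
    fix \<kappa> assume \<kappa>: "\<kappa> \<in> A"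
    note ch = closed_manifold_chart[OF man \<kappa>]
    have "C_on k (cmap \<kappa> ` cdom \<kappa>) (\<lambda>y. w (cinv \<kappa> y))" for k
    proof (rule C_on_local)
      fix y assume "y \<in> cmap \<kappa> ` cdom \<kappa>"
      then obtain p where p: "p \<in> cdom \<kappa>" "y = cmap \<kappa> p" by blast
      obtain D where D: "open D" "p \<in> D" "D \<subseteq> cdom \<kappa>" "chart_smooth (D, cmap \<kappa>) w"
        using local[OF \<kappa> p(1)] by blast
      have "C_on k (cmap \<kappa> ` D) (\<lambda>y. w (cinv (D, cmap \<kappa>) y))"
        using D(4) by (simp add: chart_smooth_def cdom_restrict[OF ch D(1,3)] cmap_restrict[OF ch D(1,3)])
      then have "C_on k (cmap \<kappa> ` D) (\<lambda>y. w (cinv \<kappa> y))"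
        by (rule C_on_cong[OF open_restrict_image[OF ch D(1,3)], rotated]) (simp add: cinv_restrict[OF ch D(1,3)])
      then show "\<exists>W. open W \<and> y \<in> W \<and> C_on k W (\<lambda>y. w (cinv \<kappa> y))"
        using open_restrict_image[OF ch D(1,3)] D(2) p(2) by blast
    qed
    then show "smooth_on (cmap \<kappa> ` cdom \<kappa>) (\<lambda>y. w (cinv \<kappa> y))"
      by (simp add: smooth_on_open_iff[OF open_chart_image[OF ch]])
  qed
qed

lemma ball_cover_exists: "\<exists>P. ball_cover A P"
proof -
  let ?Q = "{(\<kappa>, y, r). \<kappa> \<in> A \<and> 0 < r \<and> cball y r \<subseteq> cmap \<kappa> ` cdom \<kappa>}"
  let ?V = "\<lambda>(\<kappa>, y, r). cdom \<kappa> \<inter> cmap \<kappa> -` ball y r"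
  have "compact (UNIV :: 'a set)" using man by (simp add: closed_connected_manifold_def)
  moreover have "open (?V z)" if "z \<in> ?Q" for z
    using that closed_manifold_chart[OF man]
    by (auto intro!: continuous_open_preimage continuous_on_cmap open_cdom)
  moreover have "UNIV \<subseteq> (\<Union>z\<in>?Q. ?V z)"
  proof
    fix p
    obtain \<kappa> where \<kappa>: "\<kappa> \<in> A" "p \<in> cdom \<kappa>" using chart_at[OF man] by blast
    then obtain r where "r > 0" "cball (cmap \<kappa> p) r \<subseteq> cmap \<kappa> ` cdom \<kappa>"
      using open_contains_cball open_chart_image[OF closed_manifold_chart[OF man \<kappa>(1)]] by blast
    then show "p \<in> (\<Union>z\<in>?Q. ?V z)" using \<kappa> by (intro UN_I[of "(\<kappa>, cmap \<kappa> p, r)"]) auto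
  qed
  ultimately obtain P where P: "P \<subseteq> ?Q" "finite P" "UNIV \<subseteq> (\<Union>z\<in>P. ?V z)"
    by (rule compactE_image)
  have "ball_cover A P"
    unfolding ball_cover_def
  proof (intro conjI P(2) allI)
    show "\<forall>(\<kappa>, y, r)\<in>P. \<kappa> \<in> A \<and> 0 < r \<and> cball y r \<subseteq> cmap \<kappa> ` cdom \<kappa>" using P(1) by auto
    fix p
    obtain z where "z \<in> P" "p \<in> ?V z" using P(3) by blast
    then show "\<exists>(\<kappa>, y, r)\<in>P. p \<in> cdom \<kappa> \<and> cmap \<kappa> p \<in> ball y r" by (auto simp: case_prod_unfold)
  qed
  then show ?thesis by blast
qed

lemma poincare_ball:
  assumes P: "ball_cover A P" and k: "(\<kappa>, y, r) \<in> P" and u: "smooth_fun A u"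
    and \<delta>: "bounded_by P (d_fun u) \<delta>" and z: "z \<in> cball y r" "z' \<in> cball y r"
  shows "\<bar>u (cinv \<kappa> z) - u (cinv \<kappa> z')\<bar> \<le> real CARD('m) * \<delta> * (2 * r)"
proof -
  have \<kappa>: "\<kappa> \<in> A" "0 < r" "cball y r \<subseteq> cmap \<kappa> ` cdom \<kappa>" using P k unfolding ball_cover_def by auto
  note ch = closed_manifold_chart[OF man \<kappa>(1)]
  have d0: "0 \<le> \<delta>" using bounded_byD[OF \<delta> k z(1), of undefined] by linarith
  have "norm (u (cinv \<kappa> z) - u (cinv \<kappa> z')) \<le> (real CARD('m) * \<delta>) * norm (z - z')"
  proof (rule differentiable_bound[OF convex_cball _ _ z])
    fix x assume x: "x \<in> cball y r"
    then have xO: "x \<in> cmap \<kappa> ` cdom \<kappa>" using \<kappa>(3) by blast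
    let ?D = "\<lambda>v. \<Sum>i\<in>UNIV. v $ i * pd \<kappa> i u (cinv \<kappa> x)"
    show "((\<lambda>z. u (cinv \<kappa> z)) has_derivative ?D) (at x within cball y r)"
      using chart_smooth_has_derivative[OF ch smooth_fun_chart_smooth[OF u \<kappa>(1) ch] cinv_in_cdom[OF ch xO]]
      by (simp add: cmap_cinv[OF ch xO] has_derivative_at_withinI)
    show "onorm ?D \<le> real CARD('m) * \<delta>"
    proof (rule onorm_le)
      fix v :: "real ^ 'm"
      have "norm (?D v) \<le> (\<Sum>i\<in>UNIV. \<bar>v $ i\<bar> * \<bar>pd \<kappa> i u (cinv \<kappa> x)\<bar>)"
        by (simp add: abs_mult[symmetric] sum_abs)
      also have "\<dots> \<le> (\<Sum>i\<in>(UNIV :: 'm set). norm v * \<delta>)"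
        using bounded_byD[OF \<delta> k x] by (intro sum_mono mult_mono component_le_norm_cart) (auto simp: d_fun_def)
      finally show "norm (?D v) \<le> real CARD('m) * \<delta> * norm v" by (simp add: mult.commute mult.left_commute)
    qed
  qed
  also have "\<dots> \<le> (real CARD('m) * \<delta>) * (2 * r)"
  proof (rule mult_left_mono)
    have "dist z z' \<le> dist y z + dist y z'" using dist_triangle[of z z' y] by (simp add: dist_commute)
    then show "norm (z - z') \<le> 2 * r" using z by (simp add: dist_norm)
  qed (use d0 in simp)
  finally show ?thesis by simp
qed

text \<open>Call \<open>p\<close> and \<open>q\<close> related if one constant controls
  \<open>|u p - u q|\<close> for all \<open>u\<close>. Classes are open by the estimate on balls, so
  connectedness leaves a single class; the finite cover then makes the constant independent of the
  points.\<close>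

lemma poincare:
  assumes P: "ball_cover A P"
  shows "\<exists>C\<ge>0. \<forall>u \<delta>. smooth_fun A u \<longrightarrow> 0 \<le> \<delta> \<longrightarrow> bounded_by P (d_fun u) \<delta> \<longrightarrow> (\<forall>p q. \<bar>u p - u q\<bar> \<le> C * \<delta>)"
proof -
  define R where "R p q \<longleftrightarrow> (\<exists>C\<ge>0. \<forall>u \<delta>. smooth_fun A u \<longrightarrow> 0 \<le> \<delta> \<longrightarrow> bounded_by P (d_fun u) \<delta> \<longrightarrow> \<bar>u p - u q\<bar> \<le> C * \<delta>)" for p q
  have R_refl: "R p p" for p unfolding R_def by (intro exI[of _ 0]) auto
  have R_sym: "R q p" if "R p q" for p q using that unfolding R_def by (simp add: abs_minus_commute)
  have R_trans: "R p s" if pq: "R p q" and qs: "R q s" for p q s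
  proof -
    obtain C where C: "C \<ge> 0" "\<And>u \<delta>. smooth_fun A u \<Longrightarrow> 0 \<le> \<delta> \<Longrightarrow> bounded_by P (d_fun u) \<delta> \<Longrightarrow> \<bar>u p - u q\<bar> \<le> C * \<delta>"
      using pq unfolding R_def by blast
    obtain C' where C': "C' \<ge> 0" "\<And>u \<delta>. smooth_fun A u \<Longrightarrow> 0 \<le> \<delta> \<Longrightarrow> bounded_by P (d_fun u) \<delta> \<Longrightarrow> \<bar>u q - u s\<bar> \<le> C' * \<delta>"
      using qs unfolding R_def by blast
    have "\<bar>u p - u s\<bar> \<le> (C + C') * \<delta>" if "smooth_fun A u" "0 \<le> \<delta>" "bounded_by P (d_fun u) \<delta>" for u \<delta>
      using C(2)[OF that] C'(2)[OF that] by (simp add: distrib_right)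
    then show ?thesis unfolding R_def using C(1) C'(1) by (intro exI[of _ "C + C'"]) auto
  qed
  have R_ball: "R p q" if k: "(\<kappa>, y, r) \<in> P" and p: "p \<in> cdom \<kappa>" "cmap \<kappa> p \<in> cball y r"
    and q: "q \<in> cdom \<kappa>" "cmap \<kappa> q \<in> cball y r" for \<kappa> y r p q
  proof -
    have \<kappa>: "\<kappa> \<in> A" "0 < r" using P k unfolding ball_cover_def by auto
    note ch = closed_manifold_chart[OF man \<kappa>(1)]
    have "\<bar>u p - u q\<bar> \<le> (real CARD('m) * (2 * r)) * \<delta>" if "smooth_fun A u" "bounded_by P (d_fun u) \<delta>" for u \<delta>
      using poincare_ball[OF P k that p(2) q(2)] by (simp add: cinv_cmap[OF ch] p(1) q(1) mult_ac)
    then show ?thesis unfolding R_def using \<kappa>(2) by (intro exI[of _ "real CARD('m) * (2 * r)"]) auto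
  qed
  obtain p0 :: 'a where True by blast
  have R_all: "R p0 q" for q
  proof -
    have "R p0 q = R p0 p0"
    proof (rule connected_locally_constant[where f="R p0"])
      show "connected (UNIV :: 'a set)" using man by (simp add: closed_connected_manifold_def)
      fix p
      have "\<exists>z\<in>P. (case z of (\<kappa>, y, r) \<Rightarrow> p \<in> cdom \<kappa> \<and> cmap \<kappa> p \<in> ball y r)"
        using P unfolding ball_cover_def by (elim conjE allE)
      then obtain \<kappa> y r where k: "(\<kappa>, y, r) \<in> P" "p \<in> cdom \<kappa>" "cmap \<kappa> p \<in> ball y r" by auto
      then have \<kappa>: "\<kappa> \<in> A" using P unfolding ball_cover_def by auto
      note ch = closed_manifold_chart[OF man \<kappa>]
      let ?N = "cdom \<kappa> \<inter> cmap \<kappa> -` ball y r"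
      have "open ?N" by (rule continuous_open_preimage[OF continuous_on_cmap[OF ch] open_cdom[OF ch] open_ball])
      moreover have "R p0 q = R p0 p" if "q \<in> ?N" for q
      proof -
        have "R p q" by (rule R_ball[OF k(1,2) _ _]) (use that k(3) in auto)
        then show ?thesis using R_trans R_sym by blast
      qed
      ultimately show "\<exists>N. open N \<and> p \<in> N \<and> (\<forall>q\<in>N. R p0 q = R p0 p)" using k by blast
    qed
    then show ?thesis using R_refl by simp
  qed
  obtain C where C: "\<And>q. C q \<ge> 0" "\<And>q u \<delta>. smooth_fun A u \<Longrightarrow> 0 \<le> \<delta> \<Longrightarrow> bounded_by P (d_fun u) \<delta> \<Longrightarrow> \<bar>u p0 - u q\<bar> \<le> C q * \<delta>"
    using R_all unfolding R_def by metis
  \<comment> \<open>For \<open>q\<close> in a ball of the cover: the constant from \<open>p0\<close>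
    to the centre, plus the estimate across the ball. The sum over the finite cover dominates every
    case.\<close>
  define B where "B = (\<Sum>(\<kappa>, y, r)\<in>P. C (cinv \<kappa> y) + real CARD('m) * (2 * r))"
  have nonneg: "0 \<le> (case z of (\<kappa>, y, r) \<Rightarrow> C (cinv \<kappa> y) + real CARD('m) * (2 * r))" if "z \<in> P" for z
  proof -
    obtain \<kappa> y r where k: "z = (\<kappa>, y, r)" by (cases z)
    have "0 < r" using that P unfolding ball_cover_def k by auto
    then show ?thesis using C(1) unfolding k by simp
  qed
  have B: "\<bar>u p0 - u q\<bar> \<le> B * \<delta>" if u: "smooth_fun A u" "0 \<le> \<delta>" "bounded_by P (d_fun u) \<delta>" for u \<delta> q
  proof -
    have "\<exists>z\<in>P. (case z of (\<kappa>, y, r) \<Rightarrow> q \<in> cdom \<kappa> \<and> cmap \<kappa> q \<in> ball y r)"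
      using P unfolding ball_cover_def by (elim conjE allE)
    then obtain \<kappa> y r where k: "(\<kappa>, y, r) \<in> P" "q \<in> cdom \<kappa>" "cmap \<kappa> q \<in> ball y r" by auto
    then have \<kappa>: "\<kappa> \<in> A" "r > 0" using P unfolding ball_cover_def by auto
    have "\<bar>u (cinv \<kappa> y) - u (cinv \<kappa> (cmap \<kappa> q))\<bar> \<le> real CARD('m) * \<delta> * (2 * r)"
      by (rule poincare_ball[OF P k(1) u(1,3)]) (use k(3) \<kappa>(2) in auto)
    then have "\<bar>u p0 - u q\<bar> \<le> (C (cinv \<kappa> y) + real CARD('m) * (2 * r)) * \<delta>"
      using C(2)[OF u, of "cinv \<kappa> y"] k(2)
      by (simp add: cinv_cmap[OF closed_manifold_chart[OF man \<kappa>(1)]] algebra_simps)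
    also have "\<dots> \<le> B * \<delta>"
    proof (rule mult_right_mono[OF _ u(2)])
      show "C (cinv \<kappa> y) + real CARD('m) * (2 * r) \<le> B"
        unfolding B_def using member_le_sum[OF k(1), of "\<lambda>(\<kappa>, y, r). C (cinv \<kappa> y) + real CARD('m) * (2 * r)"] nonneg P
        unfolding ball_cover_def by auto
    qed
    finally show ?thesis .
  qed
  have "\<bar>u p - u q\<bar> \<le> (2 * B) * \<delta>" if u: "smooth_fun A u" "0 \<le> \<delta>" "bounded_by P (d_fun u) \<delta>" for u \<delta> p q
    using B[OF u, of p] B[OF u, of q] by linarith
  moreover have "0 \<le> B" unfolding B_def by (rule sum_nonneg) (rule nonneg)
  ultimately show ?thesis by (intro exI[of _ "2 * B"]) auto
qed

lemma bounded_by_one_form: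
  assumes P: "ball_cover A P" and \<alpha>: "one_form A \<alpha>"
  shows "\<exists>K\<ge>0. bounded_by P \<alpha> K"
proof -
  have "\<exists>K. \<forall>z\<in>P. case z of (\<kappa>, y, r) \<Rightarrow> \<forall>x\<in>cball y r. norm (\<alpha> \<kappa> (cinv \<kappa> x)) \<le> K z" 
  proof (rule bchoice, rule ballI)
    fix z assume z: "z \<in> P"
    obtain \<kappa> y r where k: "z = (\<kappa>, y, r)" by (cases z)
    have \<kappa>: "\<kappa> \<in> A" "cball y r \<subseteq> cmap \<kappa> ` cdom \<kappa>" using P z unfolding ball_cover_def k by auto
    note ch = closed_manifold_chart[OF man \<kappa>(1)]
    have "continuous_on (cball y r) (\<lambda>x. \<alpha> \<kappa> (cinv \<kappa> x))"
      by (rule continuous_on_subset[OF chart_smooth_continuous_on[OF one_form_chart_smooth[OF \<alpha> \<kappa>(1) ch]] \<kappa>(2)])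
    then have "bounded ((\<lambda>x. \<alpha> \<kappa> (cinv \<kappa> x)) ` cball y r)"
      by (intro compact_imp_bounded compact_continuous_image compact_cball)
    then show "\<exists>K. case z of (\<kappa>, y, r) \<Rightarrow> \<forall>x\<in>cball y r. norm (\<alpha> \<kappa> (cinv \<kappa> x)) \<le> K"
      unfolding k by (auto simp: bounded_iff)
  qed
  then obtain K where K: "\<forall>z\<in>P. case z of (\<kappa>, y, r) \<Rightarrow> \<forall>x\<in>cball y r. norm (\<alpha> \<kappa> (cinv \<kappa> x)) \<le> K z" ..
  have fin: "finite P" using P by (simp add: ball_cover_def)
  have "\<bar>\<alpha> \<kappa> (cinv \<kappa> x) $ i\<bar> \<le> (\<Sum>z\<in>P. \<bar>K z\<bar>)" if "(\<kappa>, y, r) \<in> P" "x \<in> cball y r" for \<kappa> y r x i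
  proof -
    have "\<bar>\<alpha> \<kappa> (cinv \<kappa> x) $ i\<bar> \<le> norm (\<alpha> \<kappa> (cinv \<kappa> x))" by (rule component_le_norm_cart)
    also have "\<dots> \<le> \<bar>K (\<kappa>, y, r)\<bar>" using bspec[OF K that(1)] that(2) by force
    also have "\<dots> \<le> (\<Sum>z\<in>P. \<bar>K z\<bar>)" by (rule member_le_sum[OF that(1)]) (use fin in auto)
    finally show ?thesis .
  qed
  then show ?thesis
    unfolding bounded_by_def by (intro exI[of _ "\<Sum>z\<in>P. \<bar>K z\<bar>"]) (auto intro: sum_nonneg)
qed

end

text \<open>Bolzano-Weierstrass one coordinate at a time: the number \<open>b\<close> of basis forms
  is a variable and not the size of a type, so coefficients are functions on \<open>nat\<close> and
  subsequences are extracted successively.\<close>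

lemma bounded_coordinates_subsequence:
  fixes E :: "nat \<Rightarrow> nat \<Rightarrow> real"
  assumes "\<And>n l. l < b \<Longrightarrow> \<bar>E n l\<bar> \<le> 1"
  shows "\<exists>\<rho> e. strict_mono \<rho> \<and> (\<forall>l<b. (\<lambda>n. E (\<rho> n) l) \<longlonglongrightarrow> e l)"
  using assms
proof (induction b)
  case 0
  then show ?case by (auto intro!: exI[of _ "\<lambda>n. n"] simp: strict_mono_def)
next
  case (Suc b)
  then obtain \<rho> e where \<rho>: "strict_mono \<rho>" "\<forall>l<b. (\<lambda>n. E (\<rho> n) l) \<longlonglongrightarrow> e l" by (metis less_SucI)
  have "bounded (range (\<lambda>n. E (\<rho> n) b))"
    using Suc.prems[of b] by (auto simp: bounded_iff)
  then obtain x \<rho>' where \<rho>': "strict_mono \<rho>'" "((\<lambda>n. E (\<rho> n) b) \<circ> \<rho>') \<longlonglongrightarrow> x"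
    using bounded_imp_convergent_subsequence by metis
  have "(\<lambda>n. E ((\<rho> \<circ> \<rho>') n) l) \<longlonglongrightarrow> (e(b := x)) l" if "l < Suc b" for l
  proof (cases "l = b")
    case True
    then show ?thesis using \<rho>'(2) by (simp add: o_def)
  next
    case False
    then have "(\<lambda>n. E (\<rho> n) l) \<longlonglongrightarrow> e l" using \<rho>(2) that by simp
    from LIMSEQ_subseq_LIMSEQ[OF this \<rho>'(1)] show ?thesis using False by (simp add: o_def)
  qed
  moreover have "strict_mono (\<rho> \<circ> \<rho>')" using \<rho>(1) \<rho>'(1) by (rule strict_mono_o)
  ultimately show ?case by blast
qed

lemma osc_attained:
  fixes u :: "'a::topological_space \<Rightarrow> real"
  assumes "compact (UNIV :: 'a set)" "continuous_on UNIV u"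
  shows "\<exists>p q. osc u = u p - u q" "u p - u q \<le> osc u"
proof -
  obtain pM where pM: "\<And>q. u q \<le> u pM"
    using continuous_attains_sup[OF assms(1) _ assms(2)] by auto
  obtain pm where pm: "\<And>q. u pm \<le> u q"
    using continuous_attains_inf[OF assms(1) _ assms(2)] by auto
  have "Sup (range u) = u pM" by (rule cSup_eq_maximum) (auto simp: pM)
  moreover have "Inf (range u) = u pm" by (rule cInf_eq_minimum) (auto simp: pm)
  ultimately have e: "osc u = u pM - u pm" by (simp add: osc_def)
  then show "\<exists>p q. osc u = u p - u q" by blast
  show "u p - u q \<le> osc u" unfolding e using pM[of p] pm[of q] by linarith
qed

lemma osc_le_osc_add:
  fixes u v :: "'a::topological_space \<Rightarrow> real"
  assumes "compact (UNIV :: 'a set)" "continuous_on UNIV u" "continuous_on UNIV v"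
    and D: "\<And>p q. \<bar>(u p - v p) - (u q - v q)\<bar> \<le> D"
  shows "osc u \<le> osc v + D"
proof -
  obtain p q where "osc u = u p - u q" using osc_attained(1)[OF assms(1,2)] by blast
  then show ?thesis using osc_attained(2)[OF assms(1,3), of p q] D[of p q] by linarith
qed

definition lincomb :: "nat \<Rightarrow> (nat \<Rightarrow> ('a, 'm::finite) vec_field) \<Rightarrow> (nat \<Rightarrow> real) \<Rightarrow> ('a, 'm) vec_field" where
  "lincomb b h e \<kappa> q = (\<Sum>l<b. e l *\<^sub>R h l \<kappa> q)"

lemma lincomb_component: "lincomb b h e \<kappa> q $ i = (\<Sum>l<b. e l * h l \<kappa> q $ i)"
  by (simp add: lincomb_def)

context
  fixes A :: "('a::{t2_space, second_countable_topology}, 'm::finite) chart set" and G :: "('a, 'm) mat_field"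
    and b :: nat and h :: "nat \<Rightarrow> ('a, 'm) vec_field"
  assumes man: "closed_connected_manifold A" and riem: "riemannian_metric A G" and hb: "harmonic_basis A G b h"
begin

lemma harmonic_lincomb_basis: "harmonic A G (lincomb b h e)"
  using harmonic_sum[OF man riem, of b h e] hb unfolding harmonic_basis_def lincomb_def by blast

lemma harmonic_cong:
  assumes \<alpha>: "harmonic A G \<alpha>" and eq: "\<And>\<kappa> p. \<kappa> \<in> A \<Longrightarrow> p \<in> cdom \<kappa> \<Longrightarrow> \<beta> \<kappa> p = \<alpha> \<kappa> p"
  shows "harmonic A G \<beta>"
  unfolding harmonic_def one_form_def
proof (intro conjI ballI)
  have of: "one_form A \<alpha>" using \<alpha> by (simp add: harmonic_def)
  fix \<kappa> assume \<kappa>: "\<kappa> \<in> A"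
  note ch = closed_manifold_chart[OF man \<kappa>]
  have "chart_smooth \<kappa> (\<beta> \<kappa>)"
    by (rule chart_smooth_cong[OF ch _ one_form_chart_smooth[OF of \<kappa> ch]]) (simp add: eq[OF \<kappa>])
  then show "smooth_on (cmap \<kappa> ` cdom \<kappa>) (\<lambda>y. \<beta> \<kappa> (cinv \<kappa> y))"
    by (simp add: chart_smooth_iff_smooth_on[OF ch])
  fix p
  show "laplacian G \<beta> \<kappa> p = 0" if p: "p \<in> cdom \<kappa>"
  proof -
    have "laplacian G \<beta> \<kappa> p = laplacian G \<alpha> \<kappa> p"
      by (rule laplacian_cong[where \<alpha>=\<beta> and \<beta>=\<alpha>, OF ch _ _ _ p])
        (use metric_chart[OF man riem] \<kappa> eq in auto)
    then show ?thesis using \<alpha> \<kappa> p by (simp add: harmonic_def)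
  qed
  fix \<kappa>' assume \<kappa>': "\<kappa>' \<in> A" "p \<in> cdom \<kappa> \<inter> cdom \<kappa>'"
  then have "\<alpha> \<kappa> p = transpose (jacobian \<kappa> \<kappa>' p) *v \<alpha> \<kappa>' p"
    using of \<kappa> unfolding one_form_def by blast
  moreover have "\<beta> \<kappa> p = \<alpha> \<kappa> p" "\<beta> \<kappa>' p = \<alpha> \<kappa>' p" using eq \<kappa> \<kappa>' by auto
  ultimately show "\<beta> \<kappa> p = transpose (jacobian \<kappa> \<kappa>' p) *v \<beta> \<kappa>' p" by simp
qed

lemma ball_cover_point:
  assumes "ball_cover A P" "(\<kappa>, y, r) \<in> P" "z \<in> cball y r"
  shows "\<kappa> \<in> A" "z \<in> cmap \<kappa> ` cdom \<kappa>" "cinv \<kappa> z \<in> cdom \<kappa>"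
proof -
  have k: "\<kappa> \<in> A \<and> 0 < r \<and> cball y r \<subseteq> cmap \<kappa> ` cdom \<kappa>"
    using assms(1,2) unfolding ball_cover_def by blast
  then show \<kappa>: "\<kappa> \<in> A" by blast
  show z: "z \<in> cmap \<kappa> ` cdom \<kappa>" using k assms(3) by blast
  show "cinv \<kappa> z \<in> cdom \<kappa>" by (rule cinv_in_cdom[OF closed_manifold_chart[OF man \<kappa>] z])
qed

text \<open>One shape for all later uses: differences of potentials, normalisation at a base point,
  and scaling.\<close>

lemma smooth_fun_affine:
  assumes u: "smooth_fun A u" and v: "smooth_fun A v"
  shows "smooth_fun A (\<lambda>p. c * (u p - a * v p - k))"
    and "\<kappa> \<in> A \<Longrightarrow> p \<in> cdom \<kappa> \<Longrightarrow> d_fun (\<lambda>p. c * (u p - a * v p - k)) \<kappa> p = c *\<^sub>R (d_fun u \<kappa> p - a *\<^sub>R d_fun v \<kappa> p)"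
proof -
  have s: "chart_smooth \<kappa> u" "chart_smooth \<kappa> v" "chart_smooth \<kappa> (\<lambda>p. a * v p)" "chart_smooth \<kappa> (\<lambda>p. u p - a * v p)"
    "chart_smooth \<kappa> (\<lambda>p. u p - a * v p - k)" "chart_smooth \<kappa> (\<lambda>p. c * (u p - a * v p - k))" if \<kappa>: "\<kappa> \<in> A" for \<kappa>
  proof -
    note ch = closed_manifold_chart[OF man \<kappa>]
    show 1: "chart_smooth \<kappa> u" "chart_smooth \<kappa> v"
      using smooth_fun_chart_smooth[OF u \<kappa> ch] smooth_fun_chart_smooth[OF v \<kappa> ch] by auto
    show "chart_smooth \<kappa> (\<lambda>p. a * v p)" "chart_smooth \<kappa> (\<lambda>p. u p - a * v p)"
      "chart_smooth \<kappa> (\<lambda>p. u p - a * v p - k)" "chart_smooth \<kappa> (\<lambda>p. c * (u p - a * v p - k))"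
      by (intro chart_smooth_mult chart_smooth_diff chart_smooth_const ch 1)+
  qed
  show "smooth_fun A (\<lambda>p. c * (u p - a * v p - k))"
    unfolding smooth_fun_def
    by (intro ballI iffD1[OF chart_smooth_iff_smooth_on[OF closed_manifold_chart[OF man]]] s(6))
  assume \<kappa>: "\<kappa> \<in> A" and p: "p \<in> cdom \<kappa>"
  note ch = closed_manifold_chart[OF man \<kappa>]
  have "pd \<kappa> i (\<lambda>p. c * (u p - a * v p - k)) p = c * (pd \<kappa> i u p - a * pd \<kappa> i v p)" for i
    by (simp only: pd_cmult[OF ch s(5)[OF \<kappa>] p] pd_diff[OF ch s(4)[OF \<kappa>] chart_smooth_const[OF ch] p]
        pd_diff[OF ch s(1,3)[OF \<kappa>] p] pd_cmult[OF ch s(2)[OF \<kappa>] p] pd_const diff_zero)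
  then show "d_fun (\<lambda>p. c * (u p - a * v p - k)) \<kappa> p = c *\<^sub>R (d_fun u \<kappa> p - a *\<^sub>R d_fun v \<kappa> p)"
    by (simp add: d_fun_def vec_eq_iff)
qed

lemma basis_bound:
  assumes P: "ball_cover A P"
  shows "\<exists>K\<ge>0. \<forall>e. bounded_by P (lincomb b h e) (K * (\<Sum>l<b. \<bar>e l\<bar>))"
proof -
  have "\<exists>K\<ge>0. bounded_by P (h l) K" if "l < b" for l
    using bounded_by_one_form[OF man P] hb that unfolding harmonic_basis_def harmonic_def by blast
  then obtain K where K: "\<And>l. l < b \<Longrightarrow> K l \<ge> 0" "\<And>l. l < b \<Longrightarrow> bounded_by P (h l) (K l)" by metis
  have "bounded_by P (lincomb b h e) ((\<Sum>l<b. K l) * (\<Sum>l<b. \<bar>e l\<bar>))" for e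
    unfolding bounded_by_def
  proof (clarsimp)
    fix \<kappa> y r z i assume k: "(\<kappa>, y, r) \<in> P" "dist y z \<le> r"
    have "\<bar>lincomb b h e \<kappa> (cinv \<kappa> z) $ i\<bar> \<le> (\<Sum>l<b. \<bar>e l\<bar> * \<bar>h l \<kappa> (cinv \<kappa> z) $ i\<bar>)"
      unfolding lincomb_component by (rule order_trans[OF sum_abs]) (simp add: abs_mult)
    also have "\<dots> \<le> (\<Sum>l<b. \<bar>e l\<bar> * (\<Sum>l<b. K l))"
    proof (intro sum_mono mult_left_mono)
      fix l assume l: "l \<in> {..<b}"
      have "\<bar>h l \<kappa> (cinv \<kappa> z) $ i\<bar> \<le> K l"
        using bounded_byD[OF K(2) k(1)] l k(2) by simp
      also have "K l \<le> (\<Sum>l<b. K l)" using member_le_sum[OF l, of K] K(1) by auto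
      finally show "\<bar>h l \<kappa> (cinv \<kappa> z) $ i\<bar> \<le> (\<Sum>l<b. K l)" .
    qed simp
    finally show "\<bar>lincomb b h e \<kappa> (cinv \<kappa> z) $ i\<bar> \<le> (\<Sum>l<b. K l) * (\<Sum>l<b. \<bar>e l\<bar>)"
      by (simp add: sum_distrib_right[symmetric] mult.commute)
  qed
  moreover have "0 \<le> (\<Sum>l<b. K l)" using K(1) by (intro sum_nonneg) auto
  ultimately show ?thesis by blast
qed

text \<open>Here the maximum principles enter: a primitive of a combination of harmonic forms is
  constant, so the combination is 0 and the independence of the basis applies.\<close>

lemma exact_lincomb_zero:
  assumes W: "smooth_fun A W" and eq: "\<And>\<kappa> p. \<kappa> \<in> A \<Longrightarrow> p \<in> cdom \<kappa> \<Longrightarrow> d_fun W \<kappa> p = lincomb b h e \<kappa> p" and l: "l < b"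
  shows "e l = 0"
proof -
  have "harmonic A G (d_fun W)" by (rule harmonic_cong[OF harmonic_lincomb_basis eq])
  then have c: "W x = W y" for x y by (rule exact_harmonic_constant[OF man riem W])
  have "is_lincomb A b h e (\<lambda>\<kappa> p. 0)"
    unfolding is_lincomb_def
  proof (intro ballI)
    fix \<kappa> p assume \<kappa>: "\<kappa> \<in> A" "p \<in> cdom \<kappa>"
    note ch = closed_manifold_chart[OF man \<kappa>(1)]
    have "pd \<kappa> i W p = pd \<kappa> i (\<lambda>q. W p) p" for i by (rule pd_cong[OF ch c \<kappa>(2)])
    then have "d_fun W \<kappa> p = 0" by (simp add: d_fun_def vec_eq_iff pd_const)
    then show "0 = (\<Sum>i<b. e i *\<^sub>R h i \<kappa> p)" using eq[OF \<kappa>] by (simp add: lincomb_def)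
  qed
  then show ?thesis using hb l unfolding harmonic_basis_def by blast
qed

text \<open>The differences \<open>w n - w m\<close> vanish at \<open>p0\<close> and have small
  differential, so \<open>poincare\<close> makes the values Cauchy. On each convex ball the
  differentials converge uniformly, which permits differentiating the limit; its smoothness then
  comes from \<open>primitive_of_one_form\<close>.\<close>

lemma limit_of_primitives:
  assumes P: "ball_cover A P" and w: "\<And>n. smooth_fun A (w n)" and w0: "\<And>n. w n p0 = 0"
    and \<beta>: "one_form A \<beta>" and \<eta>: "\<eta> \<longlonglongrightarrow> 0"
    and bd: "\<And>n. bounded_by P (\<lambda>\<kappa> q. d_fun (w n) \<kappa> q - \<beta> \<kappa> q) (\<eta> n)"
  shows "\<exists>W. smooth_fun A W \<and> (\<forall>\<kappa>\<in>A. \<forall>p\<in>cdom \<kappa>. d_fun W \<kappa> p = \<beta> \<kappa> p)"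
proof -
  obtain C where C: "C \<ge> 0" "\<And>u \<delta> p q. smooth_fun A u \<Longrightarrow> 0 \<le> \<delta> \<Longrightarrow> bounded_by P (d_fun u) \<delta> \<Longrightarrow> \<bar>u p - u q\<bar> \<le> C * \<delta>"
    using poincare[OF man P] by blast
  obtain \<kappa>1 y1 r1 where k1: "(\<kappa>1, y1, r1) \<in> P" "0 < r1"
  proof -
    have "\<exists>z\<in>P. (case z of (\<kappa>, y, r) \<Rightarrow> p0 \<in> cdom \<kappa> \<and> cmap \<kappa> p0 \<in> ball y r)"
      using P unfolding ball_cover_def by (elim conjE allE)
    then obtain \<kappa> y r where "(\<kappa>, y, r) \<in> P" by auto
    then show thesis using that[of \<kappa> y r] P unfolding ball_cover_def by auto
  qed
  \<comment> \<open>Read off at the centre of some ball of the cover, which is nonempty because it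
    covers \<open>p0\<close>.\<close>
  have \<eta>0: "0 \<le> \<eta> n" for n
    using bounded_byD[OF bd[of n] k1(1), of y1 undefined] k1(2) by simp
  have cauchy: "Cauchy (\<lambda>n. w n p)" for p
  proof -
    have le: "\<bar>w n p - w m p\<bar> \<le> C * (\<eta> n + \<eta> m)" for n m
    proof -
      have aff: "(\<lambda>p. 1 * (w n p - 1 * w m p - 0)) = (\<lambda>p. w n p - w m p)" by simp
      have d: "d_fun (\<lambda>p. w n p - w m p) \<kappa> q = d_fun (w n) \<kappa> q - d_fun (w m) \<kappa> q" if "\<kappa> \<in> A" "q \<in> cdom \<kappa>" for \<kappa> q
        using smooth_fun_affine(2)[OF w w that, of 1 n 1 m 0] unfolding aff by simp
      have "bounded_by P (d_fun (\<lambda>p. w n p - w m p)) (\<eta> n + \<eta> m)"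
        unfolding bounded_by_def
      proof (clarsimp)
        fix \<kappa> y r z i assume k: "(\<kappa>, y, r) \<in> P" "dist y z \<le> r"
        then have z: "z \<in> cball y r" by simp
        have "d_fun (\<lambda>p. w n p - w m p) \<kappa> (cinv \<kappa> z) $ i = (d_fun (w n) \<kappa> (cinv \<kappa> z) - \<beta> \<kappa> (cinv \<kappa> z)) $ i
            - (d_fun (w m) \<kappa> (cinv \<kappa> z) - \<beta> \<kappa> (cinv \<kappa> z)) $ i"
          using d[OF ball_cover_point(1,3)[OF P k(1) z]] by simp
        then show "\<bar>d_fun (\<lambda>p. w n p - w m p) \<kappa> (cinv \<kappa> z) $ i\<bar> \<le> \<eta> n + \<eta> m"
          using bounded_byD[OF bd[of n] k(1) z, of i] bounded_byD[OF bd[of m] k(1) z, of i] by linarith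
      qed
      from C(2)[OF _ _ this, of p p0] show ?thesis
        using smooth_fun_affine(1)[OF w w, of 1 n 1 m 0] \<eta>0[of n] \<eta>0[of m] unfolding aff by (simp add: w0)
    qed
    show ?thesis
    proof (rule CauchyI)
      fix \<epsilon> :: real assume "0 < \<epsilon>"
      then have "0 < \<epsilon> / (2 * C + 1)" using C(1) by simp
      from order_tendstoD(2)[OF \<eta> this] obtain N where N: "\<And>n. n \<ge> N \<Longrightarrow> \<eta> n < \<epsilon> / (2 * C + 1)"
        unfolding eventually_sequentially by blast
      show "\<exists>M. \<forall>m\<ge>M. \<forall>n\<ge>M. norm (w m p - w n p) < \<epsilon>"
      proof (intro exI[of _ N] allI impI)
        fix m n assume mn: "m \<ge> N" "n \<ge> N"
        have "norm (w m p - w n p) \<le> C * (\<eta> m + \<eta> n)" using le by simp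
        also have "\<dots> \<le> C * (2 * (\<epsilon> / (2 * C + 1)))"
          using N[OF mn(1)] N[OF mn(2)] C(1) by (intro mult_left_mono) auto
        also have "\<dots> < \<epsilon>" using C(1) \<open>0 < \<epsilon>\<close> by (simp add: field_simps)
        finally show "norm (w m p - w n p) < \<epsilon>" .
      qed
    qed
  qed
  define W where "W p = lim (\<lambda>n. w n p)" for p
  have W: "(\<lambda>n. w n p) \<longlonglongrightarrow> W p" for p
    unfolding W_def using cauchy real_Cauchy_convergent convergent_LIMSEQ_iff by blast
  have der: "((\<lambda>z. W (cinv \<kappa> z)) has_derivative (\<lambda>v. \<Sum>i\<in>UNIV. v $ i * \<beta> \<kappa> (cinv \<kappa> x) $ i)) (at x)"
    if k: "(\<kappa>, y, r) \<in> P" and x: "x \<in> ball y r" for \<kappa> y r x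
  proof -
    have \<kappa>: "\<kappa> \<in> A" using k P unfolding ball_cover_def by auto
    note ch = closed_manifold_chart[OF man \<kappa>]
    let ?g' = "\<lambda>x v. \<Sum>i\<in>UNIV. v $ i * \<beta> \<kappa> (cinv \<kappa> x) $ i"
    let ?f' = "\<lambda>n x v. \<Sum>i\<in>UNIV. v $ i * pd \<kappa> i (w n) (cinv \<kappa> x)"
    have "\<exists>g. \<forall>x\<in>cball y r. (\<lambda>n. w n (cinv \<kappa> x)) \<longlonglongrightarrow> g x \<and> (g has_derivative ?g' x) (at x within cball y r)"
    proof (rule has_derivative_sequence[where f'="?f'" and ?x0.0=y, OF convex_cball])
      fix n x assume x: "x \<in> cball y r"
      note pt = ball_cover_point[OF P k x]
      show "((\<lambda>x. w n (cinv \<kappa> x)) has_derivative ?f' n x) (at x within cball y r)"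
        using chart_smooth_has_derivative[OF ch smooth_fun_chart_smooth[OF w \<kappa> ch] pt(3), of n]
        by (simp add: cmap_cinv[OF ch pt(2)] has_derivative_at_withinI)
    next
      fix e :: real assume "e > 0"
      then have "0 < e / real CARD('m)" by simp
      from order_tendstoD(2)[OF \<eta> this]
      show "\<forall>\<^sub>F n in sequentially. \<forall>x\<in>cball y r. \<forall>v. norm (?f' n x v - ?g' x v) \<le> e * norm v"
      proof (eventually_elim, intro ballI allI)
        fix n x v assume n: "\<eta> n < e / real CARD('m)" and x: "x \<in> cball y r"
        have "?f' n x v - ?g' x v = (\<Sum>i\<in>UNIV. v $ i * (d_fun (w n) \<kappa> (cinv \<kappa> x) - \<beta> \<kappa> (cinv \<kappa> x)) $ i)"
          by (simp add: d_fun_def sum_subtractf right_diff_distrib)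
        then have "norm (?f' n x v - ?g' x v) \<le> (\<Sum>i\<in>UNIV. \<bar>v $ i\<bar> * \<bar>(d_fun (w n) \<kappa> (cinv \<kappa> x) - \<beta> \<kappa> (cinv \<kappa> x)) $ i\<bar>)"
          by (simp only: real_norm_def abs_mult[symmetric] sum_abs)
        also have "\<dots> \<le> (\<Sum>i\<in>(UNIV :: 'm set). norm v * \<eta> n)"
          using bounded_byD[OF bd[of n] k x] by (intro sum_mono mult_mono component_le_norm_cart) auto
        also have "\<dots> = real CARD('m) * \<eta> n * norm v" by simp
        also have "\<dots> \<le> e * norm v"
          using n by (intro mult_right_mono) (simp_all add: field_simps)
        finally show "norm (?f' n x v - ?g' x v) \<le> e * norm v" .
      qed
    next
      show "y \<in> cball y r" using x zero_le_dist[of y x] by (simp del: zero_le_dist)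
      show "(\<lambda>n. w n (cinv \<kappa> y)) \<longlonglongrightarrow> W (cinv \<kappa> y)" by (rule W)
    qed
    then obtain g where g: "\<And>x. x \<in> cball y r \<Longrightarrow> (\<lambda>n. w n (cinv \<kappa> x)) \<longlonglongrightarrow> g x"
      "\<And>x. x \<in> cball y r \<Longrightarrow> (g has_derivative ?g' x) (at x within cball y r)" by blast
    have gW: "g x = W (cinv \<kappa> x)" if "x \<in> cball y r" for x
      using LIMSEQ_unique[OF g(1)[OF that] W] .
    have "(g has_derivative ?g' x) (at x within ball y r)"
      using g(2)[of x] x by (auto intro: has_derivative_subset)
    then have "(g has_derivative ?g' x) (at x)" using x by (simp add: at_within_open[OF _ open_ball])
    then show ?thesis
      by (rule has_derivative_transform_within_open[OF _ open_ball x]) (simp add: gW)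
  qed
  have "smooth_fun A W" "\<And>\<kappa> p. \<kappa> \<in> A \<Longrightarrow> p \<in> cdom \<kappa> \<Longrightarrow> d_fun W \<kappa> p = \<beta> \<kappa> p"
  proof -
    have loc: "\<exists>\<kappa>\<in>A. \<exists>N. open N \<and> p \<in> N \<and> N \<subseteq> cdom \<kappa> \<and> (\<forall>q\<in>N.
      ((\<lambda>z. W (cinv \<kappa> z)) has_derivative (\<lambda>v. \<Sum>i\<in>UNIV. v $ i * \<beta> \<kappa> q $ i)) (at (cmap \<kappa> q)))" for p
    proof -
      have "\<exists>z\<in>P. (case z of (\<kappa>, y, r) \<Rightarrow> p \<in> cdom \<kappa> \<and> cmap \<kappa> p \<in> ball y r)"
        using P unfolding ball_cover_def by (elim conjE allE)
      then obtain \<kappa> y r where k: "(\<kappa>, y, r) \<in> P" "p \<in> cdom \<kappa>" "cmap \<kappa> p \<in> ball y r" by auto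
      then have \<kappa>: "\<kappa> \<in> A" using P unfolding ball_cover_def by auto
      note ch = closed_manifold_chart[OF man \<kappa>]
      show ?thesis
      proof (intro bexI[OF _ \<kappa>] exI[of _ "cdom \<kappa> \<inter> cmap \<kappa> -` ball y r"] conjI ballI)
        show "open (cdom \<kappa> \<inter> cmap \<kappa> -` ball y r)"
          by (rule continuous_open_preimage[OF continuous_on_cmap[OF ch] open_cdom[OF ch] open_ball])
        fix q assume q: "q \<in> cdom \<kappa> \<inter> cmap \<kappa> -` ball y r"
        then show "((\<lambda>z. W (cinv \<kappa> z)) has_derivative (\<lambda>v. \<Sum>i\<in>UNIV. v $ i * \<beta> \<kappa> q $ i)) (at (cmap \<kappa> q))"
          using der[OF k(1), of "cmap \<kappa> q"] by (simp add: cinv_cmap[OF ch])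
      qed (use k in auto)
    qed
    show "smooth_fun A W" by (rule primitive_of_one_form(1)[OF man \<beta> loc])
    show "\<And>\<kappa> p. \<kappa> \<in> A \<Longrightarrow> p \<in> cdom \<kappa> \<Longrightarrow> d_fun W \<kappa> p = \<beta> \<kappa> p" by (rule primitive_of_one_form(2)[OF man \<beta> loc])
  qed
  then show ?thesis by blast
qed

end

section \<open>Continuity of the speed of a family of Hodge decompositions\<close>

context
  fixes A :: "('a::{t2_space, second_countable_topology}, 'm::finite) chart set" and G :: "('a, 'm) mat_field"
    and b :: nat and h :: "nat \<Rightarrow> ('a, 'm) vec_field"
  assumes man: "closed_connected_manifold A" and riem: "riemannian_metric A G" and hb: "harmonic_basis A G b h"
begin

abbreviation "LC \<equiv> lincomb b h"

text \<open>A failure of the estimate produces, after normalisation and passage to a subsequence, a nonzero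
  harmonic form that is a locally uniform limit of exact forms, hence exact.\<close>

lemma harmonic_part_bound:
  assumes P: "ball_cover A P"
  shows "\<exists>C\<ge>0. \<forall>u e \<delta>. smooth_fun A u \<longrightarrow> 0 \<le> \<delta> \<longrightarrow>
    bounded_by P (\<lambda>\<kappa> q. d_fun u \<kappa> q + LC e \<kappa> q) \<delta> \<longrightarrow> (\<Sum>l<b. \<bar>e l\<bar>) \<le> C * \<delta>"
proof (rule ccontr)
  assume neg: "\<not> ?thesis"
  define bad where "bad n u e \<delta> \<longleftrightarrow> smooth_fun A u \<and> 0 \<le> \<delta> \<and> bounded_by P (\<lambda>\<kappa> q. d_fun u \<kappa> q + LC e \<kappa> q) \<delta> \<and>
      real n * \<delta> < (\<Sum>l<b. \<bar>e l\<bar>)" for n u e \<delta>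
  have "\<exists>u e \<delta>. bad n u e \<delta>" for n
  proof (rule ccontr)
    assume "\<nexists>u e \<delta>. bad n u e \<delta>"
    then have "\<forall>u e \<delta>. smooth_fun A u \<longrightarrow> 0 \<le> \<delta> \<longrightarrow> bounded_by P (\<lambda>\<kappa> q. d_fun u \<kappa> q + LC e \<kappa> q) \<delta> \<longrightarrow>
      (\<Sum>l<b. \<bar>e l\<bar>) \<le> real n * \<delta>"
      unfolding bad_def by (simp add: not_less)
    then show False using neg of_nat_0_le_iff[of n] by blast
  qed
  then obtain u e \<delta> where bad: "\<And>n. bad n (u n) (e n) (\<delta> n)" by metis
  then have u: "\<And>n. smooth_fun A (u n)" and \<delta>0: "\<And>n. 0 \<le> \<delta> n"
    and bd: "\<And>n. bounded_by P (\<lambda>\<kappa> q. d_fun (u n) \<kappa> q + LC (e n) \<kappa> q) (\<delta> n)"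
    and big: "\<And>n. real n * \<delta> n < (\<Sum>l<b. \<bar>e n l\<bar>)" unfolding bad_def by simp_all
  define S where "S n = (\<Sum>l<b. \<bar>e n l\<bar>)" for n
  have S: "S n > 0" for n
  proof -
    have "0 \<le> real n * \<delta> n" using \<delta>0 by simp
    then show ?thesis using big[of n] unfolding S_def by linarith
  qed
  obtain p0 :: 'a where True by blast
  \<comment> \<open>Scaled so that the coefficients have total size 1, and shifted to vanish at
    \<open>p0\<close>; the term \<open>0 * u n p\<close> only fits the shape of
    \<open>smooth_fun_affine\<close>.\<close>
  define U where "U n p = (1 / S n) * (u n p - 0 * u n p - u n p0)" for n p
  define E where "E n l = e n l / S n" for n l
  define \<Delta> where "\<Delta> n = \<delta> n / S n" for n
  have U: "smooth_fun A (U n)" for n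
    unfolding U_def by (rule smooth_fun_affine(1)[OF man riem hb u u])
  have dU: "d_fun (U n) \<kappa> p = (1 / S n) *\<^sub>R d_fun (u n) \<kappa> p" if "\<kappa> \<in> A" "p \<in> cdom \<kappa>" for n \<kappa> p
    unfolding U_def using smooth_fun_affine(2)[OF man riem hb u u that, of "1 / S n" n 0 n "u n p0"] by simp
  have bdU: "bounded_by P (\<lambda>\<kappa> q. d_fun (U n) \<kappa> q + LC (E n) \<kappa> q) (\<Delta> n)" for n
    unfolding bounded_by_def
  proof (clarsimp)
    fix \<kappa> y r z i assume k: "(\<kappa>, y, r) \<in> P" "dist y z \<le> r"
    then have z: "z \<in> cball y r" by simp
    have "LC (E n) \<kappa> (cinv \<kappa> z) $ i = (1 / S n) * LC (e n) \<kappa> (cinv \<kappa> z) $ i"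
      by (simp add: lincomb_component E_def sum_distrib_left)
    then have "d_fun (U n) \<kappa> (cinv \<kappa> z) $ i + LC (E n) \<kappa> (cinv \<kappa> z) $ i
        = (1 / S n) * (d_fun (u n) \<kappa> (cinv \<kappa> z) + LC (e n) \<kappa> (cinv \<kappa> z)) $ i"
      using dU[OF ball_cover_point(1,3)[OF man riem hb P k(1) z]] by (simp add: distrib_left add_divide_distrib)
    then show "\<bar>d_fun (U n) \<kappa> (cinv \<kappa> z) $ i + LC (E n) \<kappa> (cinv \<kappa> z) $ i\<bar> \<le> \<Delta> n"
      using bounded_byD[OF bd[of n] k(1) z, of i] S[of n]
      by (simp add: abs_mult \<Delta>_def divide_right_mono)
  qed
  have E1: "(\<Sum>l<b. \<bar>E n l\<bar>) = 1" for n
  proof -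
    have "(\<Sum>l<b. \<bar>E n l\<bar>) = S n / S n"
      unfolding S_def[of n] sum_divide_distrib using S[of n] by (simp add: E_def S_def)
    then show ?thesis using S[of n] by simp
  qed
  have \<Delta>0: "0 \<le> \<Delta> n" and \<Delta>1: "real n * \<Delta> n < 1" for n
    using \<delta>0[of n] S[of n] big[of n] by (simp_all add: \<Delta>_def S_def pos_divide_less_eq)
  have "\<bar>E n l\<bar> \<le> 1" if "l < b" for n l
    using member_le_sum[of l "{..<b}" "\<lambda>l. \<bar>E n l\<bar>"] that E1[of n] by simp
  then obtain \<rho> c where \<rho>: "strict_mono \<rho>" and c: "\<And>l. l < b \<Longrightarrow> (\<lambda>n. E (\<rho> n) l) \<longlonglongrightarrow> c l"
    using bounded_coordinates_subsequence[of b E] by blast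
  \<comment> \<open>Failure of the estimate with constant \<open>n\<close> says
    \<open>n * \<Delta> n < 1\<close>, and \<open>n \<le> \<rho> n\<close> along the
    subsequence.\<close>
  have \<Delta>lim: "(\<lambda>n. \<Delta> (\<rho> n)) \<longlonglongrightarrow> 0"
  proof (rule real_tendsto_sandwich[of "\<lambda>n. 0" _ _ "\<lambda>n. 1 / real n"])
    have "\<Delta> (\<rho> n) \<le> 1 / real n" if "n \<ge> 1" for n
    proof -
      have "real n * \<Delta> (\<rho> n) \<le> real (\<rho> n) * \<Delta> (\<rho> n)"
        using seq_suble[OF \<rho>, of n] \<Delta>0 by (intro mult_right_mono) auto
      also have "\<dots> < 1" by (rule \<Delta>1)
      finally show ?thesis using that by (simp add: field_simps)
    qed
    then show "\<forall>\<^sub>F n in sequentially. \<Delta> (\<rho> n) \<le> 1 / real n" by (rule eventually_sequentiallyI)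
  qed (auto simp: \<Delta>0 lim_1_over_n)
  obtain K where K: "K \<ge> 0" "\<And>e. bounded_by P (LC e) (K * (\<Sum>l<b. \<bar>e l\<bar>))"
    using basis_bound[OF man riem hb P] by blast
  \<comment> \<open>Up to \<open>\<Delta>\<close> the form \<open>d U\<close> is
    \<open>- LC E\<close>, and this differs from \<open>- LC c\<close> by the error of the
    coefficients, weighted by the bound \<open>K\<close> for the basis.\<close>
  define \<eta> where "\<eta> n = \<Delta> (\<rho> n) + K * (\<Sum>l<b. \<bar>E (\<rho> n) l - c l\<bar>)" for n
  have "(\<lambda>n. \<Sum>l<b. \<bar>E (\<rho> n) l - c l\<bar>) \<longlonglongrightarrow> (\<Sum>l<b. \<bar>c l - c l\<bar>)"
    using c by (intro tendsto_sum tendsto_rabs tendsto_diff tendsto_const) auto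
  from tendsto_add[OF \<Delta>lim tendsto_mult[OF tendsto_const[of K] this]]
  have \<eta>: "\<eta> \<longlonglongrightarrow> 0"
    by (simp add: \<eta>_def[abs_def])
  have "\<exists>W. smooth_fun A W \<and> (\<forall>\<kappa>\<in>A. \<forall>p\<in>cdom \<kappa>. d_fun W \<kappa> p = LC (\<lambda>l. - c l) \<kappa> p)"
  proof (rule limit_of_primitives[OF man riem hb P, of "\<lambda>n. U (\<rho> n)" p0 _ \<eta>])
    show "one_form A (LC (\<lambda>l. - c l))"
      using harmonic_lincomb_basis[OF man riem hb] by (simp add: harmonic_def)
    show "bounded_by P (\<lambda>\<kappa> q. d_fun (U (\<rho> n)) \<kappa> q - LC (\<lambda>l. - c l) \<kappa> q) (\<eta> n)" for n
      unfolding bounded_by_def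
    proof (clarsimp)
      fix \<kappa> y r z i assume k: "(\<kappa>, y, r) \<in> P" "dist y z \<le> r"
      then have z: "z \<in> cball y r" by simp
      let ?q = "cinv \<kappa> z"
      have "d_fun (U (\<rho> n)) \<kappa> ?q $ i - LC (\<lambda>l. - c l) \<kappa> ?q $ i
          = (d_fun (U (\<rho> n)) \<kappa> ?q + LC (E (\<rho> n)) \<kappa> ?q) $ i - LC (\<lambda>l. E (\<rho> n) l - c l) \<kappa> ?q $ i"
        by (simp add: lincomb_component left_diff_distrib sum_subtractf sum_negf)
      then show "\<bar>d_fun (U (\<rho> n)) \<kappa> ?q $ i - LC (\<lambda>l. - c l) \<kappa> ?q $ i\<bar> \<le> \<eta> n"
        using bounded_byD[OF bdU[of "\<rho> n"] k(1) z, of i]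
          bounded_byD[OF K(2)[of "\<lambda>l. E (\<rho> n) l - c l"] k(1) z, of i]
        unfolding \<eta>_def by linarith
    qed
  qed (simp_all add: U \<eta>, simp add: U_def)
  then obtain W where W: "smooth_fun A W" "\<And>\<kappa> p. \<kappa> \<in> A \<Longrightarrow> p \<in> cdom \<kappa> \<Longrightarrow> d_fun W \<kappa> p = LC (\<lambda>l. - c l) \<kappa> p"
    by blast
  have c0: "c l = 0" if "l < b" for l
    using exact_lincomb_zero[OF man riem hb W that] by simp
  \<comment> \<open>The normalisation survives the limit because only finitely many coordinates
    converge.\<close>
  have "(\<lambda>n. \<Sum>l<b. \<bar>E (\<rho> n) l\<bar>) \<longlonglongrightarrow> (\<Sum>l<b. \<bar>c l\<bar>)"
    using c by (intro tendsto_sum tendsto_rabs) auto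
  then have "(\<Sum>l<b. \<bar>c l\<bar>) = 1" using E1 by (simp add: LIMSEQ_const_iff)
  then show False using c0 by simp
qed

lemma is_lincomb_iff: "is_lincomb A b h c \<alpha> \<longleftrightarrow> (\<forall>\<kappa>\<in>A. \<forall>p\<in>cdom \<kappa>. \<alpha> \<kappa> p = LC c \<kappa> p)"
  by (simp add: is_lincomb_def lincomb_def)

text \<open>Linear independence makes the coefficients unique, so the definite description
  denotes.\<close>

lemma harmonic_norm_eq:
  assumes "is_lincomb A b h c \<alpha>"
  shows "harmonic_norm A b h \<alpha> = (\<Sum>i<b. \<bar>c i\<bar>)"
  unfolding harmonic_norm_def
proof (rule the_equality)
  show "\<exists>c'. is_lincomb A b h c' \<alpha> \<and> (\<Sum>i<b. \<bar>c i\<bar>) = (\<Sum>i<b. \<bar>c' i\<bar>)" using assms by blast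
  fix s assume "\<exists>c'. is_lincomb A b h c' \<alpha> \<and> s = (\<Sum>i<b. \<bar>c' i\<bar>)"
  then obtain c' where c': "is_lincomb A b h c' \<alpha>" "s = (\<Sum>i<b. \<bar>c' i\<bar>)" by blast
  have "is_lincomb A b h (\<lambda>i. c i - c' i) (\<lambda>\<kappa> p. 0)"
    unfolding is_lincomb_def
  proof (intro ballI)
    fix \<kappa> p assume \<kappa>: "\<kappa> \<in> A" "p \<in> cdom \<kappa>"
    have "\<alpha> \<kappa> p = (\<Sum>i<b. c i *\<^sub>R h i \<kappa> p)" "\<alpha> \<kappa> p = (\<Sum>i<b. c' i *\<^sub>R h i \<kappa> p)"
      using assms c'(1) \<kappa> unfolding is_lincomb_def by blast+
    then have "(\<Sum>i<b. c i *\<^sub>R h i \<kappa> p) = (\<Sum>i<b. c' i *\<^sub>R h i \<kappa> p)" by simp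
    then show "0 = (\<Sum>i<b. (c i - c' i) *\<^sub>R h i \<kappa> p)" by (simp add: scaleR_diff_left sum_subtractf)
  qed
  then have "\<forall>i<b. c i - c' i = 0" using hb unfolding harmonic_basis_def by blast
  then show "s = (\<Sum>i<b. \<bar>c i\<bar>)" unfolding c'(2) by (intro sum.cong) auto
qed

text \<open>Subtracting the decompositions at times \<open>s\<close> and \<open>t\<close> decomposes
  \<open>\<alpha> s - \<alpha> t\<close>. Smallness of this form bounds the difference of the
  harmonic coefficients, hence the differential of \<open>U s - U t\<close>, hence the change of the
  oscillation.\<close>

lemma hodge_speed_continuous:
  fixes T :: "real set" and \<alpha> :: "real \<Rightarrow> ('a, 'm) vec_field"
  assumes P: "ball_cover A P"
    and unif: "\<And>\<eta>. \<eta> > 0 \<Longrightarrow> \<exists>d>0. \<forall>s\<in>T. \<forall>t\<in>T. \<bar>s - t\<bar> < d \<longrightarrow> bounded_by P (\<lambda>\<kappa> q. \<alpha> s \<kappa> q - \<alpha> t \<kappa> q) \<eta>"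
    and U: "\<And>t. t \<in> T \<Longrightarrow> smooth_fun A (U t)"
    and c: "\<And>t. t \<in> T \<Longrightarrow> is_lincomb A b h (c t) (H t)"
    and dec: "\<And>t \<kappa> p. t \<in> T \<Longrightarrow> \<kappa> \<in> A \<Longrightarrow> p \<in> cdom \<kappa> \<Longrightarrow> \<alpha> t \<kappa> p = d_fun (U t) \<kappa> p + H t \<kappa> p"
  shows "continuous_on T (speed A b h U H)"
proof -
  have comp: "compact (UNIV :: 'a set)" using man by (simp add: closed_connected_manifold_def)
  obtain C1 where C1: "C1 \<ge> 0" "\<And>u e \<delta>. smooth_fun A u \<Longrightarrow> 0 \<le> \<delta> \<Longrightarrow>
    bounded_by P (\<lambda>\<kappa> q. d_fun u \<kappa> q + LC e \<kappa> q) \<delta> \<Longrightarrow> (\<Sum>l<b. \<bar>e l\<bar>) \<le> C1 * \<delta>"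
    using harmonic_part_bound[OF P] by blast
  obtain C2 where C2: "C2 \<ge> 0" "\<And>u \<delta> p q. smooth_fun A u \<Longrightarrow> 0 \<le> \<delta> \<Longrightarrow> bounded_by P (d_fun u) \<delta> \<Longrightarrow> \<bar>u p - u q\<bar> \<le> C2 * \<delta>"
    using poincare[OF man P] by blast
  obtain K where K: "K \<ge> 0" "\<And>e. bounded_by P (LC e) (K * (\<Sum>l<b. \<bar>e l\<bar>))"
    using basis_bound[OF man riem hb P] by blast
  \<comment> \<open>\<open>C1\<close> bounds the harmonic coefficients, \<open>1 + K * C1\<close>
    then the differential of the potential, and \<open>C2\<close> turns this into a bound on the
    oscillation.\<close>
  define B where "B = C1 + C2 * (1 + K * C1)"
  have B: "B \<ge> 0" using C1(1) C2(1) K(1) by (simp add: B_def)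
  have le: "speed A b h U H s \<le> speed A b h U H t + B * \<eta>"
    if st: "s \<in> T" "t \<in> T" and \<eta>: "\<eta> > 0" and bd: "bounded_by P (\<lambda>\<kappa> q. \<alpha> s \<kappa> q - \<alpha> t \<kappa> q) \<eta>" for s t \<eta>
  proof -
    let ?u = "\<lambda>p. 1 * (U s p - 1 * U t p - 0)" and ?e = "\<lambda>l. c s l - c t l"
    have u: "smooth_fun A ?u" by (rule smooth_fun_affine(1)[OF man riem hb U[OF st(1)] U[OF st(2)]])
    have du: "d_fun ?u \<kappa> p = d_fun (U s) \<kappa> p - d_fun (U t) \<kappa> p" if "\<kappa> \<in> A" "p \<in> cdom \<kappa>" for \<kappa> p
      using smooth_fun_affine(2)[OF man riem hb U[OF st(1)] U[OF st(2)] that, of 1 1 0] by simp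
    have eq: "d_fun ?u \<kappa> p + LC ?e \<kappa> p = \<alpha> s \<kappa> p - \<alpha> t \<kappa> p" if "\<kappa> \<in> A" "p \<in> cdom \<kappa>" for \<kappa> p
    proof -
      have "LC ?e \<kappa> p = LC (c s) \<kappa> p - LC (c t) \<kappa> p"
        by (simp add: vec_eq_iff lincomb_component left_diff_distrib sum_subtractf)
      moreover have "H s \<kappa> p = LC (c s) \<kappa> p" "H t \<kappa> p = LC (c t) \<kappa> p"
        using c[OF st(1)] c[OF st(2)] that unfolding is_lincomb_iff by blast+
      ultimately show ?thesis using du[OF that] dec[OF st(1) that] dec[OF st(2) that] by simp
    qed
    have b1: "bounded_by P (\<lambda>\<kappa> q. d_fun ?u \<kappa> q + LC ?e \<kappa> q) \<eta>"
      unfolding bounded_by_def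
    proof (intro ballI, clarify)
      fix \<kappa> y r z i assume k: "(\<kappa>, y, r) \<in> P" "z \<in> cball y r"
      show "\<bar>(d_fun ?u \<kappa> (cinv \<kappa> z) + LC ?e \<kappa> (cinv \<kappa> z)) $ i\<bar> \<le> \<eta>"
        unfolding eq[OF ball_cover_point(1,3)[OF man riem hb P k]] by (rule bounded_byD[OF bd k])
    qed
    have e: "(\<Sum>l<b. \<bar>?e l\<bar>) \<le> C1 * \<eta>" by (rule C1(2)[OF u _ b1]) (use \<eta> in simp)
    have "bounded_by P (d_fun ?u) ((1 + K * C1) * \<eta>)"
      unfolding bounded_by_def
    proof (intro ballI, clarify)
      fix \<kappa> y r z i assume k: "(\<kappa>, y, r) \<in> P" "z \<in> cball y r"
      have "K * (\<Sum>l<b. \<bar>?e l\<bar>) \<le> K * (C1 * \<eta>)" using e K(1) by (rule mult_left_mono)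
      then show "\<bar>d_fun ?u \<kappa> (cinv \<kappa> z) $ i\<bar> \<le> (1 + K * C1) * \<eta>"
        using bounded_byD[OF b1 k, of i] bounded_byD[OF K(2)[of ?e] k, of i]
        unfolding vector_add_component by (simp only: distrib_right mult_1_left mult.assoc)
    qed
    from C2(2)[OF u _ this] have "\<bar>?u p - ?u q\<bar> \<le> C2 * ((1 + K * C1) * \<eta>)" for p q
      using \<eta> K(1) C1(1) by simp
    then have "osc (U s) \<le> osc (U t) + C2 * ((1 + K * C1) * \<eta>)"
      by (intro osc_le_osc_add[OF comp] smooth_fun_continuous[OF man] U st) simp
    moreover have "(\<Sum>l<b. \<bar>c s l\<bar>) \<le> (\<Sum>l<b. \<bar>c t l\<bar>) + (\<Sum>l<b. \<bar>?e l\<bar>)"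
      unfolding sum.distrib[symmetric] by (rule sum_mono) simp
    ultimately show ?thesis
      using e unfolding speed_def harmonic_norm_eq[OF c[OF st(1)]] harmonic_norm_eq[OF c[OF st(2)]] B_def
      by (simp add: algebra_simps)
  qed
  show ?thesis
    unfolding continuous_on_iff
  proof (intro ballI allI impI)
    fix t \<epsilon> :: real assume t: "t \<in> T" and \<epsilon>: "0 < \<epsilon>"
    define \<eta> where "\<eta> = \<epsilon> / (B + 1)"
    have \<eta>: "\<eta> > 0" "B * \<eta> < \<epsilon>" using B \<epsilon> by (auto simp: \<eta>_def field_simps)
    obtain d where d: "d > 0" "\<And>s t. s \<in> T \<Longrightarrow> t \<in> T \<Longrightarrow> \<bar>s - t\<bar> < d \<Longrightarrow> bounded_by P (\<lambda>\<kappa> q. \<alpha> s \<kappa> q - \<alpha> t \<kappa> q) \<eta>"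
      using unif[OF \<eta>(1)] by blast
    show "\<exists>d>0. \<forall>s\<in>T. dist s t < d \<longrightarrow> dist (speed A b h U H s) (speed A b h U H t) < \<epsilon>"
    proof (intro exI[of _ d] conjI d(1) ballI impI)
      fix s assume s: "s \<in> T" "dist s t < d"
      then have "speed A b h U H s \<le> speed A b h U H t + B * \<eta>" "speed A b h U H t \<le> speed A b h U H s + B * \<eta>"
        using t by (auto intro!: le \<eta>(1) d(2) simp: dist_real_def)
      then show "dist (speed A b h U H s) (speed A b h U H t) < \<epsilon>"
        using \<eta>(2) by (simp add: dist_real_def)
    qed
  qed
qed

end

section \<open>Reparametrisation of isotopies\<close>

lemma C_on_real_polynomial:
  fixes f :: "real \<Rightarrow> real"
  assumes "real_polynomial_function f"
  shows "C_on k UNIV f"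
  using assms
proof (induction rule: real_polynomial_function.induct)
  case (linear f)
  then show ?case by (rule C_on_linear[OF open_UNIV _ C_on_ident[OF open_UNIV]])
qed (auto intro: C_on_const C_on_add C_on_mult)

lemma real_polynomial_antiderivative:
  fixes f :: "real \<Rightarrow> real"
  assumes "real_polynomial_function f"
  obtains F where "F 0 = 0" "\<And>x. (F has_real_derivative f x) (at x)"
proof -
  obtain a n where f: "f = (\<lambda>x. \<Sum>i\<le>n. a i * x ^ i)"
    using assms real_polynomial_function_iff_sum by auto
  show ?thesis
  proof (rule that[of "\<lambda>x. \<Sum>i\<le>n. a i / real (Suc i) * x ^ Suc i"])
    fix x :: real
    show "((\<lambda>x. \<Sum>i\<le>n. a i / real (Suc i) * x ^ Suc i) has_real_derivative f x) (at x)"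
      unfolding f
    proof (rule DERIV_sum)
      fix i
      have "((\<lambda>x. x ^ Suc i) has_real_derivative real (Suc i) * x ^ i) (at x)"
        using DERIV_pow[of "Suc i" x] by simp
      from DERIV_cmult[OF this, of "a i / real (Suc i)"]
      show "((\<lambda>x. a i / real (Suc i) * x ^ Suc i) has_real_derivative a i * x ^ i) (at x)" by simp
    qed
  qed simp
qed

text \<open>Approximating \<open>sqrt g\<close> and squaring makes the polynomial nonnegative on the
  whole line and not just on [0,1]. The added constant bounds it away from 0 everywhere, as the
  global inverse of its primitive requires.\<close>

lemma smooth_majorant:
  fixes g :: "real \<Rightarrow> real"
  assumes g: "continuous_on {0..1} g" "\<And>t. t \<in> {0..1} \<Longrightarrow> 0 \<le> g t" and \<epsilon>: "\<epsilon> > 0"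
  obtains f \<theta> where "real_polynomial_function f" "\<theta> > 0" "\<And>x. \<theta> \<le> f x"
    "\<And>t. t \<in> {0..1} \<Longrightarrow> g t \<le> f t" "\<And>t. t \<in> {0..1} \<Longrightarrow> f t \<le> g t + \<epsilon>"
proof -
  have cs: "continuous_on {0..1} (\<lambda>t. sqrt (g t))"
    using g(1) by (rule continuous_on_real_sqrt)
  obtain M where M: "\<And>t. t \<in> {0..1} \<Longrightarrow> sqrt (g t) \<le> M"
  proof -
    have "{0..1::real} \<noteq> {}" by simp
    from continuous_attains_sup[OF compact_Icc this cs]
    obtain s where "\<And>t. t \<in> {0..1} \<Longrightarrow> sqrt (g t) \<le> sqrt (g s)" by blast
    then show thesis using that by blast
  qed
  have M0: "0 \<le> M" using M[of 0] g(2)[of 0] by (meson atLeastAtMost_iff order_trans real_sqrt_ge_zero zero_le_one order_refl)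
  \<comment> \<open>With \<open>s = sqrt (g t)\<close>, an error of \<open>2 * \<tau>\<close> costs
    \<open>4 * \<tau> * (s + \<tau>)\<close> after squaring, at most
    \<open>4 * \<tau> * (M + 1)\<close>. This must fit into \<open>\<epsilon> / 2\<close>, the other
    half being the constant added to the square.\<close>
  define \<tau> where "\<tau> = min 1 (\<epsilon> / (8 * (M + 1)))"
  have \<tau>: "0 < \<tau>" "\<tau> \<le> 1" "4 * \<tau> * (M + 1) \<le> \<epsilon> / 2"
  proof -
    show "0 < \<tau>" "\<tau> \<le> 1" using \<epsilon> M0 by (auto simp: \<tau>_def)
    have "4 * \<tau> * (M + 1) \<le> 4 * (\<epsilon> / (8 * (M + 1))) * (M + 1)"
      using M0 by (intro mult_right_mono mult_left_mono) (auto simp: \<tau>_def)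
    also have "\<dots> = \<epsilon> / 2" using M0 by (simp add: field_simps)
    finally show "4 * \<tau> * (M + 1) \<le> \<epsilon> / 2" .
  qed
  \<comment> \<open>The shift by \<open>\<tau>\<close>, equal to the tolerance, turns a two-sided
    approximation into \<open>sqrt (g t) \<le> q t \<le> sqrt (g t) + 2 * \<tau>\<close>.\<close>
  have "continuous_on {0..1} (\<lambda>t. sqrt (g t) + \<tau>)" by (intro continuous_intros cs)
  from Stone_Weierstrass_polynomial_function[OF compact_Icc this \<tau>(1)]
  obtain q where q: "polynomial_function q" "\<And>t. t \<in> {0..1} \<Longrightarrow> norm (sqrt (g t) + \<tau> - q t) < \<tau>" by blast
  define f where "f x = q x * q x + \<epsilon> / 2" for x
  show ?thesis
  proof (rule that[of f "\<epsilon> / 2"])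
    show "real_polynomial_function f"
      unfolding f_def
      by (intro real_polynomial_function.intros(2-4)
          q(1)[folded real_polynomial_function_eq])
    show "\<epsilon> / 2 \<le> f x" for x by (simp add: f_def)
    fix t :: real assume t: "t \<in> {0..1}"
    let ?s = "sqrt (g t)"
    have s: "0 \<le> ?s" "?s * ?s = g t" using g(2)[OF t] by auto
    have qs: "?s \<le> q t" "q t \<le> ?s + 2 * \<tau>" using q(2)[OF t] by (auto simp: abs_less_iff)
    have "?s * ?s \<le> q t * q t" using qs s \<tau>(1) by (intro mult_mono) linarith+
    then show "g t \<le> f t" using s \<epsilon> by (simp add: f_def)
    have "q t * q t \<le> (?s + 2 * \<tau>) * (?s + 2 * \<tau>)" using qs s \<tau>(1) by (intro mult_mono) linarith+
    also have "\<dots> = g t + 4 * \<tau> * (?s + \<tau>)" using s(2) by (simp add: algebra_simps)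
    also have "\<dots> \<le> g t + 4 * \<tau> * (M + 1)" using M[OF t] \<tau> by (intro add_left_mono mult_left_mono) auto
    finally show "f t \<le> g t + \<epsilon>" using \<tau>(3) by (simp add: f_def)
  qed (use \<epsilon> in simp)
qed

text \<open>The lower bound \<open>\<theta>\<close> on the slope makes \<open>F\<close> a bijection
  of the line. Its inverse has derivative \<open>1 / f (H y)\<close>, so each order of smoothness of
  \<open>H\<close> gives the next.\<close>

lemma smooth_inverse_of_primitive:
  fixes F f :: "real \<Rightarrow> real"
  assumes f: "real_polynomial_function f" "\<theta> > 0" "\<And>x. \<theta> \<le> f x"
    and F: "F 0 = 0" "\<And>x. (F has_real_derivative f x) (at x)"
  obtains H where "\<And>x. H (F x) = x" "\<And>k. C_on k UNIV H" "\<And>y. (H has_real_derivative inverse (f (H y))) (at y)"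
proof -
  have fpos: "0 < f x" for x using f(2) f(3)[of x] by linarith
  have mono: "x < y \<Longrightarrow> F x < F y" for x y
    by (rule DERIV_pos_imp_increasing) (use F(2) fpos in blast)+
  have inj: "inj F" by (rule linorder_injI) (use mono in force)
  have contF: "isCont F x" for x using F(2) DERIV_isCont by blast
  have lin: "F y - F x \<ge> \<theta> * (y - x)" if "x \<le> y" for x y
  proof (cases "x = y")
    case False
    then have "x < y" using that by simp
    then have "\<exists>z>x. z < y \<and> F y - F x = (y - x) * f z" by (rule MVT2) (rule F(2))
    then obtain z where "F y - F x = (y - x) * f z" by blast
    then show ?thesis using mult_left_mono[OF f(3)[of z], of "y - x"] that by (simp add: mult.commute)
  qed simp
  have surj: "\<exists>x. F x = y" for y
  proof -
    let ?r = "\<bar>y\<bar> / \<theta>"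
    have r: "0 \<le> ?r" "\<theta> * ?r = \<bar>y\<bar>" using f(2) by auto
    have "y \<le> F ?r" using lin[of 0 ?r] r F(1) by simp
    moreover have "F (- ?r) \<le> y" using lin[of "- ?r" 0] r F(1) by simp
    moreover have "\<forall>x. - ?r \<le> x \<and> x \<le> ?r \<longrightarrow> isCont F x" using contF by blast
    ultimately show ?thesis using IVT[of F "- ?r" y ?r] r(1) by force
  qed
  define H where "H = inv F"
  have HF: "H (F x) = x" for x using inj by (simp add: H_def)
  have FH: "F (H y) = y" for y unfolding H_def using surj[of y] by (metis f_inv_into_f rangeI)
  have contH: "isCont H y" for y
    using isCont_inverse_function[of 1 "H y" H F] HF contF FH by simp
  have DH: "(H has_real_derivative inverse (f (H y))) (at y)" for y
    by (rule DERIV_inverse_function[where f=F and a="y - 1" and b="y + 1"])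
      (use F(2) fpos[of "H y"] FH contH in auto)
  have "C_on k UNIV H" for k
  proof (induction k)
    case 0
    then show ?case using contH by (simp add: continuous_at_imp_continuous_on)
  next
    case (Suc k)
    show ?case
    proof (rule C_on_Suc_intro[OF open_UNIV])
      show "(H has_derivative (\<lambda>v. inverse (f (H y)) * v)) (at y)" for y
        using DH[of y] by (simp add: has_field_derivative_def)
      show "C_on k UNIV (\<lambda>y. inverse (f (H y)) * v)" for v
      proof (intro C_on_mult C_on_inverse C_on_const open_UNIV)
        show "C_on k UNIV (\<lambda>y. f (H y))"
          by (rule C_on_compose[OF open_UNIV open_UNIV Suc C_on_real_polynomial[OF f(1)]]) simp
        show "f (H y) \<noteq> 0" for y using fpos[of "H y"] by simp
      qed
    qed
  qed
  then show ?thesis using that HF DH by blast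
qed

text \<open>The time change that makes the speed almost constant: if \<open>f\<close> is a smooth majorant of the speed
  and \<open>F' = f\<close>, then \<open>\<xi> t = F\<^sup>-\<^sup>1 (t F 1)\<close> satisfies \<open>\<xi>' \<cdot> f \<circ> \<xi> = F 1\<close>.\<close>

lemma constant_speed_reparametrization:
  fixes g :: "real \<Rightarrow> real"
  assumes g: "continuous_on {0..1} g" "\<And>t. t \<in> {0..1} \<Longrightarrow> 0 \<le> g t" and \<epsilon>: "\<epsilon> > 0"
  obtains \<xi> \<xi>' where "\<And>k. C_on k UNIV \<xi>" "\<xi> 0 = 0" "\<xi> 1 = 1" "\<And>t. t \<in> {0..1} \<Longrightarrow> \<xi> t \<in> {0..1}"
    "\<And>t. (\<xi> has_real_derivative \<xi>' t) (at t)" "\<And>t. 0 < \<xi>' t"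
    "\<And>t. t \<in> {0..1} \<Longrightarrow> \<xi>' t * g (\<xi> t) \<le> integral {0..1} g + \<epsilon>"
proof -
  obtain f \<theta> where f: "real_polynomial_function f" "\<theta> > 0" "\<And>x. \<theta> \<le> f x"
    and gf: "\<And>t. t \<in> {0..1} \<Longrightarrow> g t \<le> f t" "\<And>t. t \<in> {0..1} \<Longrightarrow> f t \<le> g t + \<epsilon>"
    using smooth_majorant[OF g \<epsilon>] by metis
  obtain F where F: "F 0 = 0" "\<And>x. (F has_real_derivative f x) (at x)"
    using real_polynomial_antiderivative[OF f(1)] by blast
  obtain H where H: "\<And>x. H (F x) = x" "\<And>k. C_on k UNIV H" "\<And>y. (H has_real_derivative inverse (f (H y))) (at y)"
    using smooth_inverse_of_primitive[OF f F] by blast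
  have fpos: "0 < f x" for x using f(2) f(3)[of x] by linarith
  define c where "c = F 1"
  have "F 0 < F 1" by (rule DERIV_pos_imp_increasing) (use F(2) fpos in auto)
  then have c: "0 < c" by (simp add: c_def F(1))
  define \<xi> where "\<xi> t = H (c * t)" for t
  define \<xi>' where "\<xi>' t = c * inverse (f (\<xi> t))" for t
  have D: "(\<xi> has_real_derivative \<xi>' t) (at t)" for t
  proof -
    have "((\<lambda>t. c * t) has_real_derivative c) (at t)" by (auto intro!: derivative_eq_intros)
    from DERIV_chain2[OF H(3) this] show ?thesis by (simp add: \<xi>_def[abs_def] \<xi>'_def mult.commute)
  qed
  have pos: "0 < \<xi>' t" for t using c fpos by (simp add: \<xi>'_def)
  have \<xi>0: "\<xi> 0 = 0" using H(1)[of 0] by (simp add: \<xi>_def F(1))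
  have \<xi>1: "\<xi> 1 = 1" using H(1)[of 1] by (simp add: \<xi>_def c_def)
  have mono: "\<xi> s \<le> \<xi> t" if "s \<le> t" for s t
    by (rule DERIV_nonneg_imp_nondecreasing[OF that]) (use D pos less_imp_le in blast)
  \<comment> \<open>\<open>c\<close> is the integral of the majorant, which exceeds \<open>g\<close>
    by at most \<open>\<epsilon>\<close> on an interval of length 1.\<close>
  have cle: "c \<le> integral {0..1} g + \<epsilon>"
  proof -
    have "(f has_integral (F 1 - F 0)) {0..1}"
      using F(2) by (intro fundamental_theorem_of_calculus)
        (auto simp: has_real_derivative_iff_has_vector_derivative[symmetric] intro: has_field_derivative_at_within)
    moreover have "((\<lambda>t. g t + \<epsilon>) has_integral (integral {0..1} g + \<epsilon>)) {0..1}"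
      using has_integral_add[OF integrable_integral[OF integrable_continuous_real[OF g(1)]] has_integral_const_real[of \<epsilon> 0 1]]
      by simp
    ultimately have "F 1 - F 0 \<le> integral {0..1} g + \<epsilon>"
      using gf(2) by (rule has_integral_le)
    then show ?thesis by (simp add: c_def F(1))
  qed
  show ?thesis
  proof (rule that[of \<xi> \<xi>'])
    show "C_on k UNIV \<xi>" for k
      unfolding \<xi>_def
      by (rule C_on_compose[OF open_UNIV open_UNIV C_on_mult[OF open_UNIV C_on_const[OF open_UNIV] C_on_ident[OF open_UNIV]] H(2)]) simp
    show "\<xi> t \<in> {0..1}" if "t \<in> {0..1}" for t using mono[of 0 t] mono[of t 1] that \<xi>0 \<xi>1 by simp
    fix t :: real assume t: "t \<in> {0..1}"
    then have "\<xi> t \<in> {0..1}" using mono[of 0 t] mono[of t 1] \<xi>0 \<xi>1 by simp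
    \<comment> \<open>The value \<open>c\<close> is exact for the majorant \<open>f\<close>; passing
      to \<open>g \<le> f\<close> can only lower it.\<close>
    then have "c * inverse (f (\<xi> t)) * g (\<xi> t) \<le> c * inverse (f (\<xi> t)) * f (\<xi> t)"
      using gf(1) c fpos[of "\<xi> t"] by (intro mult_left_mono) auto
    also have "\<dots> = c" using fpos[of "\<xi> t"] by simp
    finally show "\<xi>' t * g (\<xi> t) \<le> integral {0..1} g + \<epsilon>" using cle by (simp add: \<xi>'_def)
  qed (use \<xi>0 \<xi>1 D pos in auto)
qed

text \<open>A local extension of the family, composed with
  \<open>(t, y) \<mapsto> (\<xi> t, y)\<close>, extends the new family. The composite lives on an
  open set that may reach beyond [0,1], hence smoothness of \<open>\<xi>\<close> on the whole
  line.\<close>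

lemma smooth_family_reparametrize:
  fixes A :: "('a::{t2_space, second_countable_topology}, 'm::finite) chart set"
  assumes fam: "smooth_family A \<Phi>" and \<xi>: "\<And>k. C_on k UNIV \<xi>" and \<xi>I: "\<And>t. t \<in> {0..1} \<Longrightarrow> \<xi> t \<in> {0..1}"
  shows "smooth_family A (\<lambda>t. \<Phi> (\<xi> t))"
  unfolding smooth_family_def
proof (intro conjI ballI)
  have cont\<xi>: "continuous_on UNIV \<xi>" using \<xi>[of 0] by simp
  have c1: "continuous_on ({0..1} \<times> UNIV) (\<lambda>(t, x). \<Phi> t x)" using fam by (simp add: smooth_family_def)
  have c2: "continuous_on ({0..1} \<times> (UNIV :: 'a set)) (\<lambda>z. (\<xi> (fst z), snd z))"
    by (intro continuous_on_Pair continuous_on_compose2[OF cont\<xi>] continuous_on_fst continuous_on_snd continuous_on_id) auto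
  have "continuous_on ({0..1} \<times> UNIV) (\<lambda>z. (case (\<xi> (fst z), snd z) of (t, x) \<Rightarrow> \<Phi> t x))"
    by (rule continuous_on_compose2[OF c1 c2]) (use \<xi>I in auto)
  then show "continuous_on ({0..1} \<times> UNIV) (\<lambda>(t, x). \<Phi> (\<xi> t) x)" by (simp add: case_prod_unfold)
  fix \<kappa> \<kappa>' assume \<kappa>: "\<kappa> \<in> A" "\<kappa>' \<in> A"
  let ?S = "{(t, y). t \<in> {0..1} \<and> y \<in> cmap \<kappa> ` cdom \<kappa> \<and> \<Phi> t (cinv \<kappa> y) \<in> cdom \<kappa>'}"
  let ?S' = "{(t, y). t \<in> {0..1} \<and> y \<in> cmap \<kappa> ` cdom \<kappa> \<and> \<Phi> (\<xi> t) (cinv \<kappa> y) \<in> cdom \<kappa>'}"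
  let ?m = "\<lambda>z :: real \<times> (real ^ 'm). (\<xi> (fst z), snd z)"
  have m: "C_on k UNIV ?m" for k
    by (rule C_on_Pair[OF open_UNIV C_on_compose[OF open_UNIV open_UNIV
          C_on_linear[OF open_UNIV bounded_linear_fst C_on_ident[OF open_UNIV]] \<xi>]
        C_on_linear[OF open_UNIV bounded_linear_snd C_on_ident[OF open_UNIV]]]) simp
  have s: "smooth_on ?S (\<lambda>(t, y). cmap \<kappa>' (\<Phi> t (cinv \<kappa> y)))"
    using fam \<kappa> unfolding smooth_family_def by blast
  show "smooth_on ?S' (\<lambda>(t, y). cmap \<kappa>' (\<Phi> (\<xi> t) (cinv \<kappa> y)))"
    unfolding smooth_on_def
  proof
    fix z assume z: "z \<in> ?S'"
    have mS: "?m z' \<in> ?S" if "z' \<in> ?S'" for z'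
      using that \<xi>I[of "fst z'"] by (simp add: case_prod_unfold)
    obtain W F where W: "open W" "?m z \<in> W" "\<forall>k. C_on k W F"
      "\<forall>y\<in>W \<inter> ?S. F y = (case y of (t, y) \<Rightarrow> cmap \<kappa>' (\<Phi> t (cinv \<kappa> y)))"
      using bspec[OF s[unfolded smooth_on_def] mS[OF z]] by (elim exE conjE)
    have "continuous_on UNIV ?m" using m[of 0] by simp
    then have oW: "open (?m -` W)" using W(1) by (rule open_vimage[rotated])
    show "\<exists>W F. open W \<and> z \<in> W \<and> (\<forall>k. C_on k W F) \<and>
      (\<forall>y\<in>W \<inter> ?S'. F y = (case y of (t, y) \<Rightarrow> cmap \<kappa>' (\<Phi> (\<xi> t) (cinv \<kappa> y))))"
    proof (intro exI[of _ "?m -` W"] exI[of _ "\<lambda>z. F (?m z)"] conjI oW allI ballI)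
      show "z \<in> ?m -` W" using W(2) by simp
      show "C_on k (?m -` W) (\<lambda>z. F (?m z))" for k
        by (rule C_on_compose[OF oW W(1) C_on_subset[OF m subset_UNIV] W(3)[rule_format]]) simp
      fix z' assume z': "z' \<in> ?m -` W \<inter> ?S'"
      have "?m z' \<in> W \<inter> ?S" by (rule IntI[OF _ mS]) (use z' in simp_all)
      from bspec[OF W(4) this] show "F (?m z') = (case z' of (t, y) \<Rightarrow> cmap \<kappa>' (\<Phi> (\<xi> t) (cinv \<kappa> y)))"
        by (simp add: case_prod_unfold)
    qed
  qed
qed

text \<open>The derivative of the path is taken within [0,1], so the chain rule is too, and it uses
  that \<open>\<xi>\<close> maps [0,1] into itself. The point
  \<open>inv (\<Phi> (\<xi> t)) p\<close> is the same for both velocities.\<close>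

lemma velocity_reparametrize:
  fixes A :: "('a::{t2_space, second_countable_topology}, 'm::finite) chart set"
  assumes man: "closed_connected_manifold A" and fam: "smooth_family A \<Phi>" and bij: "\<And>t. t \<in> {0..1} \<Longrightarrow> bij (\<Phi> t)"
    and \<xi>: "(\<xi> has_real_derivative \<xi>') (at t)" and \<xi>I: "\<And>t. t \<in> {0..1} \<Longrightarrow> \<xi> t \<in> {0..1}"
    and t: "t \<in> {0..1}" and \<kappa>: "\<kappa> \<in> A" "p \<in> cdom \<kappa>"
  shows "velocity (\<lambda>t. \<Phi> (\<xi> t)) t \<kappa> p = \<xi>' *\<^sub>R velocity \<Phi> (\<xi> t) \<kappa> p"
proof -
  let ?g = "\<lambda>s. cmap \<kappa> (\<Phi> s (inv (\<Phi> (\<xi> t)) p))"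
  have "(?g has_vector_derivative velocity \<Phi> (\<xi> t) \<kappa> p) (at (\<xi> t) within {0..1})"
    by (rule velocity_has_vector_derivative[OF man fam bij \<kappa>(1) \<xi>I[OF t] \<kappa>(2)])
  then have "(?g has_vector_derivative velocity \<Phi> (\<xi> t) \<kappa> p) (at (\<xi> t) within \<xi> ` {0..1})"
    by (rule has_vector_derivative_within_subset) (use \<xi>I in auto)
  moreover have "(\<xi> has_vector_derivative \<xi>') (at t within {0..1})"
    using \<xi> by (simp add: has_real_derivative_iff_has_vector_derivative has_vector_derivative_at_within)
  ultimately have "((?g \<circ> \<xi>) has_vector_derivative \<xi>' *\<^sub>R velocity \<Phi> (\<xi> t) \<kappa> p) (at t within {0..1})"
    by (rule vector_diff_chain_within[rotated])
  then show ?thesis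
    unfolding velocity_def o_def using t by (intro vector_derivative_within_closed_interval) auto
qed

section \<open>Symplectic isotopies under time changes, and the two energies\<close>

context
  fixes A :: "('a::{t2_space, second_countable_topology}, 'n::finite + 'n) chart set"
    and \<omega> G :: "('a, 'n + 'n) mat_field"
    and b :: nat
    and h :: "nat \<Rightarrow> ('a, 'n + 'n) vec_field"
  assumes man: "closed_connected_manifold A"
    and symp: "symplectic_form A \<omega>"
    and riem: "riemannian_metric A G"
    and hb: "harmonic_basis A G b h"
begin

lemma isotopy_family:
  assumes "symplectic_isotopy A \<omega> \<Phi>"
  shows "smooth_family A \<Phi>" "\<And>t. t \<in> {0..1} \<Longrightarrow> bij (\<Phi> t)"
  using assms by (auto simp: symplectic_isotopy_def diffeomorphism_def)

lemma symplectic_form_chart_smooth: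
  assumes "\<kappa> \<in> A"
  shows "chart_smooth \<kappa> (\<omega> \<kappa>)"
  using symp assms unfolding chart_smooth_iff_smooth_on[OF closed_manifold_chart[OF man assms]]
  by (simp add: symplectic_form_def closed_two_form_def covariant_2_tensor_def)

lemma continuous_on_contract_velocity:
  assumes \<Phi>: "symplectic_isotopy A \<omega> \<Phi>" and \<kappa>: "\<kappa> \<in> A" and C: "C \<subseteq> cmap \<kappa> ` cdom \<kappa>"
  shows "continuous_on ({0..1} \<times> C) (\<lambda>z. contract (velocity \<Phi> (fst z)) \<omega> \<kappa> (cinv \<kappa> (snd z)))"
proof -
  note ch = closed_manifold_chart[OF man \<kappa>]
  have w: "continuous_on ({0..1} \<times> C) (\<lambda>z. \<omega> \<kappa> (cinv \<kappa> (snd z)) $ j $ i)" for i j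
  proof -
    have "chart_smooth \<kappa> (\<lambda>q. \<omega> \<kappa> q $ j $ i)"
      using symplectic_form_chart_smooth[OF \<kappa>] chart_smooth_mat_iff[OF ch, of "\<omega> \<kappa>"] by simp
    from continuous_on_subset[OF chart_smooth_continuous_on[OF this] C]
    show ?thesis by (rule continuous_on_compose2) (auto intro: continuous_intros)
  qed
  have m: "continuous_on ({0..1} \<times> C) (\<lambda>z. (fst z, cinv \<kappa> (snd z)))"
    by (intro continuous_on_Pair continuous_on_fst continuous_on_id
        continuous_on_compose2[OF continuous_on_subset[OF continuous_on_cinv[OF ch] C]] continuous_on_snd) auto
  have "continuous_on ({0..1} \<times> C) (\<lambda>z. (case (fst z, cinv \<kappa> (snd z)) of (t, p) \<Rightarrow> velocity \<Phi> t \<kappa> p))"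
    by (rule continuous_on_compose2[OF continuous_on_velocity[OF man isotopy_family[OF \<Phi>] \<kappa>] m])
      (use C cinv_in_cdom[OF ch] in auto)
  then have v: "continuous_on ({0..1} \<times> C) (\<lambda>z. velocity \<Phi> (fst z) \<kappa> (cinv \<kappa> (snd z)))" by simp
  have "contract X \<omega> \<kappa> q = (\<chi> i. \<Sum>j\<in>UNIV. \<omega> \<kappa> q $ j $ i * X \<kappa> q $ j)" for X and q :: 'a
    by (simp add: contract_def vec_eq_iff matrix_vector_mult_component transpose_def)
  then show ?thesis
    by (simp only:) (intro continuous_on_vec_lambda continuous_on_sum continuous_on_mult w continuous_on_component v)
qed

text \<open>Uniform continuity on the compact product of [0,1] with each closed ball, and then the
  smallest of finitely many moduli.\<close>

lemma contract_velocity_uniform: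
  assumes \<Phi>: "symplectic_isotopy A \<omega> \<Phi>" and P: "ball_cover A P" and \<eta>: "\<eta> > 0"
  shows "\<exists>d>0. \<forall>s\<in>{0..1}. \<forall>t\<in>{0..1}. \<bar>s - t\<bar> < d \<longrightarrow>
    bounded_by P (\<lambda>\<kappa> q. contract (velocity \<Phi> s) \<omega> \<kappa> q - contract (velocity \<Phi> t) \<omega> \<kappa> q) \<eta>"
proof -
  let ?\<alpha> = "\<lambda>t. contract (velocity \<Phi> t) \<omega>"
  define Q where "Q z d \<longleftrightarrow> (case z of (\<kappa>, y, r) \<Rightarrow> \<forall>s\<in>{0..1}. \<forall>t\<in>{0..1}. \<bar>s - t\<bar> < d \<longrightarrow>
    (\<forall>x\<in>cball y r. norm (?\<alpha> s \<kappa> (cinv \<kappa> x) - ?\<alpha> t \<kappa> (cinv \<kappa> x)) \<le> \<eta>))"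
    for z :: "('a, 'n + 'n) chart \<times> (real ^ ('n + 'n)) \<times> real" and d
  have "\<exists>d>0. Q z d" if "z \<in> P" for z
  proof -
    obtain \<kappa> y r where z: "z = (\<kappa>, y, r)" by (cases z)
    have "\<forall>(\<kappa>, y, r)\<in>P. \<kappa> \<in> A \<and> 0 < r \<and> cball y r \<subseteq> cmap \<kappa> ` cdom \<kappa>"
      using P unfolding ball_cover_def by (elim conjE)
    then have k: "\<kappa> \<in> A" "cball y r \<subseteq> cmap \<kappa> ` cdom \<kappa>" using that unfolding z by auto
    have "uniformly_continuous_on ({0..1} \<times> cball y r) (\<lambda>z. ?\<alpha> (fst z) \<kappa> (cinv \<kappa> (snd z)))"
      by (intro compact_uniformly_continuous continuous_on_contract_velocity[OF \<Phi> k] compact_Times compact_Icc compact_cball)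
    then obtain d where d: "d > 0" "\<And>w w'. w \<in> {0..1} \<times> cball y r \<Longrightarrow> w' \<in> {0..1} \<times> cball y r \<Longrightarrow> dist w' w < d \<Longrightarrow>
      dist (?\<alpha> (fst w') \<kappa> (cinv \<kappa> (snd w'))) (?\<alpha> (fst w) \<kappa> (cinv \<kappa> (snd w))) < \<eta>"
      unfolding uniformly_continuous_on_def using \<eta> by blast
    have "norm (?\<alpha> s \<kappa> (cinv \<kappa> x) - ?\<alpha> t \<kappa> (cinv \<kappa> x)) \<le> \<eta>"
      if st: "s \<in> {0..1}" "t \<in> {0..1}" "\<bar>s - t\<bar> < d" and x: "x \<in> cball y r" for s t x
      using d(2)[of "(t, x)" "(s, x)"] st x by (simp add: dist_Pair_Pair dist_norm)
    then show ?thesis using d(1) unfolding Q_def z by auto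
  qed
  then obtain d where d: "\<And>z. z \<in> P \<Longrightarrow> d z > 0 \<and> Q z (d z)" by metis
  have fin: "finite P" using P unfolding ball_cover_def by blast
  \<comment> \<open>The element 1 keeps the set nonempty for \<open>Min\<close>.\<close>
  define d0 where "d0 = Min (insert 1 (d ` P))"
  have "0 < d0" using fin d by (simp add: d0_def)
  moreover have "bounded_by P (\<lambda>\<kappa> q. ?\<alpha> s \<kappa> q - ?\<alpha> t \<kappa> q) \<eta>" if st: "s \<in> {0..1}" "t \<in> {0..1}" "\<bar>s - t\<bar> < d0" for s t
    unfolding bounded_by_def
  proof (intro ballI, clarify)
    fix \<kappa> y r x i assume k: "(\<kappa>, y, r) \<in> P" "x \<in> cball y r"
    have "d0 \<le> d (\<kappa>, y, r)" unfolding d0_def using fin k(1) by (intro Min_le) auto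
    then have "norm (?\<alpha> s \<kappa> (cinv \<kappa> x) - ?\<alpha> t \<kappa> (cinv \<kappa> x)) \<le> \<eta>"
      using d[OF k(1)] st k(2) unfolding Q_def by auto
    then show "\<bar>(?\<alpha> s \<kappa> (cinv \<kappa> x) - ?\<alpha> t \<kappa> (cinv \<kappa> x)) $ i\<bar> \<le> \<eta>"
      using component_le_norm_cart order_trans by blast
  qed
  ultimately show ?thesis by blast
qed

lemma isotopy_speed:
  assumes \<Phi>: "symplectic_isotopy A \<omega> \<Phi>" and hodge: "isotopy_hodge A \<omega> G \<Phi> U H"
  shows "continuous_on {0..1} (speed A b h U H)" "\<And>t. t \<in> {0..1} \<Longrightarrow> 0 \<le> speed A b h U H t"
proof -
  obtain P where P: "ball_cover A P" using ball_cover_exists[OF man] by blast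
  have dec: "smooth_fun A (U t)" "harmonic A G (H t)"
    "\<And>\<kappa> p. \<kappa> \<in> A \<Longrightarrow> p \<in> cdom \<kappa> \<Longrightarrow> contract (velocity \<Phi> t) \<omega> \<kappa> p = d_fun (U t) \<kappa> p + H t \<kappa> p" if "t \<in> {0..1}" for t
    using hodge that unfolding isotopy_hodge_def hodge_decomposition_def by auto
  have "\<exists>c. is_lincomb A b h c (H t)" if "t \<in> {0..1}" for t
    using hb dec(2)[OF that] unfolding harmonic_basis_def by blast
  then obtain c where c: "\<And>t. t \<in> {0..1} \<Longrightarrow> is_lincomb A b h (c t) (H t)" by metis
  show "continuous_on {0..1} (speed A b h U H)"
    by (rule hodge_speed_continuous[OF man riem hb P contract_velocity_uniform[OF \<Phi> P] dec(1) c dec(3)])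
  fix t :: real assume t: "t \<in> {0..1}"
  have "compact (UNIV :: 'a set)" using man by (simp add: closed_connected_manifold_def)
  from osc_attained(2)[OF this smooth_fun_continuous[OF man dec(1)[OF t]], of undefined undefined]
  have "0 \<le> osc (U t)" by simp
  moreover have "0 \<le> harmonic_norm A b h (H t)"
    unfolding harmonic_norm_eq[OF man riem hb c[OF t]] by (simp add: sum_nonneg)
  ultimately show "0 \<le> speed A b h U H t" by (simp add: speed_def)
qed

lemma osc_scale:
  assumes u: "smooth_fun A u" and c: "0 < c"
  shows "osc (\<lambda>p. c * u p) \<le> c * osc u"
proof -
  have comp: "compact (UNIV :: 'a set)" using man by (simp add: closed_connected_manifold_def)
  have cont: "continuous_on UNIV u" by (rule smooth_fun_continuous[OF man u])
  then have "continuous_on UNIV (\<lambda>p. c * u p)" by (intro continuous_intros)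
  from osc_attained(1)[OF comp this] obtain p q where "osc (\<lambda>p. c * u p) = c * u p - c * u q" by blast
  also have "\<dots> = c * (u p - u q)" by (simp add: right_diff_distrib)
  also have "\<dots> \<le> c * osc u" using osc_attained(2)[OF comp cont] c by (intro mult_left_mono) auto
  finally show ?thesis .
qed

lemma hodge_decomposition_scale:
  assumes dec: "hodge_decomposition A \<omega> G \<alpha> u \<eta>"
    and \<alpha>': "\<And>\<kappa> p. \<kappa> \<in> A \<Longrightarrow> p \<in> cdom \<kappa> \<Longrightarrow> \<alpha>' \<kappa> p = c *\<^sub>R \<alpha> \<kappa> p"
  shows "hodge_decomposition A \<omega> G \<alpha>' (\<lambda>p. c * u p) (\<lambda>\<kappa> p. c *\<^sub>R \<eta> \<kappa> p)"
  unfolding hodge_decomposition_def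
proof (intro conjI ballI)
  have u: "smooth_fun A u" and \<eta>: "harmonic A G \<eta>" and int: "has_omega_integral A \<omega> u 0"
    using dec by (auto simp: hodge_decomposition_def)
  show "smooth_fun A (\<lambda>p. c * u p)"
    using smooth_fun_affine(1)[OF man riem hb u u, of c 0 0] by simp
  show "has_omega_integral A \<omega> (\<lambda>p. c * u p) 0"
  proof -
    obtain K \<kappa> \<psi> where K: "partition_of_unity A K \<kappa> \<psi>"
      "0 = (\<Sum>k<K. integral (cmap (\<kappa> k) ` cdom (\<kappa> k))
        (\<lambda>y. let p = cinv (\<kappa> k) y in \<psi> k p * u p * \<bar>omega_power \<omega> (\<kappa> k) p\<bar>))"
      using int unfolding has_omega_integral_def by blast
    \<comment> \<open>The partition of unity that witnesses the zero mean of \<open>u\<close> also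
      witnesses it for the multiple.\<close>
    have sc: "integral (cmap (\<kappa> k) ` cdom (\<kappa> k)) (\<lambda>y. let p = cinv (\<kappa> k) y in \<psi> k p * (c * u p) * \<bar>omega_power \<omega> (\<kappa> k) p\<bar>)
      = c * integral (cmap (\<kappa> k) ` cdom (\<kappa> k)) (\<lambda>y. let p = cinv (\<kappa> k) y in \<psi> k p * u p * \<bar>omega_power \<omega> (\<kappa> k) p\<bar>)" for k
      unfolding integral_mult_right[symmetric] Let_def by (simp add: mult.left_commute mult.assoc)
    have "(\<Sum>k<K. integral (cmap (\<kappa> k) ` cdom (\<kappa> k))
        (\<lambda>y. let p = cinv (\<kappa> k) y in \<psi> k p * (c * u p) * \<bar>omega_power \<omega> (\<kappa> k) p\<bar>)) = c * 0"
      unfolding sc sum_distrib_left[symmetric] K(2)[symmetric] ..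
    then have "0 = (\<Sum>k<K. integral (cmap (\<kappa> k) ` cdom (\<kappa> k))
        (\<lambda>y. let p = cinv (\<kappa> k) y in \<psi> k p * (c * u p) * \<bar>omega_power \<omega> (\<kappa> k) p\<bar>))" by simp
    with K(1) show ?thesis unfolding has_omega_integral_def by (intro exI[of _ K] exI conjI)
  qed
  show "harmonic A G (\<lambda>\<kappa> p. c *\<^sub>R \<eta> \<kappa> p)"
    using harmonic_lincomb[OF man riem \<eta> \<eta>, of c 0] by simp
  fix \<kappa> p assume \<kappa>: "\<kappa> \<in> A" "p \<in> cdom \<kappa>"
  have "\<alpha> \<kappa> p = d_fun u \<kappa> p + \<eta> \<kappa> p" using dec \<kappa> by (simp add: hodge_decomposition_def)
  then show "\<alpha>' \<kappa> p = d_fun (\<lambda>p. c * u p) \<kappa> p + c *\<^sub>R \<eta> \<kappa> p"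
    using smooth_fun_affine(2)[OF man riem hb u u \<kappa>, of c 0 0] \<alpha>'[OF \<kappa>] by (simp add: scaleR_add_right)
qed

text \<open>In the application \<open>\<alpha>\<close> comes from a velocity, which was only shown
  to be continuous. The smoothness needed to differentiate its components is therefore read off from
  \<open>\<alpha> = d u + \<eta>\<close>.\<close>

lemma d_form_scale:
  assumes dec: "hodge_decomposition A \<omega> G \<alpha> u \<eta>" and \<kappa>: "\<kappa> \<in> A" "p \<in> cdom \<kappa>"
    and \<alpha>': "\<And>q. q \<in> cdom \<kappa> \<Longrightarrow> \<alpha>' \<kappa> q = c *\<^sub>R \<alpha> \<kappa> q"
  shows "d_form \<alpha>' \<kappa> p = c *\<^sub>R d_form \<alpha> \<kappa> p"
proof -
  note ch = closed_manifold_chart[OF man \<kappa>(1)]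
  have u: "smooth_fun A u" and \<eta>: "one_form A \<eta>"
    using dec by (auto simp: hodge_decomposition_def harmonic_def)
  have s: "chart_smooth \<kappa> (\<lambda>q. \<alpha> \<kappa> q $ j)" for j
  proof (rule chart_smooth_cong[OF ch])
    have "chart_smooth \<kappa> (\<lambda>q. \<eta> \<kappa> q $ j)"
      using one_form_chart_smooth[OF \<eta> \<kappa>(1) ch] chart_smooth_vec_iff[OF ch, of "\<eta> \<kappa>"] by simp
    then show "chart_smooth \<kappa> (\<lambda>q. pd \<kappa> j u q + \<eta> \<kappa> q $ j)"
      by (intro chart_smooth_add chart_smooth_pd ch smooth_fun_chart_smooth[OF u \<kappa>(1) ch])
    show "pd \<kappa> j u q + \<eta> \<kappa> q $ j = \<alpha> \<kappa> q $ j" if "q \<in> cdom \<kappa>" for q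
      using dec \<kappa>(1) that by (simp add: hodge_decomposition_def d_fun_def)
  qed
  have "pd \<kappa> i (\<lambda>q. \<alpha>' \<kappa> q $ j) p = c * pd \<kappa> i (\<lambda>q. \<alpha> \<kappa> q $ j) p" for i j
  proof -
    have "pd \<kappa> i (\<lambda>q. \<alpha>' \<kappa> q $ j) p = pd \<kappa> i (\<lambda>q. c * \<alpha> \<kappa> q $ j) p"
      by (rule pd_cong[OF ch _ \<kappa>(2)]) (simp add: \<alpha>')
    then show ?thesis by (simp only: pd_cmult[OF ch s \<kappa>(2)])
  qed
  then show ?thesis by (simp add: d_form_def vec_eq_iff right_diff_distrib)
qed

text \<open>The contracted velocity at time \<open>t\<close> is \<open>\<xi>' t\<close> times the
  old one at time \<open>\<xi> t\<close>; closedness, potential and harmonic part follow linearly,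
  and the positive factor comes out of the oscillation and the absolute values.\<close>

lemma isotopy_reparametrize:
  assumes \<Phi>: "symplectic_isotopy A \<omega> \<Phi>" and hodge: "isotopy_hodge A \<omega> G \<Phi> U H"
    and \<xi>: "\<And>k. C_on k UNIV \<xi>" "\<xi> 0 = 0" and \<xi>I: "\<And>t. t \<in> {0..1} \<Longrightarrow> \<xi> t \<in> {0..1}"
    and D: "\<And>t. (\<xi> has_real_derivative \<xi>' t) (at t)" and pos: "\<And>t. 0 < \<xi>' t"
  defines "U' \<equiv> \<lambda>t p. \<xi>' t * U (\<xi> t) p" and "H' \<equiv> \<lambda>t \<kappa> p. \<xi>' t *\<^sub>R H (\<xi> t) \<kappa> p"
  shows "symplectic_isotopy A \<omega> (\<lambda>t. \<Phi> (\<xi> t))" and "isotopy_hodge A \<omega> G (\<lambda>t. \<Phi> (\<xi> t)) U' H'"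
    and "\<And>t. t \<in> {0..1} \<Longrightarrow> speed A b h U' H' t \<le> \<xi>' t * speed A b h U H (\<xi> t)"
proof -
  let ?\<alpha> = "\<lambda>t. contract (velocity \<Phi> t) \<omega>" and ?\<alpha>' = "\<lambda>t. contract (velocity (\<lambda>t. \<Phi> (\<xi> t)) t) \<omega>"
  note fam = isotopy_family[OF \<Phi>]
  have \<alpha>': "?\<alpha>' t \<kappa> p = \<xi>' t *\<^sub>R ?\<alpha> (\<xi> t) \<kappa> p" if "t \<in> {0..1}" "\<kappa> \<in> A" "p \<in> cdom \<kappa>" for t \<kappa> p
  proof -
    have "velocity (\<lambda>t. \<Phi> (\<xi> t)) t \<kappa> p = \<xi>' t *\<^sub>R velocity \<Phi> (\<xi> t) \<kappa> p"
      by (rule velocity_reparametrize[OF man fam D \<xi>I that])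
    then show ?thesis by (simp only: contract_def matrix_vector_mult_scaleR)
  qed
  have dec: "hodge_decomposition A \<omega> G (?\<alpha> (\<xi> t)) (U (\<xi> t)) (H (\<xi> t))" if "t \<in> {0..1}" for t
    using hodge \<xi>I[OF that] unfolding isotopy_hodge_def by blast
  show "symplectic_isotopy A \<omega> (\<lambda>t. \<Phi> (\<xi> t))"
    unfolding symplectic_isotopy_def
  proof (intro conjI ballI)
    show "smooth_family A (\<lambda>t. \<Phi> (\<xi> t))" by (rule smooth_family_reparametrize[OF fam(1) \<xi>(1) \<xi>I])
    show "\<Phi> (\<xi> 0) = id" using \<Phi> by (simp add: \<xi>(2) symplectic_isotopy_def)
    fix t :: real assume t: "t \<in> {0..1}"
    show "diffeomorphism A (\<Phi> (\<xi> t))" using \<Phi> \<xi>I[OF t] unfolding symplectic_isotopy_def by blast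
    fix \<kappa> p assume \<kappa>: "\<kappa> \<in> A" "p \<in> cdom \<kappa>"
    have "d_form (?\<alpha> (\<xi> t)) \<kappa> p = 0" using \<Phi> \<xi>I[OF t] \<kappa> unfolding symplectic_isotopy_def by blast
    then show "d_form (?\<alpha>' t) \<kappa> p = 0"
      using d_form_scale[where \<alpha>'="?\<alpha>' t", OF dec[OF t] \<kappa> \<alpha>'[OF t \<kappa>(1)]] by simp
  qed
  show "isotopy_hodge A \<omega> G (\<lambda>t. \<Phi> (\<xi> t)) U' H'"
    unfolding isotopy_hodge_def U'_def H'_def
    by (intro ballI hodge_decomposition_scale[OF dec] \<alpha>')
  fix t :: real assume t: "t \<in> {0..1}"
  have d: "smooth_fun A (U (\<xi> t))" "harmonic A G (H (\<xi> t))"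
    using dec[OF t] by (auto simp: hodge_decomposition_def)
  obtain c where c: "is_lincomb A b h c (H (\<xi> t))" using hb d(2) unfolding harmonic_basis_def by blast
  then have c': "is_lincomb A b h (\<lambda>i. \<xi>' t * c i) (H' t)"
    by (simp add: is_lincomb_def H'_def scaleR_sum_right)
  have "harmonic_norm A b h (H' t) = \<xi>' t * harmonic_norm A b h (H (\<xi> t))"
    unfolding harmonic_norm_eq[OF man riem hb c] harmonic_norm_eq[OF man riem hb c']
    using pos[of t] by (simp add: abs_mult sum_distrib_left)
  moreover have "osc (U' t) \<le> \<xi>' t * osc (U (\<xi> t))"
    unfolding U'_def by (rule osc_scale[OF d(1) pos])
  ultimately show "speed A b h U' H' t \<le> \<xi>' t * speed A b h U H (\<xi> t)"
    by (simp add: speed_def distrib_left)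
qed

text \<open>Stated for a single map, so that it can be applied both to \<open>\<phi>\<close> and to
  \<open>inv \<phi>\<close> in the two norms.\<close>

lemma energy_infty_eq_energy_one: "energy_infty A \<omega> G b h \<phi> = energy_one A \<omega> G b h \<phi>"
proof -
  define Q where "Q \<Phi> U H \<longleftrightarrow> symplectic_isotopy A \<omega> \<Phi> \<and> \<Phi> 1 = \<phi> \<and> isotopy_hodge A \<omega> G \<Phi> U H" for \<Phi> U H
  let ?X1 = "{length_one A b h U H | \<Phi> U H. Q \<Phi> U H}" and ?Xi = "{length_infty A b h U H | \<Phi> U H. Q \<Phi> U H}"
  have e: "energy_one A \<omega> G b h \<phi> = Inf ?X1" "energy_infty A \<omega> G b h \<phi> = Inf ?Xi"
    by (simp_all add: energy_one_def energy_infty_def Q_def)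
  have sp: "continuous_on {0..1} (speed A b h U H)" "\<And>t. t \<in> {0..1} \<Longrightarrow> 0 \<le> speed A b h U H t" if "Q \<Phi> U H" for \<Phi> U H
    using isotopy_speed[of \<Phi> U H] that by (auto simp: Q_def)
  have one: "0 \<le> length_one A b h U H" "length_one A b h U H \<le> length_infty A b h U H" if q: "Q \<Phi> U H" for \<Phi> U H
  proof -
    have int: "speed A b h U H integrable_on {0..1}" by (rule integrable_continuous_real[OF sp(1)[OF q]])
    show "0 \<le> length_one A b h U H"
      unfolding length_one_def by (rule integral_nonneg[OF int]) (use sp(2)[OF q] in auto)
    have bdd: "bdd_above (speed A b h U H ` {0..1})"
      by (intro bounded_imp_bdd_above compact_imp_bounded compact_continuous_image sp(1)[OF q] compact_Icc)
    have "integral {0..1} (speed A b h U H) \<le> integral {0..1} (\<lambda>t::real. length_infty A b h U H)"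
    proof (rule integral_le[OF int])
      show "speed A b h U H t \<le> length_infty A b h U H" if "t \<in> {0..1}" for t
        unfolding length_infty_def by (rule cSup_upper[OF imageI[OF that] bdd])
    qed (rule integrable_const_ivl)
    then show "length_one A b h U H \<le> length_infty A b h U H" by (simp add: length_one_def)
  qed
  have bdd1: "bdd_below ?X1" by (rule bdd_belowI[of _ 0]) (use one(1) in auto)
  have bddi: "bdd_below ?Xi" by (rule bdd_belowI[of _ 0]) (use one order_trans in blast)
  show ?thesis
  proof (cases "?X1 = {}")
    \<comment> \<open>Whatever real number \<open>Inf {}\<close> denotes, the two sets are empty
      together.\<close>
    case True
    then have "?Xi = {}" by blast
    then show ?thesis unfolding e True by simp
  next
    case False
    then have ne: "?Xi \<noteq> {}" by blast
    \<comment> \<open>Each isotopy of length \<open>x\<close> yields, by a time change fixing both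
      endpoints, an isotopy to the same map whose maximal speed is at most
      \<open>x + \<epsilon>\<close>.\<close>
    have "Inf ?Xi \<le> Inf ?X1"
    proof (rule cInf_greatest[OF False])
      fix x assume "x \<in> ?X1"
      then obtain \<Phi> U H where q: "Q \<Phi> U H" and x: "x = length_one A b h U H" by blast
      show "Inf ?Xi \<le> x"
      proof (rule field_le_epsilon)
        fix \<epsilon> :: real assume \<epsilon>: "0 < \<epsilon>"
        obtain \<xi> \<xi>' where \<xi>: "\<And>k. C_on k UNIV \<xi>" "\<xi> 0 = 0" "\<xi> 1 = 1" "\<And>t. t \<in> {0..1} \<Longrightarrow> \<xi> t \<in> {0..1}"
          "\<And>t. (\<xi> has_real_derivative \<xi>' t) (at t)" "\<And>t. 0 < \<xi>' t"
          "\<And>t. t \<in> {0..1} \<Longrightarrow> \<xi>' t * speed A b h U H (\<xi> t) \<le> integral {0..1} (speed A b h U H) + \<epsilon>"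
          using constant_speed_reparametrization[OF sp[OF q] \<epsilon>] by metis
        let ?U = "\<lambda>t p. \<xi>' t * U (\<xi> t) p" and ?H = "\<lambda>t \<kappa> p. \<xi>' t *\<^sub>R H (\<xi> t) \<kappa> p"
        have \<Phi>: "symplectic_isotopy A \<omega> \<Phi>" "isotopy_hodge A \<omega> G \<Phi> U H" "\<Phi> 1 = \<phi>" using q by (auto simp: Q_def)
        have "Q (\<lambda>t. \<Phi> (\<xi> t)) ?U ?H"
          using isotopy_reparametrize(1,2)[OF \<Phi>(1,2) \<xi>(1,2,4,5,6)] \<Phi>(3) by (simp add: Q_def \<xi>(3))
        then have "length_infty A b h ?U ?H \<in> ?Xi" by blast
        moreover have "length_infty A b h ?U ?H \<le> x + \<epsilon>"
          unfolding length_infty_def x length_one_def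
        proof (rule cSup_least)
          fix s assume "s \<in> speed A b h ?U ?H ` {0..1}"
          then obtain t where t: "t \<in> {0..1}" "s = speed A b h ?U ?H t" by blast
          show "s \<le> integral {0..1} (speed A b h U H) + \<epsilon>"
            using isotopy_reparametrize(3)[OF \<Phi>(1,2) \<xi>(1,2,4,5,6) t(1)] \<xi>(7)[OF t(1)]
            unfolding t(2) by (rule order_trans)
        qed simp
        ultimately show "Inf ?Xi \<le> x + \<epsilon>" using bddi by (rule cInf_lower2)
      qed
    qed
    moreover have "Inf ?X1 \<le> Inf ?Xi"
    proof (rule cInf_greatest[OF ne])
      fix x assume "x \<in> ?Xi"
      then obtain \<Phi> U H where q: "Q \<Phi> U H" and x: "x = length_infty A b h U H" by blast
      have "length_one A b h U H \<in> ?X1" using q by blast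
      then show "Inf ?X1 \<le> x" using one(2)[OF q] bdd1 unfolding x by (rule cInf_lower2)
    qed
    ultimately show ?thesis unfolding e by simp
  qed
qed

end

theorem lemma3p6:
  fixes A :: "('a::{t2_space, second_countable_topology}, 'n::finite + 'n) chart set"
    and \<omega> G :: "('a, 'n + 'n) mat_field"
    and b :: nat
    and h :: "nat \<Rightarrow> ('a, 'n + 'n) vec_field"
    and \<phi> :: "'a \<Rightarrow> 'a"
  assumes "closed_connected_manifold A"
    and "symplectic_form A \<omega>"
    and "riemannian_metric A G"
    and "harmonic_basis A G b h"
    and "\<phi> \<in> Symp0 A \<omega>"
  shows "HL_norm_infty A \<omega> G b h \<phi> = HL_norm_one A \<omega> G b h \<phi>"
  unfolding HL_norm_infty_def HL_norm_one_def energy_infty_eq_energy_one[OF assms(1-4)] ..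

end
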